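(* Let $G$ be a $2$-connected multigraph which contains $K_5$, the cube graph $Q_3$, or the octahedron graph $K_{2,2,2}$ as a minor. Then $G$ has a three-dimensional injective super stable tensegrity realization.
   Context: A multigraph is a finite undirected graph that may contain parallel edges but no loops. A tensegrity realization of $G$ in $\mathbb{R}^d$ is $(G,\sigma,p)$ with $\sigma:E(G)\to\{+,-\}$ and $p:V(G)\to\mathbb{R}^d$; it is injective if $p$ is injective. With $V(G)=\{1,\dots,n\}$ and standard basis $\mathbf{e}_i$, for $\omega:E(G)\to\mathbb{R}$ put $L_{G,\omega}=\sum_{e\in E(G)}\omega(e)(\mathbf{e}_i-\mathbf{e}_j)(\mathbf{e}_i-\mathbf{e}_j)^\top$ ($i,j$ endpoints of $e$). $\omega$ is an equilibrium stress if $\sum_{e \text{ joins } i,j}\omega(e)(p(j)-p(i))=0$ for every vertex $i$, strictly proper if $\sigma(e)\omega(e)>0$ for all $e$. A tensegrity whose points affinely span $\mathbb{R}^d$ is a $d$-dimensional super stable tensegrity if (i) some strictly proper equilibrium stress $\omega$ has $L_{G,\omega}\succeq0$ and $\dim\ker L_{G,\omega}=d+1$, and (ii) no nonzero symmetric $d\times d$ matrix $S$ has $(p(j)-p(i))^\top S(p(j)-p(i))=0$ for all edges $ij$. Minors are in the usual sense (loops from contraction deleted). *)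

theory Defs
  imports "HOL-Analysis.Analysis"
begin

section \<open>Multigraphs\<close>

record ('v, 'e) mgraph =
  verts :: "'v set"
  edges :: "'e set"
  ends :: "'e \<Rightarrow> 'v set"

definition multigraph :: "('v, 'e) mgraph \<Rightarrow> bool" where
  "multigraph G \<longleftrightarrow> finite (verts G) \<and> finite (edges G) \<and>
     (\<forall>e\<in>edges G. ends G e \<subseteq> verts G \<and> card (ends G e) = 2)"

definition joins :: "('v, 'e) mgraph \<Rightarrow> 'e \<Rightarrow> 'v \<Rightarrow> 'v \<Rightarrow> bool" where
  "joins G e i j \<longleftrightarrow> e \<in> edges G \<and> ends G e = {i, j}"

definition delete_edge :: "('v, 'e) mgraph \<Rightarrow> 'e \<Rightarrow> ('v, 'e) mgraph" where
  "delete_edge G e = G\<lparr>edges := edges G - {e}\<rparr>"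

definition delete_vertex :: "('v, 'e) mgraph \<Rightarrow> 'v \<Rightarrow> ('v, 'e) mgraph" where
  "delete_vertex G v = G\<lparr>verts := verts G - {v}, edges := {e \<in> edges G. v \<notin> ends G e}\<rparr>"

text \<open>Contraction of an edge joining \<open>u\<close> and \<open>v\<close>; the merged vertex is called \<open>u\<close>. All edges
  joining \<open>u\<close> and \<open>v\<close> would become loops and are deleted; other parallel edges are kept.\<close>

definition contract :: "('v, 'e) mgraph \<Rightarrow> 'v \<Rightarrow> 'v \<Rightarrow> ('v, 'e) mgraph" where
  "contract G u v =
     \<lparr>verts = verts G - {v},
      edges = {e \<in> edges G. ends G e \<noteq> {u, v}},
      ends = (\<lambda>e. (\<lambda>x. if x = v then u else x) ` ends G e)\<rparr>"

definition connected_graph :: "('v, 'e) mgraph \<Rightarrow> bool" where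
  "connected_graph G \<longleftrightarrow> verts G \<noteq> {} \<and>
     (\<forall>u\<in>verts G. \<forall>v\<in>verts G. (u, v) \<in> {(a, b). \<exists>e. joins G e a b}\<^sup>*)"

definition two_connected :: "('v, 'e) mgraph \<Rightarrow> bool" where
  "two_connected G \<longleftrightarrow> card (verts G) > 2 \<and> connected_graph G \<and>
     (\<forall>v\<in>verts G. connected_graph (delete_vertex G v))"

section \<open>Minors\<close>

inductive minor_step :: "('v, 'e) mgraph \<Rightarrow> ('v, 'e) mgraph \<Rightarrow> bool" where
  "e \<in> edges G \<Longrightarrow> minor_step G (delete_edge G e)"
| "v \<in> verts G \<Longrightarrow> minor_step G (delete_vertex G v)"
| "joins G e u v \<Longrightarrow> minor_step G (contract G u v)"

definition mgraph_iso :: "('v, 'e) mgraph \<Rightarrow> ('w, 'f) mgraph \<Rightarrow> bool" where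
  "mgraph_iso G H \<longleftrightarrow> (\<exists>f g. bij_betw f (verts G) (verts H) \<and> bij_betw g (edges G) (edges H) \<and>
     (\<forall>e\<in>edges G. ends H (g e) = f ` ends G e))"

definition has_minor :: "('v, 'e) mgraph \<Rightarrow> ('w, 'f) mgraph \<Rightarrow> bool" where
  "has_minor G H \<longleftrightarrow> (\<exists>K. minor_step\<^sup>*\<^sup>* G K \<and> mgraph_iso K H)"

text \<open>Simple graphs: an edge is its own set of end vertices.\<close>

definition simple_graph :: "'v set \<Rightarrow> ('v \<Rightarrow> 'v \<Rightarrow> bool) \<Rightarrow> ('v, 'v set) mgraph" where
  "simple_graph V adj =
     \<lparr>verts = V, edges = {{x, y} | x y. x \<in> V \<and> y \<in> V \<and> adj x y}, ends = (\<lambda>e. e)\<rparr>"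

definition K5 :: "(nat, nat set) mgraph" where
  "K5 = simple_graph {..<5} (\<lambda>x y. x \<noteq> y)"

definition Q3 :: "(bool ^ 3, (bool ^ 3) set) mgraph" where
  "Q3 = simple_graph UNIV (\<lambda>x y. card {i. x $ i \<noteq> y $ i} = 1)"

text \<open>The first component of a vertex of \<open>K\<^sub>2\<^sub>,\<^sub>2\<^sub>,\<^sub>2\<close> is its colour class.\<close>

definition K222 :: "(nat \<times> nat, (nat \<times> nat) set) mgraph" where
  "K222 = simple_graph ({..<3} \<times> {..<2}) (\<lambda>x y. fst x \<noteq> fst y)"

section \<open>Weighted Laplacians\<close>

text \<open>Vertices are taken from a finite type \<open>'v\<close>, and \<open>\<real>\<^bsup>V(G)\<^esup>\<close> is the subspace of \<open>real ^ 'v\<close> of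
  vectors vanishing outside \<open>verts G\<close>. It is all of \<open>real ^ 'v\<close> if \<open>verts G = UNIV\<close>.\<close>

text \<open>\<open>edge_vec G e\<close> is determined up to sign only, so \<open>edge_matrix G e\<close> is well defined;
  see \<open>edge_matrix_eq\<close> below.\<close>

definition edge_vec :: "('v::finite, 'e) mgraph \<Rightarrow> 'e \<Rightarrow> real ^ 'v" where
  "edge_vec G e = (SOME x. \<exists>i j. ends G e = {i, j} \<and> i \<noteq> j \<and> x = axis i 1 - axis j 1)"

definition edge_matrix :: "('v::finite, 'e) mgraph \<Rightarrow> 'e \<Rightarrow> real ^ 'v ^ 'v" where
  "edge_matrix G e =
     (columnvector (edge_vec G e) :: real ^ 1 ^ 'v) ** (rowvector (edge_vec G e) :: real ^ 'v ^ 1)"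

definition laplacian :: "('v::finite, 'e) mgraph \<Rightarrow> ('e \<Rightarrow> real) \<Rightarrow> real ^ 'v ^ 'v" where
  "laplacian G \<omega> = (\<Sum>e\<in>edges G. \<omega> e *\<^sub>R edge_matrix G e)"

lemma edge_matrix_eq:
  fixes G :: "('v::finite, 'e) mgraph" and i j :: 'v
  assumes "ends G e = {i, j}" "i \<noteq> j"
  defines "x \<equiv> axis i (1::real) - axis j 1"
  shows "edge_matrix G e = (columnvector x :: real ^ 1 ^ 'v) ** (rowvector x :: real ^ 'v ^ 1)"
proof -
  have "\<exists>a b. ends G e = {a, b} \<and> a \<noteq> b \<and> edge_vec G e = axis a 1 - axis b 1"
    unfolding edge_vec_def by (rule someI_ex) (use assms in blast)
  then have "edge_vec G e = x \<or> edge_vec G e = - x"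
    using assms(1) unfolding x_def by (auto simp: doubleton_eq_iff)
  then show ?thesis
    by (auto simp: edge_matrix_def columnvector_def rowvector_def matrix_matrix_mult_def vec_eq_iff)
qed

definition laplacian_kernel :: "('v::finite, 'e) mgraph \<Rightarrow> ('e \<Rightarrow> real) \<Rightarrow> (real ^ 'v) set" where
  "laplacian_kernel G \<omega> = {x. (\<forall>i. i \<notin> verts G \<longrightarrow> x $ i = 0) \<and> laplacian G \<omega> *v x = 0}"

definition pos_semidef :: "real ^ 'n ^ 'n \<Rightarrow> bool" where
  "pos_semidef A \<longleftrightarrow> transpose A = A \<and> (\<forall>x. x \<bullet> (A *v x) \<ge> 0)"

section \<open>Tensegrities\<close>

text \<open>The signs \<open>+\<close> and \<open>-\<close> are the reals \<open>1\<close> and \<open>-1\<close>. Values of \<open>\<sigma>\<close> and \<open>\<omega>\<close> outside the edge set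
  and of \<open>p\<close> outside the vertex set are irrelevant.\<close>

definition tensegrity :: "('v, 'e) mgraph \<Rightarrow> ('e \<Rightarrow> real) \<Rightarrow> ('v \<Rightarrow> real ^ 'd) \<Rightarrow> bool" where
  "tensegrity G \<sigma> p \<longleftrightarrow> multigraph G \<and> \<sigma> \<in> edges G \<rightarrow> {1, -1}"

definition injective_realization :: "('v, 'e) mgraph \<Rightarrow> ('v \<Rightarrow> real ^ 'd) \<Rightarrow> bool" where
  "injective_realization G p \<longleftrightarrow> inj_on p (verts G)"

definition equilibrium_stress ::
    "('v, 'e) mgraph \<Rightarrow> ('v \<Rightarrow> real ^ 'd) \<Rightarrow> ('e \<Rightarrow> real) \<Rightarrow> bool" where
  "equilibrium_stress G p \<omega> \<longleftrightarrow>
     (\<forall>i\<in>verts G. (\<Sum>j\<in>verts G. \<Sum>e | joins G e i j. \<omega> e *\<^sub>R (p j - p i)) = 0)"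

definition strictly_proper :: "('v, 'e) mgraph \<Rightarrow> ('e \<Rightarrow> real) \<Rightarrow> ('e \<Rightarrow> real) \<Rightarrow> bool" where
  "strictly_proper G \<sigma> \<omega> \<longleftrightarrow> (\<forall>e\<in>edges G. \<sigma> e * \<omega> e > 0)"

definition super_stable ::
    "('v::finite, 'e) mgraph \<Rightarrow> ('e \<Rightarrow> real) \<Rightarrow> ('v \<Rightarrow> real ^ 'd) \<Rightarrow> bool" where
  "super_stable G \<sigma> p \<longleftrightarrow>
     affine hull (p ` verts G) = UNIV \<and>
     (\<exists>\<omega>. equilibrium_stress G p \<omega> \<and> strictly_proper G \<sigma> \<omega> \<and>
        pos_semidef (laplacian G \<omega>) \<and> dim (laplacian_kernel G \<omega>) = CARD('d) + 1) \<and>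
     \<not> (\<exists>S :: real ^ 'd ^ 'd. S \<noteq> 0 \<and> transpose S = S \<and>
        (\<forall>e i j. joins G e i j \<longrightarrow> (p j - p i) \<bullet> (S *v (p j - p i)) = 0))"

end

theory Submission
  imports Defs
begin

text \<open>
  A super stable realization with stress \<open>\<omega>\<close> is rebuilt across edge additions and vertex splits by
  minimizing the quartic energy \<open>\<Sum>f. \<omega>\<^sub>f l\<^sub>f + (l\<^sub>f - l\<^sub>f\<^sup>0)\<^sup>2
        + c l\<^sub>e\<close>, where \<open>l\<^sub>f\<close> is the squared length of the
  edge \<open>f\<close> and \<open>e\<close> is the new edge. Without its last term the energy is nonnegative and, by super
  stability, vanishes exactly on the congruent copies of the given realization. So as \<open>c \<rightarrow> 0\<close> (a new
  edge) or \<open>c \<rightarrow> \<infinity>\<close> (the two halves of a split vertex), the minimizers converge to such a copy.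
  Criticality of a minimizer says that \<open>\<omega>\<^sub>f + 2 (l\<^sub>f - l\<^sub>f\<^sup>0)\<close>, extended
    by \<open>c\<close> on \<open>e\<close>, is an equilibrium stress
  for it; the other conditions of super stability are open.

  The two halves of a split vertex must not coincide. This is ensured by carrying along a genericity
  condition: at every vertex, no sum of the forces over a nonempty proper subset of the incident edges
  vanishes. It survives both operations, because complementary partial sums are opposite, as long as
  each half of a split vertex has an edge other than the new one, which 2-connectivity provides.

  A 2-connected graph with a minor model of \<open>H\<close> is contracted, keeping 2-connectivity, along edges inside
  the branch sets until \<open>H\<close> is a spanning subgraph. For \<open>K\<^sub>5\<close>, \<open>Q\<^sub>3\<close>
    and \<open>K\<^sub>2\<^sub>,\<^sub>2\<^sub>,\<^sub>2\<close> generic stresses are explicit.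
\<close>

section \<open>Super stable stresses\<close>

text \<open>So the usual continuation of a placement by the implicit function theorem does not
  apply, and a variational principle has to produce points and stress at once. The linear part of
  the energy is the Laplacian form summed over the three coordinates. It vanishes on every affine
  image of the given points, hence cannot keep minimizers bounded; the squared part adds the
  preference for the given edge lengths, and condition (ii) on the edge directions turns a
  length-preserving affine map into an isometry. This is why the limits are congruent copies, to
  which all conditions transfer.

  Signs need not be tracked: \<open>\<sigma>\<close> can be chosen last, as the sign of the stress,
  so only nonvanishing has to survive. The weight of a split edge diverges, so limits are taken over
  old edges only, and statements about the new edge are obtained from equilibrium by passing to the
  complementary edges at a vertex.\<close>

abbreviation edge_diff :: "('e \<Rightarrow> 'v) \<Rightarrow> ('e \<Rightarrow> 'v) \<Rightarrow> ('v \<Rightarrow> 'a::minus) \<Rightarrow> 'e \<Rightarrow> 'a" where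
  "edge_diff s t x e \<equiv> x (s e) - x (t e)"

text \<open>The quadratic form of the weighted Laplacian. Edges carry an arbitrary orientation from
  \<open>s e\<close> to \<open>t e\<close>; edge differences enter in pairs here and in the notions
  below, so reversing an edge changes nothing. Parallel edges remain distinct elements of
  \<open>E\<close>.\<close>

definition energy :: "'e set \<Rightarrow> ('e \<Rightarrow> 'v) \<Rightarrow> ('e \<Rightarrow> 'v) \<Rightarrow> ('e \<Rightarrow> real) \<Rightarrow> ('v \<Rightarrow> real) \<Rightarrow> real" where
  "energy E s t w x = (\<Sum>e\<in>E. w e * (edge_diff s t x e)\<^sup>2)"

text \<open>A weak form of the balance of forces, tested against scalar functions \<open>x\<close>:
  the indicator of a vertex recovers the force there, and the coordinates of \<open>p\<close> as
  test functions yield the vanishing of the total energy.\<close>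

definition in_equilibrium ::
    "'e set \<Rightarrow> ('e \<Rightarrow> 'v) \<Rightarrow> ('e \<Rightarrow> 'v) \<Rightarrow> ('e \<Rightarrow> real) \<Rightarrow> ('v \<Rightarrow> real ^ 3) \<Rightarrow> bool" where
  "in_equilibrium E s t w p \<longleftrightarrow>
     (\<forall>x. (\<Sum>e\<in>E. (w e * edge_diff s t x e) *\<^sub>R edge_diff s t p e) = 0)"

text \<open>The constraint \<open>C\<close> makes room for the glued situation, in which only
  functions equal at both ends of the new edge are controlled. The second clause is one half of the
  kernel condition; the other half, that affine functions of \<open>p\<close> lie in the kernel,
  comes from equilibrium.\<close>

definition pos_energy_on :: "(('v \<Rightarrow> real) \<Rightarrow> bool) \<Rightarrow> 'v set \<Rightarrow> 'e set \<Rightarrow> ('e \<Rightarrow> 'v) \<Rightarrow> ('e \<Rightarrow> 'v) \<Rightarrow>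
    ('e \<Rightarrow> real) \<Rightarrow> ('v \<Rightarrow> real ^ 3) \<Rightarrow> bool" where
  "pos_energy_on C V E s t w p \<longleftrightarrow>
     (\<forall>x. C x \<longrightarrow> 0 \<le> energy E s t w x \<and>
       (energy E s t w x = 0 \<longrightarrow> (\<exists>a b. \<forall>i\<in>V. x i = a \<bullet> p i + b)))"

text \<open>The dual form of a full affine hull. A violating pair \<open>(a, b)\<close> can be
  scaled to norm one, which suits compactness arguments.\<close>

definition affinely_spanning :: "'v set \<Rightarrow> ('v \<Rightarrow> real ^ 3) \<Rightarrow> bool" where
  "affinely_spanning V p \<longleftrightarrow> (\<forall>a b. (\<forall>i\<in>V. a \<bullet> p i + b = 0) \<longrightarrow> a = 0 \<and> b = 0)"

definition conic_free :: "'e set \<Rightarrow> ('e \<Rightarrow> 'v) \<Rightarrow> ('e \<Rightarrow> 'v) \<Rightarrow> ('v \<Rightarrow> real ^ 3) \<Rightarrow> bool" where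
  "conic_free E s t p \<longleftrightarrow> (\<forall>S :: real ^ 3 ^ 3. transpose S = S \<longrightarrow>
     (\<forall>e\<in>E. edge_diff s t p e \<bullet> (S *v edge_diff s t p e) = 0) \<longrightarrow> S = 0)"

definition superstable_stress :: "'v set \<Rightarrow> 'e set \<Rightarrow> ('e \<Rightarrow> 'v) \<Rightarrow> ('e \<Rightarrow> 'v) \<Rightarrow>
    ('e \<Rightarrow> real) \<Rightarrow> ('v \<Rightarrow> real ^ 3) \<Rightarrow> bool" where
  "superstable_stress V E s t w p \<longleftrightarrow> in_equilibrium E s t w p \<and>
     pos_energy_on (\<lambda>_. True) V E s t w p \<and> affinely_spanning V p \<and> conic_free E s t p"

section \<open>Openness of super stability along convergent sequences\<close>

text \<open>Bad points for infinitely many \<open>k\<close> would accumulate in \<open>K\<close>.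
  The reindexing \<open>r\<close> is exposed in the hypothesis so that the other data depending on
  \<open>k\<close> can be passed to the limit along the same subsequence.\<close>

lemma eventually_compact:
  fixes K :: "'a::metric_space set"
  assumes "compact K"
    and "\<And>(r :: nat \<Rightarrow> nat) xs l. \<lbrakk>strict_mono r; \<And>k. xs k \<in> K; \<And>k. B (r k) (xs k); xs \<longlonglongrightarrow> l; l \<in> K\<rbrakk> \<Longrightarrow> False"
  shows "\<forall>\<^sub>F k in sequentially. \<forall>x\<in>K. \<not> B k x"
proof (rule ccontr)
  assume "\<not> ?thesis"
  then have "\<forall>N. \<exists>k\<ge>N. \<exists>x\<in>K. B k x"
    by (auto simp: eventually_sequentially)
  then have inf: "infinite {k. \<exists>x\<in>K. B k x}"
    unfolding infinite_nat_iff_unbounded_le by blast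
  define r where "r = enumerate {k. \<exists>x\<in>K. B k x}"
  have r: "strict_mono r"
    using inf by (simp add: r_def strict_mono_enumerate)
  have "\<exists>x\<in>K. B (r k) x" for k
    using enumerate_in_set[OF inf, of k] by (auto simp: r_def)
  then obtain xs where xs: "\<And>k. xs k \<in> K" "\<And>k. B (r k) (xs k)"
    by metis
  obtain l r' where l: "l \<in> K" "strict_mono r'" "(xs \<circ> r') \<longlonglongrightarrow> l"
    using assms(1) xs(1) unfolding compact_def by blast
  have "strict_mono (r \<circ> r')"
    using r l(2) by (simp add: strict_mono_o)
  then show False
    using assms(2)[of "r \<circ> r'" "xs \<circ> r'" l] xs l by simp
qed

lemma tendsto_quadratic_form:
  fixes S :: "'a \<Rightarrow> real ^ 'n ^ 'n"
  assumes "(S \<longlongrightarrow> A) F" "(d \<longlongrightarrow> v) F"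
  shows "((\<lambda>k. d k \<bullet> (S k *v d k)) \<longlongrightarrow> v \<bullet> (A *v v)) F"
  unfolding matrix_vector_mult_def using assms by (intro tendsto_intros tendsto_vec_lambda)

text \<open>The penalty argument: an infinite weight with bounded cost forces the penalized quantity
  to vanish. It glues the ends of a split edge, both for limits of test vectors and for limits of
  minimizers.\<close>

lemma filterlim_at_top_mult_bounded_zero:
  fixes c y :: "nat \<Rightarrow> real"
  assumes "filterlim c at_top sequentially" "\<And>k. c k > 0" "\<And>k. c k * (y k)\<^sup>2 \<le> h k" "h \<longlonglongrightarrow> H"
    "y \<longlonglongrightarrow> l"
  shows "l = 0"
proof -
  have "(\<lambda>k. h k / c k) \<longlonglongrightarrow> 0"
    using assms(1,4) by (rule real_tendsto_divide_at_top[rotated])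
  moreover have "(\<lambda>k. (y k)\<^sup>2) \<longlonglongrightarrow> l\<^sup>2"
    using assms(5) by (intro tendsto_intros)
  moreover have "(y k)\<^sup>2 \<le> h k / c k" for k
    using assms(2,3)[of k] by (simp add: field_simps)
  ultimately have "l\<^sup>2 \<le> 0"
    by (meson LIMSEQ_le)
  then show ?thesis by simp
qed

text \<open>Equilibrium is a closed condition and has to be given for every \<open>k\<close>; the
  other three conditions are open once scaling is factored out, by restriction to unit spheres.
  Positivity needs more care, because the kernel is never trivial and moves with \<open>p k\<close>.
  About the weight of \<open>e\<close>, only its sign is required unless the edge is split: a
  positive weight can only raise the energy.\<close>

lemma eventually_superstable_stress:
  fixes V :: "'v::finite set" and E :: "'e set" and p :: "nat \<Rightarrow> 'v \<Rightarrow> real ^ 3"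
  assumes fin: "finite E" and e: "e \<notin> E"
    and ends: "\<And>f. f \<in> insert e E \<Longrightarrow> s f \<in> V \<and> t f \<in> V"
    and p: "\<And>i. i \<in> V \<Longrightarrow> (\<lambda>k. p k i) \<longlonglongrightarrow> q i"
    and w: "\<And>f. f \<in> E \<Longrightarrow> (\<lambda>k. w k f) \<longlonglongrightarrow> wlim f"
    and pos: "\<And>k. w k e > 0"
    and split: "split \<Longrightarrow> filterlim (\<lambda>k. w k e) at_top sequentially"
    and equil: "\<And>k. in_equilibrium (insert e E) s t (w k) (p k)"
    and psd: "pos_energy_on (\<lambda>x. split \<longrightarrow> x (s e) = x (t e)) V E s t wlim q"
    and aff: "affinely_spanning V q"
    and con: "conic_free E s t q"
  shows "\<forall>\<^sub>F k in sequentially. superstable_stress V (insert e E) s t (w k) (p k)"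
proof -
  have energy_insert: "energy (insert e E) s t (w k) x = w k e * (edge_diff s t x e)\<^sup>2
        + energy E s t (w k) x" for k x
    using fin e by (simp add: energy_def)
  have lim_diff: "(\<lambda>k. edge_diff s t (p (r k)) f) \<longlonglongrightarrow> edge_diff s t q f"
    if "f \<in> E" "strict_mono r" for f and r :: "nat \<Rightarrow> nat"
    using LIMSEQ_subseq_LIMSEQ[OF p[of "s f"] that(2)] LIMSEQ_subseq_LIMSEQ[OF p[of "t f"] that(2)] ends[of
      f] that(1)
    by (auto simp: o_def intro!: tendsto_diff)
  have ev_aff: "\<forall>\<^sub>F k in sequentially. affinely_spanning V (p k)"
  proof -
    have "\<forall>\<^sub>F k in sequentially. \<forall>ab\<in>sphere (0 :: (real ^ 3) \<times> real) 1. \<not> (\<forall>i\<in>V. fst ab \<bullet> p k i + snd ab = 0)"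
    proof (rule eventually_compact)
      fix r :: "nat \<Rightarrow> nat" and xs :: "nat \<Rightarrow> (real ^ 3) \<times> real" and l
      assume *: "strict_mono r" "\<And>k. \<forall>i\<in>V. fst (xs k) \<bullet> p (r k) i + snd (xs k) = 0" "xs \<longlonglongrightarrow> l" "l \<in> sphere 0 1"
      have "fst l \<bullet> q i + snd l = 0" if "i \<in> V" for i
      proof -
        have "(\<lambda>k. fst (xs k) \<bullet> p (r k) i + snd (xs k)) \<longlonglongrightarrow> fst l \<bullet> q i + snd l"
          using LIMSEQ_subseq_LIMSEQ[OF p[OF that] *(1)] *(3) by (auto intro!: tendsto_intros simp: o_def)
        then show ?thesis using *(2) that by (simp add: LIMSEQ_const_iff)
      qed
      then have "fst l = 0 \<and> snd l = 0" using aff unfolding affinely_spanning_def by blast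
      then have "l = 0" by (simp add: prod_eq_iff)
      then show False using *(4) by simp
    qed simp
    then show ?thesis
    proof (rule eventually_mono)
      fix k assume *: "\<forall>ab\<in>sphere (0 :: (real ^ 3) \<times> real) 1. \<not> (\<forall>i\<in>V. fst ab \<bullet> p k i + snd ab = 0)"
      show "affinely_spanning V (p k)"
        unfolding affinely_spanning_def
      proof (intro allI impI)
        fix a b assume ab: "\<forall>i\<in>V. a \<bullet> p k i + b = 0"
        show "a = 0 \<and> b = 0"
        proof (rule ccontr)
          assume "\<not> (a = 0 \<and> b = 0)"
          then have n: "norm (a, b) \<noteq> 0" by (simp add: zero_prod_def)
          define n where "n = inverse (norm (a, b))"
          have "n *\<^sub>R (a, b) \<in> sphere 0 1" using n by (simp add: n_def del: scaleR_Pair)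
          then obtain i where "i \<in> V" "n * (a \<bullet> p k i) + n * b \<noteq> 0"
            using *[rule_format, of "n *\<^sub>R (a, b)"] by auto
          then show False using ab by (simp flip: distrib_left)
        qed
      qed
    qed
  qed
  have ev_con: "\<forall>\<^sub>F k in sequentially. conic_free (insert e E) s t (p k)"
  proof -
    let ?K = "sphere (0 :: real ^ 3 ^ 3) 1"
    have "\<forall>\<^sub>F k in sequentially. \<forall>S\<in>?K. \<not> (transpose S = S \<and>
          (\<forall>e\<in>E. edge_diff s t (p k) e \<bullet> (S *v edge_diff s t (p k) e) = 0))"
    proof (rule eventually_compact)
      fix r :: "nat \<Rightarrow> nat" and xs :: "nat \<Rightarrow> real ^ 3 ^ 3" and l
      assume *: "strict_mono r" "\<And>k. transpose (xs k) = xs k \<and>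
            (\<forall>e\<in>E. edge_diff s t (p (r k)) e \<bullet> (xs k *v edge_diff s t (p (r k)) e) = 0)" "xs \<longlonglongrightarrow> l" "l \<in> ?K"
      have "edge_diff s t q f \<bullet> (l *v edge_diff s t q f) = 0" if "f \<in> E" for f
      proof -
        have "(\<lambda>k. edge_diff s t (p (r k)) f \<bullet> (xs k *v edge_diff s t (p (r k)) f))
              \<longlonglongrightarrow> edge_diff s t q f \<bullet> (l *v edge_diff s t q f)"
          using *(3) lim_diff[OF that *(1)] by (rule tendsto_quadratic_form)
        then show ?thesis using *(2) that by (simp add: LIMSEQ_const_iff)
      qed
      moreover have "transpose l = l"
      proof -
        have "(\<lambda>k. transpose (xs k)) \<longlonglongrightarrow> transpose l"
          unfolding transpose_def using *(3) by (intro tendsto_intros tendsto_vec_lambda)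
        then show ?thesis using *(2,3) LIMSEQ_unique by auto
      qed
      ultimately have "l = 0" using con unfolding conic_free_def by blast
      then show False using *(4) by simp
    qed simp
    then show ?thesis
    proof (rule eventually_mono)
      fix k assume *: "\<forall>S\<in>?K. \<not> (transpose S = S \<and>
            (\<forall>e\<in>E. edge_diff s t (p k) e \<bullet> (S *v edge_diff s t (p k) e) = 0))"
      show "conic_free (insert e E) s t (p k)"
        unfolding conic_free_def
      proof (intro allI impI)
        fix S :: "real ^ 3 ^ 3"
        assume S: "transpose S = S" "\<forall>e\<in>insert e E. edge_diff s t (p k) e \<bullet> (S *v edge_diff s t (p k) e) = 0"
        show "S = 0"
        proof (rule ccontr)
          assume n: "S \<noteq> 0"
          define n where "n = inverse (norm S)"
          have "n *\<^sub>R S \<in> ?K" using n by (simp add: n_def)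
          moreover have "transpose (n *\<^sub>R S) = n *\<^sub>R S" using S(1) by (simp add: transpose_scalar)
          ultimately show False using * S(2) by (auto simp: scaleR_matrix_vector_assoc[symmetric])
        qed
      qed
    qed
  qed
  have ev_psd: "\<forall>\<^sub>F k in sequentially. pos_energy_on (\<lambda>_. True) V (insert e E) s t (w k) (p k)"
  proof -
    let ?K = "sphere (0 :: real ^ 'v) 1"
    \<comment> \<open>The first two equations say that \<open>y\<close> is orthogonal to the
      constants and to the coordinate functions of \<open>p k\<close>, that is, to the kernel forced
      by equilibrium. On this moving complement the energy has to be strictly positive.\<close>
    define B where "B k y \<longleftrightarrow> (\<Sum>i\<in>V. y $ i) = 0 \<and> (\<Sum>i\<in>V. y $ i *\<^sub>R p k i) = 0 \<and> (\<forall>i. i \<notin> V \<longrightarrow> y $ i = 0) \<and>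
      energy (insert e E) s t (w k) (($) y) \<le> 0" for k and y :: "real ^ 'v"
    have "\<forall>\<^sub>F k in sequentially. \<forall>y\<in>?K. \<not> B k y"
    proof (rule eventually_compact)
      fix r :: "nat \<Rightarrow> nat" and xs :: "nat \<Rightarrow> real ^ 'v" and y
      assume r: "strict_mono r" and xs: "\<And>k. B (r k) (xs k)" and y: "xs \<longlonglongrightarrow> y" "y \<in> ?K"
      have "(\<lambda>k. (\<Sum>i\<in>V. xs k $ i)) \<longlonglongrightarrow> (\<Sum>i\<in>V. y $ i)"
        using y(1) by (intro tendsto_intros)
      then have y1: "(\<Sum>i\<in>V. y $ i) = 0" using xs by (simp add: B_def LIMSEQ_const_iff)
      have "(\<lambda>k. (\<Sum>i\<in>V. xs k $ i *\<^sub>R p (r k) i)) \<longlonglongrightarrow> (\<Sum>i\<in>V. y $ i *\<^sub>R q i)"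
        using y(1) LIMSEQ_subseq_LIMSEQ[OF p r] by (auto simp: o_def intro!: tendsto_intros)
      then have y2: "(\<Sum>i\<in>V. y $ i *\<^sub>R q i) = 0" using xs by (simp add: B_def LIMSEQ_const_iff)
      have y3: "y $ i = 0" if "i \<notin> V" for i
      proof -
        have "(\<lambda>k. xs k $ i) \<longlonglongrightarrow> y $ i" using y(1) by (intro tendsto_intros)
        then show ?thesis using xs that by (simp add: B_def LIMSEQ_const_iff)
      qed
      have lim: "(\<lambda>k. energy E s t (w (r k)) (($) (xs k))) \<longlonglongrightarrow> energy E s t wlim (($) y)"
        unfolding energy_def using y(1) LIMSEQ_subseq_LIMSEQ[OF w r]
          by (auto simp: o_def intro!: tendsto_intros)
      have le: "w (r k) e * (edge_diff s t (($) (xs k)) e)\<^sup>2 \<le> - energy E s t (w (r k)) (($) (xs k))" for k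
        using xs[of k] by (simp add: B_def energy_insert)
      have "energy E s t (w (r k)) (($) (xs k)) \<le> 0" for k
        using le[of k] pos[of "r k"] by (smt (verit) mult_nonneg_nonneg zero_le_power2)
      then have neg: "energy E s t wlim (($) y) \<le> 0"
        using lim by (meson LIMSEQ_le_const2)
      have "y $ s e = y $ t e" if "split"
      proof -
        have "filterlim (\<lambda>k. w (r k) e) at_top sequentially"
          using filterlim_compose[OF split[OF that] filterlim_subseq[OF r]] .
        moreover have "(\<lambda>k. edge_diff s t (($) (xs k)) e) \<longlonglongrightarrow> edge_diff s t (($) y) e"
          using y(1) by (intro tendsto_intros)
        ultimately have "edge_diff s t (($) y) e = 0"
          using pos le tendsto_minus[OF lim]
            by (intro filterlim_at_top_mult_bounded_zero[where c = "\<lambda>k. w (r k) e"])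
        then show ?thesis by simp
      qed
      then have "0 \<le> energy E s t wlim (($) y) \<and>
       (energy E s t wlim (($) y) = 0 \<longrightarrow> (\<exists>a b. \<forall>i\<in>V. y $ i = a \<bullet> q i + b))"
        using psd unfolding pos_energy_on_def by blast
      with neg obtain a b where ab: "\<forall>i\<in>V. y $ i = a \<bullet> q i + b" by auto
      \<comment> \<open>The limit \<open>y\<close> is an affine function of \<open>q\<close> by the
        kernel hypothesis and is orthogonal to all of these, so it is orthogonal to itself.\<close>
      have "y \<bullet> y = (\<Sum>i\<in>V. y $ i * y $ i)"
        unfolding inner_vec_def using y3 by (intro sum.mono_neutral_cong_right) auto
      also have "\<dots> = (\<Sum>i\<in>V. a \<bullet> (y $ i *\<^sub>R q i) + b * y $ i)"
        using ab by (intro sum.cong) (auto simp: algebra_simps)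
      also have "\<dots> = a \<bullet> (\<Sum>i\<in>V. y $ i *\<^sub>R q i) + b * (\<Sum>i\<in>V. y $ i)"
        by (simp add: sum.distrib inner_sum_right sum_distrib_left)
      also have "\<dots> = 0" using y1 y2 by simp
      finally show False using y(2) by simp
    qed simp
    then show ?thesis
    proof (rule eventually_mono)
      fix k assume nB: "\<forall>y\<in>?K. \<not> B k y"
      have main: "0 \<le> energy (insert e E) s t (w k) x \<and> (energy (insert e E) s t (w k) x = 0 \<longrightarrow>
            (\<exists>a b. \<forall>i\<in>V. x i = a \<bullet> p k i + b))" for x
      proof -
        \<comment> \<open>\<open>T\<close> consists of the affine functions of \<open>p k\<close>.
          Splitting off the component in \<open>T\<close> does not change the energy, so it suffices
          to consider the component orthogonal to \<open>T\<close>, to which the exclusion of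
          \<open>B\<close> applies after scaling.\<close>
        define T :: "(real ^ 'v) set" where "T = range (\<lambda>(a, b). \<chi> i. if i \<in> V then a \<bullet> p k i + b else 0)"
        have sub: "subspace T"
        proof -
          have "linear (\<lambda>(a, b). (\<chi> i. if i \<in> V then a \<bullet> p k i + b else 0) :: real ^ 'v)"
            by (rule linearI) (auto simp: vec_eq_iff algebra_simps inner_add_left)
          then show ?thesis unfolding T_def by (intro linear_subspace_image) auto
        qed
        define x' :: "real ^ 'v" where "x' = (\<chi> i. if i \<in> V then x i else 0)"
        have ex': "energy (insert e E) s t (w k) x = energy (insert e E) s t (w k) (($) x')"
          unfolding energy_def using ends by (intro sum.cong) (auto simp: x'_def)
        obtain u y where uy: "u \<in> span T" "\<And>v. v \<in> span T \<Longrightarrow> orthogonal y v" "x' = u + y"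
          using orthogonal_subspace_decomp_exists[of T x'] by metis
        have spT: "span T = T" using sub by (simp add: span_eq_iff)
        have "u \<in> T" using uy(1) spT by simp
        then obtain a b where u: "u = (\<chi> i. if i \<in> V then a \<bullet> p k i + b else 0)" by (auto simp: T_def)
        \<comment> \<open>The mixed term and the term of \<open>u\<close> alone are equilibrium
          sums, tested against \<open>y\<close> and against \<open>a \<bullet> p k\<close>; both
          vanish.\<close>
        have "energy (insert e E) s t (w k) (($) x') = energy (insert e E) s t (w k) (($) y) +
          2 * (a \<bullet> (\<Sum>f\<in>insert e E. (w k f * edge_diff s t (($) y) f) *\<^sub>R edge_diff s t (p k) f)) +
          a \<bullet> (\<Sum>f\<in>insert e E. (w k f * edge_diff s t (\<lambda>i. a \<bullet> p k i) f) *\<^sub>R edge_diff s t (p k) f)"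
          unfolding energy_def inner_sum_right sum_distrib_left sum.distrib[symmetric]
          using ends by (intro sum.cong) (auto simp: uy(3) u power2_eq_square algebra_simps inner_diff_right)
        also have "\<dots> = energy (insert e E) s t (w k) (($) y)"
          using equil[of k, unfolded in_equilibrium_def, rule_format, of "($) y"]
            equil[of k, unfolded in_equilibrium_def, rule_format, of "\<lambda>i. a \<bullet> p k i"]
              by (simp only: inner_zero_right mult_zero_right add_0_right)
        finally have exy: "energy (insert e E) s t (w k) x = energy (insert e E) s t (w k) (($) y)"
          using ex' by simp
        have orth: "(\<Sum>i\<in>V. y $ i * (a \<bullet> p k i + b)) = 0" for a b
        proof -
          have "y \<bullet> (\<chi> i. if i \<in> V then a \<bullet> p k i + b else 0) = 0"
            using uy(2)[unfolded spT] by (auto simp: T_def orthogonal_def)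
          moreover have "y \<bullet> (\<chi> i. if i \<in> V then a \<bullet> p k i + b else 0) = (\<Sum>i\<in>V. y $ i * (a \<bullet> p k i + b))"
            unfolding inner_vec_def by (intro sum.mono_neutral_cong_right) auto
          ultimately show ?thesis by simp
        qed
        have y1: "(\<Sum>i\<in>V. y $ i) = 0" using orth[of 0 1] by simp
        have y2: "(\<Sum>i\<in>V. y $ i *\<^sub>R p k i) = 0"
        proof -
          have "a \<bullet> (\<Sum>i\<in>V. y $ i *\<^sub>R p k i) = 0" for a
            using orth[of a 0] by (simp add: inner_sum_right)
          then show ?thesis by (metis inner_eq_zero_iff)
        qed
        have y3: "\<forall>i. i \<notin> V \<longrightarrow> y $ i = 0"
        proof (intro allI impI)
          fix i assume "i \<notin> V"
          then have "x' $ i = 0" "u $ i = 0" by (auto simp: x'_def u)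
          then show "y $ i = 0" using uy(3) by simp
        qed
        show ?thesis
        proof (cases "y = 0")
          case True
          then have "x' = u" using uy(3) by simp
          then have "x i = a \<bullet> p k i + b" if "i \<in> V" for i
            using u that by (auto simp: vec_eq_iff x'_def dest: spec[of _ i])
          moreover have "energy (insert e E) s t (w k) x = 0"
            unfolding exy True by (simp add: energy_def)
          ultimately show ?thesis by auto
        next
          case False
          define n where "n = inverse (norm y)"
          have n: "n > 0" using False by (simp add: n_def)
          have "n *\<^sub>R y \<in> ?K" using False by (simp add: n_def)
          then have "\<not> B k (n *\<^sub>R y)" using nB by blast
          moreover have "(\<Sum>i\<in>V. (n *\<^sub>R y) $ i) = 0" "(\<Sum>i\<in>V. (n *\<^sub>R y) $ i *\<^sub>R p k i) = 0"
            using y1 y2 by (simp_all add: scaleR_sum_right[symmetric] sum_distrib_left[symmetric]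
              flip: scaleR_scaleR)
          moreover have "energy (insert e E) s t (w k) (($) (n *\<^sub>R y)) =
                n\<^sup>2 * energy (insert e E) s t (w k) (($) y)"
            unfolding energy_def sum_distrib_left
              by (intro sum.cong) (auto simp: power2_eq_square algebra_simps)
          ultimately have "n\<^sup>2 * energy (insert e E) s t (w k) (($) y) > 0"
            using y3 by (auto simp: B_def)
          then have "energy (insert e E) s t (w k) (($) y) > 0" using n by (simp add: zero_less_mult_iff)
          then show ?thesis using exy by simp
        qed
      qed
      show "pos_energy_on (\<lambda>_. True) V (insert e E) s t (w k) (p k)"
        unfolding pos_energy_on_def using main by blast
    qed
  qed
  show ?thesis
    using ev_aff ev_con ev_psd by eventually_elim (simp add: superstable_stress_def equil)
qed

section \<open>Minimizers of the quartic energy\<close>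

lemma orthogonal_image_inner:
  fixes A :: "real ^ 'n ^ 'n"
  assumes "transpose A ** A = mat 1"
  shows "(A *v x) \<bullet> (A *v y) = x \<bullet> y"
  by (metis assms dot_lmul_matrix inner_commute matrix_vector_mul_assoc matrix_vector_mul_lid
    vector_transpose_matrix transpose_matrix_vector)

text \<open>If \<open>split\<close> holds, then the ends of \<open>e\<close> are regarded as glued in the limit: the energy of \<open>E\<close> is
  controlled only on vectors that agree on them. Otherwise the new weight of \<open>e\<close> tends to zero.\<close>

lemma perturb_stress:
  fixes V :: "'v::finite set" and E :: "'e set" and z :: "'v \<Rightarrow> real ^ 3"
  assumes fin: "finite E" and e: "e \<notin> E"
    and ends: "\<And>f. f \<in> insert e E \<Longrightarrow> s f \<in> V \<and> t f \<in> V"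
    and zs: "split \<Longrightarrow> z (s e) = z (t e)"
    and eq0: "(\<Sum>f\<in>E. w f * (norm (edge_diff s t z f))\<^sup>2) = 0"
    and psd: "pos_energy_on (\<lambda>x. split \<longrightarrow> x (s e) = x (t e)) V E s t w z"
    and aff: "affinely_spanning V z"
    and con: "conic_free E s t z"
  obtains p w' A b where
    "\<And>i. i \<in> V \<Longrightarrow> (\<lambda>k. p k i) \<longlonglongrightarrow> A *v z i + b"
    "transpose A ** A = mat 1"
    "\<And>f. f \<in> E \<Longrightarrow> (\<lambda>k. w' k f) \<longlonglongrightarrow> w f"
    "\<And>k. w' k e > 0"
    "\<forall>\<^sub>F k in sequentially. superstable_stress V (insert e E) s t (w' k) (p k)"
proof -
  \<comment> \<open>The shift by one keeps \<open>c\<close> positive at \<open>k = 0\<close>. It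
    also gives \<open>c k \<ge> 1\<close> in the split case, used in the lower bound for
    \<open>U\<close>, and \<open>c k \<le> 1\<close> otherwise, used in the upper bound by
    \<open>M\<close>.\<close>
  define c where "c k = (if split then real k + 1 else 1 / (real k + 1))" for k
  define len where "len f p = (norm (edge_diff s t p f))\<^sup>2" for f and p :: "'v \<Rightarrow> real ^ 3"
  \<comment> \<open>A quadratic form that is definite on \<open>S\<close>. The edge \<open>e\<close>
    is included only in the split case, where \<open>E\<close> alone need not determine the relative
    position of the two halves.\<close>
  define N where "N p = (\<Sum>f\<in>E. len f p) + (if split then len e p else 0)" for p
  define U0 where "U0 p = (\<Sum>f\<in>E. w f * len f p + (len f p - len f z)\<^sup>2)" for p
  define U where "U k p = U0 p + c k * len e p" for k p
  \<comment> \<open>The constant from completing the square in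
    \<open>(len f p - len f z + (w f - 1) / 2)\<^sup>2 \<ge> 0\<close>; it makes \<open>U0\<close>
    at least the sum of the squared lengths minus \<open>K\<close>.\<close>
  define K where "K = (\<Sum>f\<in>E. (w f - 1)\<^sup>2 / 4 - (w f - 1) * len f z)"
  \<comment> \<open>Pinning \<open>s e\<close> at the origin removes the translations, without which
    no sublevel set would be bounded.\<close>
  define S where "S = {p :: real ^ 3 ^ 'v. (\<forall>i. i \<notin> V \<longrightarrow> p $ i = 0) \<and> p $ s e = 0}"
  define M where "M = len e z"
  have c_pos: "c k > 0" for k by (simp add: c_def)
  have len_nonneg: "0 \<le> len f p" for f p by (simp add: len_def)
  have se: "s e \<in> V" using ends by blast
  have subS: "subspace S" by (auto simp: S_def subspace_def)
  have len_cont: "continuous_on UNIV (\<lambda>p :: real ^ 3 ^ 'v. len f (($) p))" for f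
    unfolding len_def by (intro continuous_intros)
  have N0: "p = 0" if "p \<in> S" "N (($) p) = 0" for p
  proof -
    have "\<forall>f\<in>E. len f (($) p) = 0" and sp: "split \<longrightarrow> len e (($) p) = 0"
      using that(2) fin len_nonneg unfolding N_def
      by (smt (verit) sum_nonneg sum_nonneg_eq_0_iff)+
    then have pf: "p $ s f = p $ t f" if "f \<in> E" for f using that by (simp add: len_def)
    have "p $ i $ j = 0" if i: "i \<in> V" for i j
    proof -
      have "split \<longrightarrow> p $ s e $ j = p $ t e $ j" using sp by (simp add: len_def)
      moreover have "energy E s t w (\<lambda>i. p $ i $ j) = 0"
        using pf by (simp add: energy_def)
      ultimately obtain a b where ab: "\<And>i. i \<in> V \<Longrightarrow> p $ i $ j = a \<bullet> z i + b"
        using psd[unfolded pos_energy_on_def, rule_format, of "\<lambda>i. p $ i $ j"] by blast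
      \<comment> \<open>A coordinate without edge differences has zero energy, so it is affine in
        \<open>z\<close> with some gradient \<open>a\<close>. This gradient is orthogonal to every
        edge direction, so the rank one form of \<open>a\<close> vanishes on all of them, and
        \<open>con\<close> gives \<open>a = 0\<close>.\<close>
      define T :: "real ^ 3 ^ 3" where "T = (\<chi> m n. a $ m * a $ n)"
      have T: "d \<bullet> (T *v d) = (a \<bullet> d)\<^sup>2" for d
        by (simp add: T_def inner_vec_def matrix_vector_mult_def power2_eq_square sum_product
          sum_distrib_left mult_ac)
      have "a \<bullet> edge_diff s t z f = 0" if "f \<in> E" for f
        using ab[of "s f"] ab[of "t f"] pf[OF that] ends[of f] that by (simp add: inner_diff_right)
      then have "T = 0"
        using con[unfolded conic_free_def, rule_format, of T] T
          by (auto simp: T_def transpose_def mult.commute)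
      then have "a = 0" by (auto simp: T_def vec_eq_iff)
      moreover have "p $ s e $ j = 0" using that \<open>p \<in> S\<close> by (simp add: S_def)
      ultimately show ?thesis using ab[OF i] ab[OF se] by simp
    qed
    then show ?thesis using that(1)
      unfolding S_def vec_eq_iff by (metis (mono_tags, lifting) mem_Collect_eq zero_index)
  qed
  have N_scale: "N (($) (a *\<^sub>R p)) = a\<^sup>2 * N (($) p)" for a p
    by (simp add: N_def len_def sum_distrib_left power_mult_distrib algebra_simps flip: scaleR_diff_right)
  have N_nonneg: "N p \<ge> 0" for p
    unfolding N_def using len_nonneg by (auto intro!: add_nonneg_nonneg sum_nonneg)
  obtain m where m: "m > 0" "\<And>p. p \<in> S \<Longrightarrow> m * (norm p)\<^sup>2 \<le> N (($) p)"
  proof -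
    let ?K = "sphere 0 1 \<inter> S"
    have "\<exists>m>0. \<forall>p\<in>?K. m \<le> N (($) p)"
    proof (cases "?K = {}")
      case True
      then show ?thesis by (intro exI[of _ 1]) auto
    next
      case False
      have "compact ?K" using subS by (simp add: closed_subspace compact_Int_closed)
      moreover have "continuous_on ?K (\<lambda>p. N (($) p))"
        unfolding N_def using len_cont
          by (cases "split") (auto intro!: continuous_intros intro: continuous_on_subset)
      ultimately obtain p0 where p0: "p0 \<in> ?K" "\<forall>p\<in>?K. N (($) p0) \<le> N (($) p)"
        using False continuous_attains_inf by blast
      then have "N (($) p0) \<noteq> 0" using N0[of p0] by auto
      then show ?thesis using p0(2) N_nonneg by (metis order_le_less)
    qed
    then obtain m where m: "m > 0" "\<And>p. p \<in> ?K \<Longrightarrow> m \<le> N (($) p)" by blast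
    have "m * (norm p)\<^sup>2 \<le> N (($) p)" if "p \<in> S" for p
    proof (cases "p = 0")
      case True then show ?thesis using N_nonneg by simp
    next
      case False
      have "m \<le> N (($) (inverse (norm p) *\<^sub>R p))"
        using False that subS by (intro m) (auto simp: subspace_scale)
      also have "\<dots> = N (($) p) / (norm p)\<^sup>2" by (simp add: N_scale field_simps)
      finally show ?thesis using False by (simp add: field_simps)
    qed
    with m(1) that show thesis by blast
  qed
  have U0_lower: "U0 p \<ge> (\<Sum>f\<in>E. len f p) - K" for p
  proof -
    have "len f p - ((w f - 1)\<^sup>2 / 4 - (w f - 1) * len f z) \<le> w f * len f p + (len f p - len f z)\<^sup>2" for f
    proof -
      have "0 \<le> (len f p - len f z + (w f - 1) / 2)\<^sup>2" by simp
      then show ?thesis by (simp add: power2_eq_square algebra_simps)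
    qed
    then show ?thesis unfolding U0_def K_def sum_subtractf[symmetric] by (intro sum_mono)
  qed
  have U_lower: "U k p \<ge> N p - K" for k p
  proof -
    have "(if split then len e p else 0) \<le> c k * len e p"
      using len_nonneg[of e p] by (auto simp: c_def mult_le_cancel_right1)
    then show ?thesis using U0_lower[of p] by (simp add: U_def N_def)
  qed
  \<comment> \<open>Every configuration can be moved into \<open>S\<close> without changing its
    energy, so a minimizer over \<open>S\<close> is a minimizer over all configurations and may be
    varied freely.\<close>
  define nrm where "nrm p = (\<chi> i. if i \<in> V then p i - p (s e) else 0)" for p :: "'v \<Rightarrow> real ^ 3"
  have nrm_S: "nrm p \<in> S" for p using se by (simp add: S_def nrm_def)
  have len_nrm: "len f (($) (nrm p)) = len f p" if "f \<in> insert e E" for f p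
    using ends[OF that] by (simp add: nrm_def len_def)
  have U_nrm: "U k (($) (nrm p)) = U k p" for k p
    using len_nrm by (simp add: U_def U0_def)
  have U0z: "U0 z = 0" using eq0 by (simp add: U0_def len_def)
  have Uz: "U k z = c k * M" for k by (simp add: U_def U0z M_def)
  have M0: "split \<Longrightarrow> M = 0" using zs by (simp add: M_def len_def)
  have cM: "c k * M \<le> M" for k
    using M0 len_nonneg[of e z] by (cases "split") (auto simp: c_def M_def field_simps)
  \<comment> \<open>Coercivity bounds the square of the norm. The maximum with 1 ensures that the
    norm is below its square outside the ball, so a bound for the square can be compared with the
    norm itself.\<close>
  define R where "R = max 1 ((M + K) / m)"
  have R: "p \<in> cball 0 R" if "p \<in> S" "U k (($) p) \<le> M" for p k
  proof (rule ccontr)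
    assume "p \<notin> cball 0 R"
    then have n: "norm p > 1" "norm p > (M + K) / m" by (auto simp: R_def)
    then have "norm p ^ 1 < norm p ^ 2" by (intro power_strict_increasing) auto
    then have "norm p < (norm p)\<^sup>2" by (simp only: power_one_right)
    then have "m * (norm p)\<^sup>2 > M + K"
      using n(2) m(1) by (smt (verit) mult_less_cancel_left_pos pos_divide_less_eq mult.commute)
    then show False using m(2)[OF that(1)] U_lower[of "($) p" k] that(2) by linarith
  qed
  have zR: "nrm z \<in> cball 0 R" using R[OF nrm_S, of 0] U_nrm Uz cM by simp
  have "\<exists>p\<in>S \<inter> cball 0 R. \<forall>q\<in>S. U k (($) p) \<le> U k (($) q)" for k
  proof -
    have "compact (S \<inter> cball 0 R)" using subS by (simp add: closed_subspace closed_Int_compact)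
    moreover have "continuous_on (S \<inter> cball 0 R) (\<lambda>p. U k (($) p))"
      unfolding U_def U0_def by (intro continuous_intros continuous_on_subset[OF len_cont]) auto
    moreover have "S \<inter> cball 0 R \<noteq> {}" using zR nrm_S by blast
    ultimately obtain p where p: "p \<in> S \<inter> cball 0 R" "\<And>q. q \<in> S \<inter> cball 0 R \<Longrightarrow> U k (($) p) \<le> U k (($) q)"
      using continuous_attains_inf by metis
    have "U k (($) p) \<le> U k (($) q)" if "q \<in> S" for q
    proof (cases "q \<in> cball 0 R")
      case True then show ?thesis using p(2) that by simp
    next
      case False
      then have "M < U k (($) q)" using R[OF that, of k] by force
      moreover have "U k (($) p) \<le> M" using p(2)[of "nrm z"] zR nrm_S U_nrm Uz cM by (metis IntI order_trans)
      ultimately show ?thesis by simp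
    qed
    then show ?thesis using p(1) by blast
  qed
  then obtain pk where pk: "\<And>k. pk k \<in> S" "\<And>k. pk k \<in> cball 0 R" "\<And>k q. q \<in> S \<Longrightarrow>
        U k (($) (pk k)) \<le> U k (($) q)"
    by (metis Int_iff)
  have pk_min: "U k (($) (pk k)) \<le> U k q" for k q
    using pk(3)[OF nrm_S[of q]] U_nrm by simp
  define w' where "w' k f = (if f = e then c k else w f + 2 * (len f (($) (pk k)) - len f z))" for k f
  have equil: "in_equilibrium (insert e E) s t (w' k) (($) (pk k))" for k
    unfolding in_equilibrium_def
  proof
    fix x :: "'v \<Rightarrow> real"
    let ?v = "\<Sum>f\<in>insert e E. (w' k f * edge_diff s t x f) *\<^sub>R edge_diff s t (($) (pk k)) f"
    \<comment> \<open>The component of the equilibrium sum along \<open>a\<close>, tested against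
      \<open>x\<close>, is half the derivative of \<open>U k\<close> in the direction that moves
      vertex \<open>i\<close> by \<open>x i\<close> times \<open>a\<close>. Squared lengths are
      quadratic in the parameter, with linear coefficient \<open>2 * g f\<close>.\<close>
    have "a \<bullet> ?v = 0" for a
    proof -
      define g where "g f = edge_diff s t (($) (pk k)) f \<bullet> (edge_diff s t x f *\<^sub>R a)" for f
      define h where "h f = (norm (edge_diff s t x f *\<^sub>R a))\<^sup>2" for f
      let ?l = "\<lambda>f. len f (($) (pk k))"
      have len_line: "len f (\<lambda>i. pk k $ i + \<tau> *\<^sub>R x i *\<^sub>R a) = ?l f + 2 * \<tau> * g f + \<tau>\<^sup>2 * h f" for f \<tau>
      proof -
        have "edge_diff s t (\<lambda>i. pk k $ i + \<tau> *\<^sub>R x i *\<^sub>R a) f = edge_diff s t (($) (pk k)) f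
              + \<tau> *\<^sub>R edge_diff s t x f *\<^sub>R a"
          by (simp add: algebra_simps)
        then show ?thesis
          unfolding len_def g_def h_def power2_norm_eq_inner
          by (simp add: inner_add_left inner_add_right inner_commute power2_eq_square algebra_simps)
      qed
      let ?\<phi> = "\<lambda>\<tau>. U k (\<lambda>i. pk k $ i + \<tau> *\<^sub>R x i *\<^sub>R a)"
      have \<phi>: "?\<phi> = (\<lambda>\<tau>. (\<Sum>f\<in>E. w f * (?l f + 2 * \<tau> * g f + \<tau>\<^sup>2 * h f) + (?l f + 2 * \<tau> * g f
            + \<tau>\<^sup>2 * h f - len f z)\<^sup>2) +
          c k * (?l e + 2 * \<tau> * g e + \<tau>\<^sup>2 * h e))"
        unfolding U_def U0_def len_line ..
      have "(?\<phi> has_field_derivative (\<Sum>f\<in>E. w f * (2 * g f) + 2 * (?l f - len f z) * (2 * g f))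
            + c k * (2 * g e)) (at 0)"
      proof -
        have D1: "((\<lambda>\<tau>. l + 2 * \<tau> * g + \<tau>\<^sup>2 * h) has_field_derivative 2 * g) (at 0)" for l g h :: real
          by (auto intro!: derivative_eq_intros)
        have D2: "((\<lambda>\<tau>. (l + 2 * \<tau> * g
              + \<tau>\<^sup>2 * h - L)\<^sup>2) has_field_derivative 2 * (l - L) * (2 * g)) (at 0)" for l g h L :: real
          using DERIV_power[OF DERIV_diff[OF D1[of l g h] DERIV_const[of L]], of 2]
            by (simp add: algebra_simps)
        show ?thesis
          unfolding \<phi> by (intro DERIV_add DERIV_sum DERIV_cmult D1 D2)
      qed
      then have "(\<Sum>f\<in>E. w f * (2 * g f) + 2 * (?l f - len f z) * (2 * g f)) + c k * (2 * g e) = 0"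
        by (rule DERIV_local_min[where d = 1]) (use pk_min in auto)
      moreover have "(\<Sum>f\<in>E. w f * (2 * g f) + 2 * (?l f - len f z) * (2 * g f)) = 2 * (\<Sum>f\<in>E. w' k f * g f)"
        unfolding sum_distrib_left using e by (intro sum.cong) (auto simp: w'_def algebra_simps)
      ultimately have "(\<Sum>f\<in>insert e E. w' k f * g f) = 0"
        using fin e by (simp add: w'_def)
      moreover have "a \<bullet> ?v = (\<Sum>f\<in>insert e E. w' k f * g f)"
        unfolding inner_sum_right by (intro sum.cong) (auto simp: g_def inner_commute)
      ultimately show ?thesis by simp
    qed
    from this[of ?v] show "?v = 0" by (simp only: inner_eq_zero_iff)
  qed
  obtain l r where l: "strict_mono r" "(pk \<circ> r) \<longlonglongrightarrow> l" and "l \<in> cball 0 R"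
    using pk(2) compact_cball[of "0 :: real ^ 3 ^ 'v" R] unfolding compact_def by meson
  have lim_i: "(\<lambda>k. pk (r k) $ i) \<longlonglongrightarrow> l $ i" for i
    using tendsto_vec_nth[OF l(2), of i] by (simp add: o_def)
  have lim_len: "(\<lambda>k. len f (($) (pk (r k)))) \<longlonglongrightarrow> len f (($) l)" for f
    unfolding len_def using l(2)[unfolded o_def] by (intro tendsto_intros)
  have c_top: "filterlim (\<lambda>k. c (r k)) at_top sequentially" if "split"
  proof -
    have "filterlim c at_top sequentially"
      unfolding c_def using that
      by (auto intro!: filterlim_at_top_mono[OF filterlim_real_sequentially])
    then show ?thesis using filterlim_compose filterlim_subseq[OF l(1)] by blast
  qed
  have U_pk: "U k (($) (pk k)) \<le> c k * M" for k using pk_min[of k z] Uz by simp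
  \<comment> \<open>The lower bound for \<open>U0\<close> and the comparison of \<open>U\<close>
    with its value at \<open>z\<close> bound the penalty \<open>c k * len e\<close>
    uniformly.\<close>
  have ls: "l $ s e = l $ t e" if "split"
  proof -
    have "norm (edge_diff s t (($) l) e) = 0"
    proof (rule filterlim_at_top_mult_bounded_zero[where c = "\<lambda>k. c (r k)"
      and h = "\<lambda>_. M + K" and H = "M + K"])
      show "(\<lambda>k. norm (edge_diff s t (($) (pk (r k))) e)) \<longlonglongrightarrow> norm (edge_diff s t (($) l) e)"
        using l(2)[unfolded o_def] by (intro tendsto_intros)
      show "c (r k) * (norm (edge_diff s t (($) (pk (r k))) e))\<^sup>2 \<le> M + K" for k
      proof -
        have "0 \<le> (\<Sum>f\<in>E. len f (($) (pk (r k))))" using len_nonneg by (simp add: sum_nonneg)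
        then show ?thesis
          using U_pk[of "r k"] cM[of "r k"] U0_lower[of "($) (pk (r k))"] by (simp add: U_def len_def)
      qed
    qed (use c_top[OF that] c_pos in auto)
    then show ?thesis by simp
  qed
  have U0l: "U0 (($) l) \<le> 0"
  proof -
    have "(\<lambda>k. U0 (($) (pk (r k)))) \<longlonglongrightarrow> U0 (($) l)"
      unfolding U0_def using lim_len by (intro tendsto_intros)
    \<comment> \<open>For two different reasons: in the split case \<open>z\<close> places both ends
      of \<open>e\<close> at one point, so \<open>M = 0\<close>; otherwise \<open>c\<close> tends to
      zero.\<close>
    moreover have "(\<lambda>k. c (r k) * M) \<longlonglongrightarrow> 0"
    proof (cases "split")
      case True then show ?thesis using M0 by simp
    next
      case False
      have "c \<longlonglongrightarrow> 0" unfolding c_def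
        using False LIMSEQ_inverse_real_of_nat by (simp add: inverse_eq_divide add.commute)
      then have "(\<lambda>k. c (r k)) \<longlonglongrightarrow> 0" using LIMSEQ_subseq_LIMSEQ l(1) by (auto simp: o_def)
      then show ?thesis using tendsto_mult_left_zero by blast
    qed
    moreover have "U0 (($) (pk (r k))) \<le> c (r k) * M" for k
      using U_pk[of "r k"] c_pos[of "r k"] len_nonneg[of e "($) (pk (r k))"]
        by (simp add: U_def) (smt (verit) mult_nonneg_nonneg)
    ultimately show ?thesis by (meson LIMSEQ_le)
  qed
  have en_nonneg: "0 \<le> energy E s t w (\<lambda>i. l $ i $ j)" for j
    using psd ls unfolding pos_energy_on_def by auto
  \<comment> \<open>Both sums are nonnegative and the total is at most zero, so both vanish: the
    first makes the coordinates of \<open>l\<close> affine in \<open>z\<close>, the second restores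
    the old edge lengths.\<close>
  have U0l_eq: "U0 (($) l) = (\<Sum>j\<in>UNIV. energy E s t w (\<lambda>i. l $ i $ j)) + (\<Sum>f\<in>E. (len f (($) l) - len f z)\<^sup>2)"
  proof -
    have "(\<Sum>j\<in>UNIV. energy E s t w (\<lambda>i. l $ i $ j)) = (\<Sum>f\<in>E. w f * len f (($) l))"
      unfolding energy_def
      unfolding len_def power2_norm_eq_inner
      by (subst sum.swap) (simp add: inner_vec_def sum_distrib_left power2_eq_square)
    then show ?thesis by (simp add: U0_def sum.distrib)
  qed
  have 1: "(\<Sum>j\<in>UNIV. energy E s t w (\<lambda>i. l $ i $ j)) \<ge> 0" "(\<Sum>f\<in>E. (len f (($) l) - len f z)\<^sup>2) \<ge> 0"
    using en_nonneg by (simp_all add: sum_nonneg)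
  have en0: "energy E s t w (\<lambda>i. l $ i $ j) = 0" for j
  proof -
    have "(\<Sum>j\<in>UNIV. energy E s t w (\<lambda>i. l $ i $ j)) = 0" using U0l U0l_eq 1 by linarith
    then show ?thesis using en_nonneg by (simp add: sum_nonneg_eq_0_iff)
  qed
  have len_l: "len f (($) l) = len f z" if "f \<in> E" for f
  proof -
    have "(\<Sum>f\<in>E. (len f (($) l) - len f z)\<^sup>2) = 0" using U0l U0l_eq 1 by linarith
    then show ?thesis using fin that by (simp add: sum_nonneg_eq_0_iff)
  qed
  have "\<exists>a b. \<forall>i\<in>V. l $ i $ j = a \<bullet> z i + b" for j
    using psd ls en0[of j] unfolding pos_energy_on_def by auto
  then obtain a b' where ab: "\<And>i j. i \<in> V \<Longrightarrow> l $ i $ j = a j \<bullet> z i + b' j" by metis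
  define A :: "real ^ 3 ^ 3" where "A = (\<chi> j. a j)"
  define b :: "real ^ 3" where "b = (\<chi> j. b' j)"
  have lA: "l $ i = A *v z i + b" if "i \<in> V" for i
    using ab[OF that] by (simp add: vec_eq_iff A_def b_def matrix_vector_mul_component)
  have AA: "transpose A ** A = mat 1"
  proof -
    \<comment> \<open>The defect of \<open>A\<close> from orthogonality, as a symmetric form.
      Equality of the edge lengths before and after \<open>A\<close> says that it vanishes on all
      edge directions, which \<open>con\<close> excludes unless it is zero.\<close>
    define T where "T = transpose A ** A - mat 1"
    have "transpose T = T"
      by (simp add: T_def transpose_def vec_eq_iff matrix_matrix_mult_def mat_def mult.commute)
    moreover have "edge_diff s t z f \<bullet> (T *v edge_diff s t z f) = 0" if "f \<in> E" for f
    proof -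
      let ?d = "edge_diff s t z f"
      have "edge_diff s t (($) l) f = A *v ?d"
        using lA ends[of f] that by (simp add: matrix_vector_mult_diff_distrib)
      then have "(A *v ?d) \<bullet> (A *v ?d) = ?d \<bullet> ?d"
        using len_l[OF that] by (simp add: len_def power2_norm_eq_inner)
      moreover have "(A *v ?d) \<bullet> (A *v ?d) = ?d \<bullet> ((transpose A ** A) *v ?d)"
        by (metis dot_lmul_matrix inner_commute matrix_vector_mul_assoc transpose_matrix_vector)
      ultimately show ?thesis
        by (simp add: T_def matrix_vector_mult_diff_rdistrib inner_diff_right)
    qed
    ultimately have "T = 0" using con unfolding conic_free_def by blast
    then show ?thesis by (simp add: T_def)
  qed
  then have AA': "A ** transpose A = mat 1" using matrix_left_right_inverse by blast
  let ?q = "\<lambda>i. A *v z i + b"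
  have w_lim: "(\<lambda>k. w' (r k) f) \<longlonglongrightarrow> w f" if "f \<in> E" for f
  proof -
    have "(\<lambda>k. w f + 2 * (len f (($) (pk (r k))) - len f z)) \<longlonglongrightarrow> w f + 2 * (len f (($) l) - len f z)"
      using lim_len by (intro tendsto_intros)
    moreover have "(\<lambda>k. w' (r k) f) = (\<lambda>k. w f + 2 * (len f (($) (pk (r k))) - len f z))"
      using that e by (auto simp: w'_def)
    moreover have "w f + 2 * (len f (($) l) - len f z) = w f" using len_l[OF that] by simp
    ultimately show ?thesis by (simp only:)
  qed
  have ev: "\<forall>\<^sub>F k in sequentially. superstable_stress V (insert e E) s t (w' (r k)) (($) (pk (r k)))"
  proof (rule eventually_superstable_stress[where q = ?q and wlim = w and split = "split"])
    show "(\<lambda>k. pk (r k) $ i) \<longlonglongrightarrow> A *v z i + b" if "i \<in> V" for i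
      using lim_i[of i] lA[OF that] by simp
    show "(\<lambda>k. w' (r k) f) \<longlonglongrightarrow> w f" if "f \<in> E" for f
      using w_lim[OF that] .
    show "pos_energy_on (\<lambda>x. split \<longrightarrow> x (s e) = x (t e)) V E s t w ?q"
      unfolding pos_energy_on_def
    proof (intro allI impI conjI)
      fix x :: "'v \<Rightarrow> real" assume C: "split \<longrightarrow> x (s e) = x (t e)"
      then show "0 \<le> energy E s t w x" using psd unfolding pos_energy_on_def by blast
      assume "energy E s t w x = 0"
      then obtain a b' where "\<forall>i\<in>V. x i = a \<bullet> z i + b'" using psd C unfolding pos_energy_on_def by blast
      then have "\<forall>i\<in>V. x i = (A *v a) \<bullet> ?q i + (b' - (A *v a) \<bullet> b)"
        by (simp add: inner_add_right orthogonal_image_inner[OF AA])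
      then show "\<exists>a b. \<forall>i\<in>V. x i = a \<bullet> ?q i + b" by blast
    qed
    show "affinely_spanning V ?q"
      unfolding affinely_spanning_def
    proof (intro allI impI)
      fix a b' assume "\<forall>i\<in>V. a \<bullet> ?q i + b' = 0"
      then have "\<forall>i\<in>V. (transpose A *v a) \<bullet> z i + (a \<bullet> b + b') = 0"
        by (simp add: inner_add_right dot_lmul_matrix add.assoc)
      then have 0: "transpose A *v a = 0" "a \<bullet> b + b' = 0" using aff unfolding affinely_spanning_def by blast+
      have "a = (A ** transpose A) *v a" by (simp add: AA')
      also have "\<dots> = 0"
        using 0(1) by (simp add: matrix_vector_mul_assoc[symmetric] del: transpose_matrix_vector)
      finally show "a = 0 \<and> b' = 0" using 0(2) by simp
    qed
    show "conic_free E s t ?q"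
      unfolding conic_free_def
    proof (intro allI impI)
      fix T :: "real ^ 3 ^ 3" assume T: "transpose T =
            T" "\<forall>f\<in>E. edge_diff s t ?q f \<bullet> (T *v edge_diff s t ?q f) = 0"
      let ?T = "transpose A ** T ** A"
      have "transpose ?T = ?T" using T(1) by (simp add: matrix_transpose_mul matrix_mul_assoc)
      moreover have "edge_diff s t z f \<bullet> (?T *v edge_diff s t z f) = 0" if "f \<in> E" for f
      proof -
        let ?d = "edge_diff s t z f"
        have "edge_diff s t ?q f = A *v ?d" by (simp add: matrix_vector_mult_diff_distrib)
        then have "(A *v ?d) \<bullet> (T *v (A *v ?d)) = 0" using T(2) that by metis
        moreover have "(A *v ?d) \<bullet> y = ?d \<bullet> (transpose A *v y)" for y
          by (metis dot_lmul_matrix inner_commute transpose_matrix_vector)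
        ultimately show ?thesis
          by (simp add: matrix_vector_mul_assoc matrix_mul_assoc del: transpose_matrix_vector)
      qed
      ultimately have "?T = 0" using con unfolding conic_free_def by blast
      then have "A ** ?T ** transpose A = 0" by simp
      moreover have "A ** ?T ** transpose A = (A ** transpose A) ** T ** (A ** transpose A)"
        by (simp add: matrix_mul_assoc)
      ultimately show "T = 0" by (simp add: AA')
    qed
  qed (use fin e ends c_pos c_top equil in \<open>auto simp: w'_def\<close>)
  show thesis
  proof (rule that[OF _ AA _ _ ev])
    show "(\<lambda>k. pk (r k) $ i) \<longlonglongrightarrow> A *v z i + b" if "i \<in> V" for i
      using lim_i[of i] lA[OF that] by simp
    show "(\<lambda>k. w' (r k) f) \<longlonglongrightarrow> w f" if "f \<in> E" for f
      using w_lim[OF that] .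
    show "w' (r k) e > 0" for k using c_pos by (simp add: w'_def)
  qed
qed

section \<open>Adding an edge and splitting a vertex\<close>

definition incident :: "'e set \<Rightarrow> ('e \<Rightarrow> 'v) \<Rightarrow> ('e \<Rightarrow> 'v) \<Rightarrow> 'v \<Rightarrow> 'e set" where
  "incident E s t i = {e \<in> E. s e = i \<or> t e = i}"

text \<open>The indicator difference is the sign that turns the oriented difference around: an edge
  joining \<open>i\<close> and \<open>j\<close> contributes its weight times
  \<open>p i - p j\<close>, whichever end is its source.\<close>

definition force :: "('e \<Rightarrow> 'v) \<Rightarrow> ('e \<Rightarrow> 'v) \<Rightarrow> ('e \<Rightarrow> real) \<Rightarrow> ('v \<Rightarrow> real ^ 3) \<Rightarrow> 'e set \<Rightarrow> 'v \<Rightarrow> real ^ 3" where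
  "force s t w p F i = (\<Sum>e\<in>F. (w e * edge_diff s t (indicator {i}) e) *\<^sub>R edge_diff s t p e)"

text \<open>Proper subsets are the most that can be demanded, since under equilibrium the sum over
  all edges at a vertex is zero.\<close>

definition generic_stress :: "'v set \<Rightarrow> 'e set \<Rightarrow> ('e \<Rightarrow> 'v) \<Rightarrow> ('e \<Rightarrow> 'v) \<Rightarrow>
    ('e \<Rightarrow> real) \<Rightarrow> ('v \<Rightarrow> real ^ 3) \<Rightarrow> bool" where
  "generic_stress V E s t w p \<longleftrightarrow> (\<forall>e\<in>E. w e \<noteq> 0) \<and> inj_on p V \<and>
     (\<forall>i\<in>V. \<forall>F. F \<noteq> {} \<longrightarrow> F \<subset> incident E s t i \<longrightarrow> force s t w p F i \<noteq> 0)"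

definition realizable :: "'v set \<Rightarrow> 'e set \<Rightarrow> ('e \<Rightarrow> 'v) \<Rightarrow> ('e \<Rightarrow> 'v) \<Rightarrow> bool" where
  "realizable V E s t \<longleftrightarrow> (\<exists>w p. superstable_stress V E s t w p \<and> generic_stress V E s t w p)"

text \<open>Test the equilibrium with the coordinates of \<open>p\<close> and add the three diagonal
  components. This gives the reference configuration energy zero in the variational problem.\<close>

lemma equilibrium_energy_zero:
  assumes "in_equilibrium E s t w p"
  shows "(\<Sum>f\<in>E. w f * (norm (edge_diff s t p f))\<^sup>2) = 0"
proof -
  have "(\<Sum>f\<in>E. w f * (norm (edge_diff s t p f))\<^sup>2) =
      (\<Sum>j\<in>UNIV. (\<Sum>f\<in>E. (w f * edge_diff s t (\<lambda>i. p i $ j) f) *\<^sub>R edge_diff s t p f) $ j)"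
    unfolding power2_norm_eq_inner sum_component
    by (subst sum.swap) (simp add: inner_vec_def sum_distrib_left mult.assoc)
  also have "\<dots> = 0"
  proof -
    have "(\<Sum>f\<in>E. (w f * edge_diff s t (\<lambda>i. p i $ j) f) *\<^sub>R edge_diff s t p f) = 0" for j
      using assms[unfolded in_equilibrium_def, rule_format, of "\<lambda>i. p i $ j"] .
    then show ?thesis by (simp only: zero_index sum.neutral_const)
  qed
  finally show ?thesis .
qed

lemma force_incident:
  assumes "finite E" "in_equilibrium E s t w p"
  shows "force s t w p (incident E s t i) i = 0"
proof -
  have "force s t w p (incident E s t i) i = force s t w p E i"
    unfolding force_def incident_def using assms(1)
    by (intro sum.mono_neutral_left) (auto simp: indicator_def)
  then show ?thesis using assms(2) by (simp add: force_def in_equilibrium_def)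
qed

lemma force_complement:
  assumes "finite E" "in_equilibrium E s t w p" "F \<subseteq> incident E s t i"
  shows "force s t w p F i = - force s t w p (incident E s t i - F) i"
proof -
  have "finite (incident E s t i)" using assms(1) by (simp add: incident_def)
  then have "force s t w p (incident E s t i - F) i = force s t w p (incident E s t i) i - force s t w p F i"
    unfolding force_def using assms(3) by (simp add: sum_diff)
  then show ?thesis using force_incident[OF assms(1,2)] by simp
qed

text \<open>Since complementary partial sums at a vertex are opposite, a single edge may be left out.\<close>

lemma generic_stressI:
  assumes "finite E" "in_equilibrium E s t w p" "\<And>f. f \<in> E \<Longrightarrow> w f \<noteq> 0" "inj_on p V"
    and F: "\<And>i F. \<lbrakk>i \<in> V; F \<noteq> {}; F \<subset> incident E s t i; e \<notin> F\<rbrakk> \<Longrightarrow> force s t w p F i \<noteq> 0"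
  shows "generic_stress V E s t w p"
  unfolding generic_stress_def
proof (intro conjI ballI allI impI)
  fix i F assume i: "i \<in> V" and F': "F \<noteq> {}" "F \<subset> incident E s t i"
  show "force s t w p F i \<noteq> 0"
  proof (cases "e \<in> F")
    case True
    then have "force s t w p (incident E s t i - F) i \<noteq> 0"
      using F' by (intro F i) auto
    then show ?thesis using force_complement[OF assms(1,2), of F i] F' by auto
  next
    case False
    then show ?thesis using F[OF i F'] by simp
  qed
qed (use assms in auto)

text \<open>Forces depend on differences only, so the translation \<open>b\<close> drops out and the
  linear part can be pulled out of the sum.\<close>

lemma tendsto_force:
  assumes "\<And>i. i \<in> V \<Longrightarrow> (\<lambda>k. p k i) \<longlonglongrightarrow> A *v z i + b"
    and "\<And>f. f \<in> E \<Longrightarrow> (\<lambda>k. w' k f) \<longlonglongrightarrow> w f"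
    and "\<And>f. f \<in> E \<Longrightarrow> s f \<in> V \<and> t f \<in> V" "F \<subseteq> E"
  shows "(\<lambda>k. force s t (w' k) (p k) F i) \<longlonglongrightarrow> A *v force s t w z F i"
proof -
  have "(\<lambda>k. force s t (w' k) (p k) F i) \<longlonglongrightarrow>
      (\<Sum>e\<in>F. (w e * edge_diff s t (indicator {i}) e) *\<^sub>R edge_diff s t (\<lambda>i. A *v z i + b) e)"
    unfolding force_def
    by (intro tendsto_sum tendsto_scaleR tendsto_mult_right tendsto_diff assms(1,2))
      (use assms(3,4) in blast)+
  also have "(\<Sum>e\<in>F. (w e * edge_diff s t (indicator {i}) e) *\<^sub>R edge_diff s t (\<lambda>i. A *v z i + b) e) =
      A *v force s t w z F i"
    unfolding force_def
    by (subst linear_sum[OF matrix_vector_mul_linear])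
      (simp add: matrix_vector_mult_scaleR matrix_vector_mult_diff_distrib)
  finally show ?thesis .
qed

lemma orthogonal_image_eq_0:
  fixes A :: "real ^ 'n ^ 'n"
  assumes "transpose A ** A = mat 1" "A *v x = 0"
  shows "x = 0"
  using orthogonal_image_inner[OF assms(1), of x x] assms(2) by simp

text \<open>A finite number of vectors that are nonzero in the limit stay nonzero for some common
  \<open>k\<close>; the orthogonal \<open>A\<close> does not create zeros. The sets \<open>F\<close>
  avoid \<open>e\<close>, because the weight of \<open>e\<close> has no limit in the split
  case.\<close>

lemma perturb_generic_stress:
  fixes V :: "'v::finite set" and E :: "'e set" and z :: "'v \<Rightarrow> real ^ 3"
  assumes fin: "finite E" and e: "e \<notin> E"
    and ends: "\<And>f. f \<in> insert e E \<Longrightarrow> s f \<in> V \<and> t f \<in> V"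
    and zs: "split \<Longrightarrow> z (s e) = z (t e)"
    and eq0: "(\<Sum>f\<in>E. w f * (norm (edge_diff s t z f))\<^sup>2) = 0"
    and psd: "pos_energy_on (\<lambda>x. split \<longrightarrow> x (s e) = x (t e)) V E s t w z"
    and aff: "affinely_spanning V z"
    and con: "conic_free E s t z"
    and nz: "\<And>f. f \<in> E \<Longrightarrow> w f \<noteq> 0"
  obtains p w' where "superstable_stress V (insert e E) s t w' p"
    "\<And>f. f \<in> insert e E \<Longrightarrow> w' f \<noteq> 0"
    "\<And>i j. \<lbrakk>i \<in> V; j \<in> V; z i \<noteq> z j\<rbrakk> \<Longrightarrow> p i \<noteq> p j"
    "\<And>i F. \<lbrakk>i \<in> V; F \<subseteq> E; force s t w z F i \<noteq> 0\<rbrakk> \<Longrightarrow> force s t w' p F i \<noteq> 0"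
proof -
  obtain p w' A b where
    p: "\<And>i. i \<in> V \<Longrightarrow> (\<lambda>k. p k i) \<longlonglongrightarrow> A *v z i + b" and
    A: "transpose A ** A = mat 1" and
    w': "\<And>f. f \<in> E \<Longrightarrow> (\<lambda>k. w' k f) \<longlonglongrightarrow> w f" and
    we: "\<And>k. w' k e > 0" and
    ev: "\<forall>\<^sub>F k in sequentially. superstable_stress V (insert e E) s t (w' k) (p k)"
    by ((rule perturb_stress[where split = "split"
      and s = s and t = t and e = e and w = w and z = z and E = E and V = V]);
        (rule fin e eq0 psd aff con | (rule ends zs, assumption) | (rule that; assumption)))
  have "\<forall>\<^sub>F k in sequentially. \<forall>f\<in>E. w' k f \<noteq> 0"
    using fin w' nz by (intro eventually_ball_finite ballI tendsto_imp_eventually_ne) auto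
  moreover have "\<forall>\<^sub>F k in sequentially. \<forall>ij\<in>{(i, j). i \<in> V \<and> j \<in> V \<and>
        z i \<noteq> z j}. p k (fst ij) - p k (snd ij) \<noteq> 0"
  proof (intro eventually_ball_finite ballI)
    fix ij assume "ij \<in> {(i, j). i \<in> V \<and> j \<in> V \<and> z i \<noteq> z j}"
    then obtain i j where ij: "ij = (i, j)" "i \<in> V" "j \<in> V" "z i \<noteq> z j" by blast
    have "(\<lambda>k. p k i - p k j) \<longlonglongrightarrow> (A *v z i + b) - (A *v z j + b)"
      using ij p by (intro tendsto_diff) auto
    moreover have "(A *v z i + b) - (A *v z j + b) \<noteq> 0"
      using orthogonal_image_eq_0[OF A, of "z i - z j"] ij(4) by (auto simp: matrix_vector_mult_diff_distrib)
    ultimately show "\<forall>\<^sub>F k in sequentially. p k (fst ij) - p k (snd ij) \<noteq> 0"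
      unfolding ij(1) fst_conv snd_conv by (rule tendsto_imp_eventually_ne)
  qed (rule finite_subset[of _ UNIV], auto)
  moreover have "\<forall>\<^sub>F k in sequentially. \<forall>iF\<in>{(i, F). i \<in> V \<and> F \<subseteq> E \<and> force s t w z F i \<noteq> 0}.
      force s t (w' k) (p k) (snd iF) (fst iF) \<noteq> 0"
  proof (intro eventually_ball_finite ballI)
    fix iF assume "iF \<in> {(i, F). i \<in> V \<and> F \<subseteq> E \<and> force s t w z F i \<noteq> 0}"
    then obtain i F where iF: "iF = (i, F)" "F \<subseteq> E" "force s t w z F i \<noteq> 0" by blast
    have "(\<lambda>k. force s t (w' k) (p k) F i) \<longlonglongrightarrow> A *v force s t w z F i"
      using ends iF(2) by (intro tendsto_force[OF p w']) auto
    moreover have "A *v force s t w z F i \<noteq> 0" using orthogonal_image_eq_0[OF A] iF(3) by blast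
    ultimately show "\<forall>\<^sub>F k in sequentially. force s t (w' k) (p k) (snd iF) (fst iF) \<noteq> 0"
      unfolding iF(1) fst_conv snd_conv by (rule tendsto_imp_eventually_ne)
  qed (rule finite_subset[of _ "UNIV \<times> Pow E"], use fin in auto)
  ultimately have "\<forall>\<^sub>F k in sequentially. superstable_stress V (insert e E) s t (w' k) (p k) \<and>
        (\<forall>f\<in>E. w' k f \<noteq> 0) \<and>
     (\<forall>i\<in>V. \<forall>j\<in>V. z i \<noteq> z j \<longrightarrow> p k i \<noteq> p k j) \<and>
     (\<forall>i\<in>V. \<forall>F. F \<subseteq> E \<longrightarrow> force s t w z F i \<noteq> 0 \<longrightarrow> force s t (w' k) (p k) F i \<noteq> 0)"
    using ev by eventually_elim auto
  from eventually_happens'[OF sequentially_bot this]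
  obtain k where k: "superstable_stress V (insert e E) s t (w' k) (p k)" "\<forall>f\<in>E. w' k f \<noteq> 0"
     "\<forall>i\<in>V. \<forall>j\<in>V. z i \<noteq> z j \<longrightarrow> p k i \<noteq> p k j"
     "\<forall>i\<in>V. \<forall>F. F \<subseteq> E \<longrightarrow> force s t w z F i \<noteq> 0 \<longrightarrow> force s t (w' k) (p k) F i \<noteq> 0"
    by blast
  show thesis
    by (rule that[OF k(1)]) (use k(2-4) we[of k] in auto)
qed

text \<open>For genericity, a set of edges without \<open>e\<close> is either already a proper
  partial sum of the old stress, nonzero by perturbation, or all the old edges at one end of
  \<open>e\<close>. In the second case the complement is \<open>{e}\<close>, whose force is nonzero
  because \<open>p\<close> is injective.\<close>

lemma realizable_insert_edge:
  fixes V :: "'v::finite set"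
  assumes "realizable V E s t" and fin: "finite E" and e: "e \<notin> E"
    and ends: "\<And>f. f \<in> insert e E \<Longrightarrow> s f \<in> V \<and> t f \<in> V" and ne: "s e \<noteq> t e"
  shows "realizable V (insert e E) s t"
proof -
  obtain w z where ss: "superstable_stress V E s t w z" and gen: "generic_stress V E s t w z"
    using assms(1) unfolding realizable_def by blast
  have eq: "in_equilibrium E s t w z" and psd: "pos_energy_on (\<lambda>x. True) V E s t w z"
    and aff: "affinely_spanning V z" and con: "conic_free E s t z"
    using ss by (auto simp: superstable_stress_def)
  have nz: "\<And>f. f \<in> E \<Longrightarrow> w f \<noteq> 0" using gen by (simp add: generic_stress_def)
  have psd': "pos_energy_on (\<lambda>x. False \<longrightarrow> x (s e) = x (t e)) V E s t w z"
    using psd by simp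
  obtain p w' where p: "superstable_stress V (insert e E) s t w' p"
    "\<And>f. f \<in> insert e E \<Longrightarrow> w' f \<noteq> 0"
    "\<And>i j. \<lbrakk>i \<in> V; j \<in> V; z i \<noteq> z j\<rbrakk> \<Longrightarrow> p i \<noteq> p j"
    "\<And>i F. \<lbrakk>i \<in> V; F \<subseteq> E; force s t w z F i \<noteq> 0\<rbrakk> \<Longrightarrow> force s t w' p F i \<noteq> 0"
    by ((rule perturb_generic_stress[where split = False
      and s = s and t = t and e = e and w = w and z = z and E = E and V = V]);
        (rule fin e equilibrium_energy_zero[OF eq] psd' aff con | (rule ends nz, assumption) | (erule
          FalseE) | (rule that; assumption)))
  have eq': "in_equilibrium (insert e E) s t w' p" using p(1) by (simp add: superstable_stress_def)
  have inj: "inj_on p V"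
    using p(3) gen unfolding generic_stress_def inj_on_def by metis
  have "generic_stress V (insert e E) s t w' p"
  proof (rule generic_stressI[where e = e])
    fix i F assume i: "i \<in> V" and F: "F \<noteq> {}" "F \<subset> incident (insert e E) s t i" "e \<notin> F"
    have FE: "F \<subseteq> incident E s t i" using F by (auto simp: incident_def)
    show "force s t w' p F i \<noteq> 0"
    proof (cases "F = incident E s t i")
      case False
      then have "force s t w z F i \<noteq> 0"
        using gen i F FE unfolding generic_stress_def by (metis psubsetI)
      then show ?thesis using p(4)[OF i] FE by (auto simp: incident_def)
    next
      case True
      then have "e \<in> incident (insert e E) s t i" using F(2) by (auto simp: incident_def)
      then have ei: "s e = i \<or> t e = i" by (simp add: incident_def)
      then have inc: "incident (insert e E) s t i - F = {e}"
        using e F(3) True by (auto simp: incident_def)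
      have "p (s e) \<noteq> p (t e)" using inj ends[of e] ne by (auto simp: inj_on_def)
      then have "force s t w' p {e} i \<noteq> 0"
        using p(2)[of e] ei ne by (auto simp: force_def indicator_def)
      then show ?thesis
        using force_complement[OF _ eq', of F i] fin F(2) inc by auto
    qed
  qed (use fin eq' p inj in auto)
  then show ?thesis using p(1) unfolding realizable_def by blast
qed

text \<open>The hypothesis concerns the graph in which \<open>t e\<close> has been merged into
  \<open>s e\<close>. No edge of \<open>E\<close> may join the two halves, as it would be a loop
  there; such parallel edges have to be inserted afterwards.\<close>

lemma realizable_split_vertex:
  fixes V :: "'v::finite set"
  assumes "realizable (V - {t e}) E ((\<lambda>x. if x = t e then s e else x) \<circ> s) ((\<lambda>x. if x =
        t e then s e else x) \<circ> t)"
    and fin: "finite E" and e: "e \<notin> E"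
    and ends: "\<And>f. f \<in> insert e E \<Longrightarrow> s f \<in> V \<and> t f \<in> V \<and> s f \<noteq> t f"
    and simple: "\<And>f. f \<in> E \<Longrightarrow> {s f, t f} \<noteq> {s e, t e}"
    and ne1: "incident E s t (s e) \<noteq> {}" and ne2: "incident E s t (t e) \<noteq> {}"
  shows "realizable V (insert e E) s t"
proof -
  define u v where "u = s e" and "v = t e"
  define h where "h x = (if x = v then u else x)" for x
  have uv: "u \<noteq> v" "u \<in> V" "v \<in> V" using ends[of e] by (auto simp: u_def v_def)
  have hv: "h v = u" and h: "\<And>x. x \<noteq> v \<Longrightarrow> h x = x" by (auto simp: h_def)
  have "realizable (V - {v}) E (h \<circ> s) (h \<circ> t)"
    using assms(1) unfolding h_def[abs_def] u_def v_def .
  then obtain w q where ss: "superstable_stress (V - {v}) E (h \<circ> s) (h \<circ> t) w q"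
    and gen: "generic_stress (V - {v}) E (h \<circ> s) (h \<circ> t) w q"
    unfolding realizable_def by blast
  define z where "z = q \<circ> h"
  have zh: "z i = q (h i)" for i by (simp add: z_def)
  have eq: "in_equilibrium E (h \<circ> s) (h \<circ> t) w q"
    and psd: "pos_energy_on (\<lambda>x. True) (V - {v}) E (h \<circ> s) (h \<circ> t) w q"
    and aff: "affinely_spanning (V - {v}) q" and con: "conic_free E (h \<circ> s) (h \<circ> t) q"
    using ss by (auto simp: superstable_stress_def)
  \<comment> \<open>The functions that agree on the ends of \<open>e\<close> are those factoring
    through \<open>h\<close>, and on them the split graph and the glued graph have the same
    energy.\<close>
  have psd': "pos_energy_on (\<lambda>x. True \<longrightarrow> x (s e) = x (t e)) V E s t w z"
    unfolding pos_energy_on_def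
  proof (intro allI impI)
    fix x :: "'v \<Rightarrow> real" assume "True \<longrightarrow> x (s e) = x (t e)"
    then have x: "x (h y) = x y" for y by (simp add: h_def u_def v_def)
    then have en: "energy E s t w x = energy E (h \<circ> s) (h \<circ> t) w x" by (simp add: energy_def)
    have "0 \<le> energy E s t w x"
      using psd en unfolding pos_energy_on_def by auto
    moreover have "\<exists>a b. \<forall>i\<in>V. x i = a \<bullet> z i + b" if en0: "energy E s t w x = 0"
    proof -
      obtain a b where ab: "\<forall>i\<in>V - {v}. x i = a \<bullet> q i + b"
        using psd en0[unfolded en] unfolding pos_energy_on_def by blast
      have "x i = a \<bullet> z i + b" if "i \<in> V" for i
      proof -
        have "h i \<in> V - {v}" using that uv by (auto simp: h_def)
        then show ?thesis using ab x[of i] zh by metis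
      qed
      then show ?thesis by blast
    qed
    ultimately show "0 \<le> energy E s t w x \<and> (energy E s t w x = 0 \<longrightarrow> (\<exists>a b. \<forall>i\<in>V. x i = a \<bullet> z i + b))"
      by blast
  qed
  have aff': "affinely_spanning V z"
    unfolding affinely_spanning_def
  proof (intro allI impI)
    fix a b assume ab: "\<forall>i\<in>V. a \<bullet> z i + b = 0"
    have "a \<bullet> q i + b = 0" if "i \<in> V - {v}" for i
      using ab that zh[of i] h[of i] by auto
    then show "a = 0 \<and> b = 0" using aff unfolding affinely_spanning_def by blast
  qed
  have con': "conic_free E s t z" using con by (simp add: conic_free_def zh)
  have eq0: "(\<Sum>f\<in>E. w f * (norm (edge_diff s t z f))\<^sup>2) = 0"
    using equilibrium_energy_zero[OF eq] by (simp add: zh)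
  have nz: "\<And>f. f \<in> E \<Longrightarrow> w f \<noteq> 0" using gen by (simp add: generic_stress_def)
  have ends': "\<And>f. f \<in> insert e E \<Longrightarrow> s f \<in> V \<and> t f \<in> V" using ends by blast
  have zs: "z (s e) = z (t e)" using h[OF uv(1)] hv by (simp add: zh u_def v_def)
  obtain p w' where p: "superstable_stress V (insert e E) s t w' p"
    "\<And>f. f \<in> insert e E \<Longrightarrow> w' f \<noteq> 0"
    "\<And>i j. \<lbrakk>i \<in> V; j \<in> V; z i \<noteq> z j\<rbrakk> \<Longrightarrow> p i \<noteq> p j"
    "\<And>i F. \<lbrakk>i \<in> V; F \<subseteq> E; force s t w z F i \<noteq> 0\<rbrakk> \<Longrightarrow> force s t w' p F i \<noteq> 0"
    by ((rule perturb_generic_stress[where split = True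
      and s = s and t = t and e = e and w = w and z = z and E = E and V = V]);
        (rule fin e zs eq0 psd' aff' con' | (rule ends' nz, assumption) | (rule that; assumption)))
  have eq': "in_equilibrium (insert e E) s t w' p" using p(1) by (simp add: superstable_stress_def)
  have inc_u: "incident E (h \<circ> s) (h \<circ> t) u = incident E s t u \<union> incident E s t v"
    using uv by (auto simp: incident_def h_def split: if_splits)
  have disj: "incident E s t u \<inter> incident E s t v = {}"
    using simple uv(1) by (auto simp: incident_def u_def[symmetric] v_def[symmetric])
  have nonempty: "incident E s t u \<noteq> {}" "incident E s t v \<noteq> {}" using ne1 ne2 by (auto simp: u_def v_def)
  \<comment> \<open>The force at \<open>i\<close> equals the force of the same edges at
    \<open>h i\<close> in the glued graph. Even all old edges at one half form a proper subset
    there, since the other half has an edge as well.\<close>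
  have force0: "force s t w z F i \<noteq> 0"
    if "i \<in> V" "F \<noteq> {}" "F \<subseteq> incident E s t i" "i \<in> {u, v} \<or> F \<noteq> incident E s t i" for i F
  proof -
    have "force s t w z F i = force (h \<circ> s) (h \<circ> t) w q F (h i)"
      unfolding force_def
    proof (intro sum.cong refl)
      fix f assume "f \<in> F"
      then have f: "f \<in> E" "s f = i \<or> t f = i" using that(3) by (auto simp: incident_def)
      have "{s f, t f} \<noteq> {u, v}" "s f \<noteq> t f" using simple[OF f(1)] ends[of f] f(1) by (auto simp: u_def v_def)
      then have "(indicator {i} (s f) :: real) =
            indicator {h i} (h (s f))" "(indicator {i} (t f) :: real) = indicator {h i} (h (t f))"
        using f(2) uv(1) by (auto simp: indicator_def h_def)
      then show "(w f * edge_diff s t (indicator {i}) f) *\<^sub>R edge_diff s t z f =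
         (w f * edge_diff (h \<circ> s) (h \<circ> t) (indicator {h i}) f) *\<^sub>R edge_diff (h \<circ> s) (h \<circ> t) q f"
        by (simp add: zh)
    qed
    moreover have "F \<subset> incident E (h \<circ> s) (h \<circ> t) (h i)"
    proof (cases "i \<in> {u, v}")
      case True
      then have "h i = u" using hv h[OF uv(1)] by auto
      moreover have "F \<subset> incident E s t u \<union> incident E s t v"
      proof (cases "i = u")
        case True then show ?thesis using that(3) disj nonempty by blast
      next
        case False
        then have "i = v" using \<open>i \<in> {u, v}\<close> by blast
        then show ?thesis using that(3) disj nonempty by blast
      qed
      ultimately show ?thesis using inc_u by simp
    next
      case False
      then have "incident E (h \<circ> s) (h \<circ> t) (h i) = incident E s t i"
        using h[of i] by (auto simp: incident_def h_def)
      then show ?thesis using that False by blast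
    qed
    moreover have "h i \<in> V - {v}" using that(1) uv by (auto simp: h_def)
    ultimately show ?thesis using gen that(2) unfolding generic_stress_def by metis
  qed
  \<comment> \<open>If the halves coincided, \<open>e\<close> would carry no force, and the old
    edges at \<open>u\<close> would balance by themselves. Their force is nonzero at the limit,
    hence nonzero after the perturbation.\<close>
  have inj_uv: "p u \<noteq> p v"
  proof
    assume p_eq: "p u = p v"
    let ?D = "incident E s t u"
    have "force s t w' p ?D u \<noteq> 0"
      using p(4)[OF uv(2), of ?D] force0[OF uv(2) nonempty(1)] by (auto simp: incident_def)
    moreover have "incident (insert e E) s t u - ?D = {e}"
      using e by (auto simp: incident_def u_def)
    moreover have "force s t w' p {e} u = 0" using p_eq by (simp add: force_def u_def v_def)
    ultimately show False
      using force_complement[OF _ eq', of ?D u] fin by (auto simp: incident_def)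
  qed
  have inj: "inj_on p V"
  proof (rule inj_onI)
    fix i j assume ij: "i \<in> V" "j \<in> V" "p i = p j"
    then have "q (h i) = q (h j)" using p(3) zh by metis
    moreover have "h i \<in> V - {v}" "h j \<in> V - {v}" using ij uv by (auto simp: h_def)
    ultimately have "h i = h j" using gen unfolding generic_stress_def inj_on_def by blast
    then show "i = j" using ij(3) inj_uv by (auto simp: h_def split: if_splits)
  qed
  have "generic_stress V (insert e E) s t w' p"
  proof (rule generic_stressI[where e = e])
    fix i F assume i: "i \<in> V" and F: "F \<noteq> {}" "F \<subset> incident (insert e E) s t i" "e \<notin> F"
    have FE: "F \<subseteq> incident E s t i" using F by (auto simp: incident_def)
    have "i \<in> {u, v} \<or> F \<noteq> incident E s t i"
      using F(2,3) by (auto simp: incident_def u_def v_def)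
    then have "force s t w z F i \<noteq> 0" using force0[OF i F(1) FE] by blast
    then show "force s t w' p F i \<noteq> 0" using p(4)[OF i] FE by (auto simp: incident_def)
  qed (use fin eq' p inj in auto)
  then show ?thesis using p(1) unfolding realizable_def by blast
qed

section \<open>Contractible edges and minor models\<close>

text \<open>Connectedness by cuts instead of paths: it passes to images by pulling cuts back. Empty
  sets and singletons count as connected.\<close>

definition cut_connected :: "('a \<Rightarrow> 'a \<Rightarrow> bool) \<Rightarrow> 'a set \<Rightarrow> bool" where
  "cut_connected R X \<longleftrightarrow> (\<forall>A. A \<subseteq> X \<longrightarrow> A \<noteq> {} \<longrightarrow> A \<noteq> X \<longrightarrow> (\<exists>a\<in>A. \<exists>b\<in>X - A. R a b))"

definition adj :: "'e set \<Rightarrow> ('e \<Rightarrow> 'v) \<Rightarrow> ('e \<Rightarrow> 'v) \<Rightarrow> 'v \<Rightarrow> 'v \<Rightarrow> bool" where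
  "adj E s t x y \<longleftrightarrow> (\<exists>f\<in>E. {s f, t f} = {x, y})"

text \<open>The map \<open>\<phi>\<close> sends a vertex to the label of its branch set.
  Surjectivity makes the branch sets nonempty, and as \<open>\<phi>\<close> labels all of
  \<open>V\<close> they cover it: the model is spanning.\<close>

definition minor_model ::
    "'v set \<Rightarrow> ('v \<Rightarrow> 'v \<Rightarrow> bool) \<Rightarrow> 'w set \<Rightarrow> ('w \<Rightarrow> 'w \<Rightarrow> bool) \<Rightarrow> ('v \<Rightarrow> 'w) \<Rightarrow> bool" where
  "minor_model V A W R \<phi> \<longleftrightarrow> \<phi> ` V = W \<and> (\<forall>h\<in>W. cut_connected A {x \<in> V. \<phi> x = h}) \<and>
     (\<forall>h\<in>W. \<forall>h'\<in>W. R h h' \<longrightarrow> (\<exists>x\<in>V. \<exists>y\<in>V. \<phi> x = h \<and> \<phi> y = h' \<and> A x y))"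

lemma adj_sym: "adj E s t x y \<Longrightarrow> adj E s t y x"
  by (auto simp: adj_def insert_commute)

lemma cut_connectedD:
  assumes "cut_connected R X" "A \<subseteq> X" "A \<noteq> {}" "A \<noteq> X"
  shows "\<exists>a\<in>A. \<exists>b\<in>X - A. R a b"
  using assms unfolding cut_connected_def by blast

lemma cut_connected_image:
  assumes "cut_connected R X" "\<And>a b. \<lbrakk>a \<in> X; b \<in> X; R a b; h a \<noteq> h b\<rbrakk> \<Longrightarrow> R' (h a) (h b)"
  shows "cut_connected R' (h ` X)"
  unfolding cut_connected_def
proof (intro allI impI)
  fix A assume A: "A \<subseteq> h ` X" "A \<noteq> {}" "A \<noteq> h ` X"
  let ?A = "{x \<in> X. h x \<in> A}"
  have ne: "?A \<noteq> {}" "?A \<noteq> X" using A by auto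
  obtain a b where "a \<in> ?A" "b \<in> X - ?A" "R a b"
    using cut_connectedD[OF assms(1) _ ne] by auto
  note ab = this
  then have "h a \<in> A" "h b \<in> h ` X - A" by auto
  moreover from this have "h a \<noteq> h b" by auto
  then have "R' (h a) (h b)" using assms(2)[of a b] ab by blast
  ultimately show "\<exists>a\<in>A. \<exists>b\<in>h ` X - A. R' a b" by blast
qed

text \<open>A cut that divides another branch set is crossed inside that set. A cut dividing none is
  a union of branch sets, hence induces a cut of \<open>W - {h}\<close>, and an edge of
  \<open>R\<close> across it is realized in the graph.\<close>

lemma cut_connected_complement_fibre:
  assumes model: "minor_model V A W R \<phi>" and h: "cut_connected R (W - {h})"
  shows "cut_connected A (V - {x \<in> V. \<phi> x = h})"
  unfolding cut_connected_def
proof (intro allI impI)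
  let ?O = "V - {x \<in> V. \<phi> x = h}"
  fix X assume X: "X \<subseteq> ?O" "X \<noteq> {}" "X \<noteq> ?O"
  show "\<exists>a\<in>X. \<exists>b\<in>?O - X. A a b"
  proof (cases "\<phi> ` X \<inter> \<phi> ` (?O - X) = {}")
    case False
    then obtain x y where xy: "x \<in> X" "y \<in> ?O - X" "\<phi> x = \<phi> y" by blast
    let ?F = "{z \<in> V. \<phi> z = \<phi> x}"
    have "cut_connected A ?F" using model xy X(1) by (auto simp: minor_model_def)
    moreover have "X \<inter> ?F \<noteq> {}" "X \<inter> ?F \<noteq> ?F" using xy X(1) by auto
    ultimately obtain a b where "a \<in> X \<inter> ?F" "b \<in> ?F - X \<inter> ?F" "A a b"
      by (meson cut_connectedD inf_le2)
    moreover have "?F \<subseteq> ?O" using xy X(1) by auto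
    ultimately show ?thesis by blast
  next
    case True
    have "\<phi> ` X \<subseteq> W - {h}" "\<phi> ` X \<noteq> {}" using X model by (auto simp: minor_model_def)
    moreover have "\<phi> ` X \<noteq> W - {h}"
    proof -
      obtain y where "y \<in> ?O - X" using X by blast
      then have "\<phi> y \<in> W - {h}" "\<phi> y \<notin> \<phi> ` X" using True model by (auto simp: minor_model_def)
      then show ?thesis by blast
    qed
    ultimately obtain h1 h2 where h12: "h1 \<in> \<phi> ` X" "h2 \<in> W - {h} - \<phi> ` X" "R h1 h2"
      using cut_connectedD[OF h] by metis
    have "h1 \<in> W" using h12(1) X model by (auto simp: minor_model_def)
    then obtain x y where xy: "x \<in> V" "y \<in> V" "\<phi> x = h1" "\<phi> y = h2" "A x y"
      using model h12 unfolding minor_model_def by blast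
    have "x \<in> X"
    proof (rule ccontr)
      assume "x \<notin> X"
      moreover have "h1 \<noteq> h" using h12(1) X(1) by auto
      ultimately have "x \<in> ?O - X" using xy by blast
      then show False using True h12(1) xy(3) by blast
    qed
    moreover have "y \<in> ?O - X" using xy h12(2) by auto
    ultimately show ?thesis using xy(5) by blast
  qed
qed

text \<open>If no edge inside \<open>B\<close> is contractible, the ends of each such edge separate
  the graph. The connected set \<open>V - B\<close> lies on one side, so the other side is contained
  in \<open>B\<close>; descent on the size of such a side gives a contradiction.\<close>

lemma ex_contractible_edge:
  assumes V: "finite V" and sym: "\<And>x y. R x y \<Longrightarrow> R y x"
    and conn: "\<And>x. x \<in> V \<Longrightarrow> cut_connected R (V - {x})"
    and B: "B \<subseteq> V" "cut_connected R B" "x0 \<in> B" "y0 \<in> B" "x0 \<noteq> y0"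
    and O: "cut_connected R (V - B)" "V - B \<noteq> {}"
  shows "\<exists>u\<in>B. \<exists>v\<in>B. u \<noteq> v \<and> R u v \<and> cut_connected R (V - {u, v})"
proof (rule ccontr)
  assume contr: "\<not> ?thesis"
  have cut: "\<exists>X Y. X \<union> Y = V - {u, v} \<and> X \<inter> Y = {} \<and> X \<noteq> {} \<and> Y \<noteq> {} \<and> (\<forall>a\<in>X. \<forall>b\<in>Y. \<not> R a b)"
    if "u \<in> B" "v \<in> B" "u \<noteq> v" "R u v" for u v
  proof -
    have "\<not> cut_connected R (V - {u, v})" using contr that by blast
    then obtain X where X: "X \<subseteq> V - {u, v}" "X \<noteq> {}" "X \<noteq> V - {u, v}" "\<forall>a\<in>X. \<forall>b\<in>V - {u, v} - X. \<not> R a b"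
      unfolding cut_connected_def by blast
    then show ?thesis by (intro exI[of _ X] exI[of _ "V - {u, v} - X"]) blast
  qed
  have no_side: False
    if "u \<in> B" "v \<in> B" "u \<noteq> v" "R u v" "D \<noteq> {}" "D \<subseteq> B - {u, v}" "\<forall>a\<in>D. \<forall>b\<in>V - {u, v} - D. \<not> R a b" for u v D
    using that
  proof (induction "card D" arbitrary: u v D rule: less_induct)
    case less
    \<comment> \<open>Since \<open>v\<close> is no cut vertex, \<open>D\<close> contains a neighbour
      \<open>c\<close> of \<open>u\<close>. A side \<open>Z\<close> of the separation by
      \<open>{u, c}\<close> that avoids \<open>v\<close> either meets \<open>D\<close>, giving the
      smaller side \<open>Z \<inter> D\<close>, or misses \<open>D\<close>; then \<open>c\<close>
      must have a neighbour in \<open>Z\<close>, although \<open>D\<close> has no neighbours beyond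
      \<open>u\<close> and \<open>v\<close>.\<close>
    note D = less.prems
    have "cut_connected R (V - {v})" using conn D(2) B(1) by blast
    moreover have "D \<subseteq> V - {v}" "D \<noteq> V - {v}" using D(1-3,6) B(1) by auto
    ultimately obtain c b where "c \<in> D" "b \<in> V - {v} - D" "R c b"
      using D(5) by (meson cut_connectedD)
    moreover have "b = u" using calculation D(7) by blast
    ultimately have c: "c \<in> D" "R c u" by simp_all
    have uc: "c \<in> B" "u \<noteq> c" "R u c" using c D(6) sym by auto
    obtain X Y where XY: "X \<union> Y = V - {u, c}" "X \<inter> Y = {}" "X \<noteq> {}" "Y \<noteq> {}" "\<forall>a\<in>X. \<forall>b\<in>Y. \<not> R a b"
      using cut[OF D(1) uc] by blast
    obtain Z where Z: "Z \<subseteq> V - {u, c}" "Z \<noteq> {}" "v \<notin> Z" "\<forall>a\<in>Z. \<forall>b\<in>V - {u, c} - Z. \<not> R a b"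
    proof (cases "v \<in> X")
      case False
      then show thesis using XY that[of X] by blast
    next
      case True
      have "\<forall>a\<in>Y. \<forall>b\<in>V - {u, c} - Y. \<not> R a b" using XY sym by blast
      then show thesis using XY True that[of Y] by blast
    qed
    show False
    proof (cases "Z \<inter> D = {}")
      case False
      show False
      proof (rule less.hyps)
        show "card (Z \<inter> D) < card D"
          using c(1) Z(1) D(6) B(1) V by (intro psubset_card_mono) (auto intro: finite_subset)
        show "\<forall>a\<in>Z \<inter> D. \<forall>b\<in>V - {u, c} - Z \<inter> D. \<not> R a b"
          using Z D(7) by blast
      qed (use D(1) uc False D(6) Z in auto)
    next
      case True
      have "cut_connected R (V - {u})" using conn D(1) B(1) by blast
      moreover have "Z \<subseteq> V - {u}" "Z \<noteq> V - {u}" using Z(1) uc B(1) by auto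
      ultimately obtain a b where ab: "a \<in> Z" "b \<in> V - {u} - Z" "R a b"
        using Z(2) by (meson cut_connectedD)
      then have "b = c" using Z(4) by blast
      moreover have "a \<in> V - {u, v} - D" using ab(1) Z(1,3) True by blast
      ultimately show False using D(7) c(1) ab(3) sym by blast
    qed
  qed
  obtain a b where ab: "a \<in> B" "b \<in> B" "a \<noteq> b" "R a b"
  proof -
    have "{x0} \<subseteq> B" "{x0} \<noteq> {}" "{x0} \<noteq> B" using B(3-5) by auto
    from cut_connectedD[OF B(2) this] show thesis using that B(3) by auto
  qed
  obtain X Y where XY: "X \<union> Y = V - {a, b}" "X \<inter> Y = {}" "X \<noteq> {}" "Y \<noteq> {}" "\<forall>x\<in>X. \<forall>y\<in>Y. \<not> R x y"
    using cut[OF ab] by blast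
  \<comment> \<open>\<open>V - B\<close> is connected and contains neither \<open>a\<close> nor
    \<open>b\<close>, so it cannot be divided by the separation.\<close>
  have "(V - B) \<inter> X = {} \<or> (V - B) \<inter> X = V - B"
    using cut_connectedD[OF O(1), of "(V - B) \<inter> X"] XY ab(1,2) by blast
  then show False
  proof
    assume "(V - B) \<inter> X = {}"
    then have "X \<subseteq> B - {a, b}" using XY(1) by blast
    moreover have "\<forall>x\<in>X. \<forall>y\<in>V - {a, b} - X. \<not> R x y" using XY by blast
    ultimately show False using no_side[OF ab XY(3)] by blast
  next
    assume "(V - B) \<inter> X = V - B"
    then have "Y \<subseteq> B - {a, b}" using XY(1,2) by blast
    moreover have "\<forall>x\<in>Y. \<forall>y\<in>V - {a, b} - Y. \<not> R x y" using XY sym by blast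
    ultimately show False using no_side[OF ab XY(4)] by blast
  qed
qed

lemma realizable_superset:
  fixes V :: "'v::finite set"
  assumes "realizable V E0 s t" "E0 \<subseteq> E" "finite E"
    and "\<And>f. f \<in> E \<Longrightarrow> s f \<in> V \<and> t f \<in> V \<and> s f \<noteq> t f"
  shows "realizable V E s t"
proof -
  have "realizable V (E0 \<union> F) s t" if "F \<subseteq> E - E0" for F
  proof -
    have "finite F" using that assms(3) by (meson finite_Diff finite_subset)
    then show ?thesis using that
    proof (induction F rule: finite_induct)
      case (insert f F)
      have "realizable V (insert f (E0 \<union> F)) s t"
        using insert assms(2-4) by (intro realizable_insert_edge) (auto intro: finite_subset)
      then show ?case by simp
    qed (use assms(1) in simp)
  qed
  from this[of "E - E0"] show ?thesis using assms(2) by (simp add: Un_absorb1)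
qed

text \<open>Induction by contracting an edge within a branch set, with the spanning case supplied as
  \<open>base\<close>. The edges parallel to the contracted one are dropped along with it and
  restored by edge insertion after the vertex split.\<close>

lemma realizable_of_minor_model:
  fixes V :: "'v::finite set" and E :: "'e set"
  assumes W: "\<And>h. h \<in> W \<Longrightarrow> cut_connected R (W - {h})" "\<And>h. \<not> R h h" "card W \<ge> 3"
    and base: "\<And>V E s t \<phi>. \<lbrakk>minor_model V (adj E s t) W R \<phi>; inj_on \<phi> V\<rbrakk> \<Longrightarrow>
      \<exists>E0\<subseteq>E. realizable (V :: 'v set) (E0 :: 'e set) s t"
    and "finite E" "\<And>f. f \<in> E \<Longrightarrow> s f \<in> V \<and> t f \<in> V \<and> s f \<noteq> t f"
    and "\<And>x. x \<in> V \<Longrightarrow> cut_connected (adj E s t) (V - {x})"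
    and "minor_model V (adj E s t) W R \<phi>"
  shows "realizable V E s t"
  using assms(5-)
proof (induction "card V" arbitrary: V E s t rule: less_induct)
  case less
  note fin = less.prems(1) and ends = less.prems(2) and conn = less.prems(3) and model = less.prems(4)
  show ?case
  proof (cases "inj_on \<phi> V")
    case True
    then show ?thesis using base[OF model] realizable_superset fin ends by metis
  next
    case False
    then obtain x0 y0 where xy0: "x0 \<in> V" "y0 \<in> V" "x0 \<noteq> y0" "\<phi> x0 = \<phi> y0"
      by (auto simp: inj_on_def)
    define B where "B = {x \<in> V. \<phi> x = \<phi> x0}"
    have img: "\<phi> ` V = W" using model by (simp add: minor_model_def)
    have x0W: "\<phi> x0 \<in> W" using img xy0 by blast
    have cB: "cut_connected (adj E s t) B" using model x0W by (simp add: minor_model_def B_def)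
    have cO: "cut_connected (adj E s t) (V - B)"
      unfolding B_def using model W(1)[OF x0W] by (rule cut_connected_complement_fibre)
    have card3: "card V \<ge> 3" using W(3) img card_image_le[of V \<phi>] by simp
    have "V - B \<noteq> {}"
    proof
      assume "V - B = {}"
      then have "W \<subseteq> {\<phi> x0}" using img by (auto simp: B_def)
      then have "card W \<le> 1" using card_mono[of "{\<phi> x0}" W] by simp
      then show False using W(3) by simp
    qed
    then obtain a b where ab: "a \<in> B" "b \<in> B" "a \<noteq> b" "adj E s t a b" "cut_connected (adj E s t) (V - {a, b})"
      using ex_contractible_edge[of V "adj E s t" B x0 y0, OF _ adj_sym conn _ cB _ _ _ cO] xy0
        by (auto simp: B_def)
    then obtain e where e: "e \<in> E" "{s e, t e} = {a, b}" unfolding adj_def by blast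
    define u v where "u = s e" and "v = t e"
    have uv: "u \<in> B" "v \<in> B" "u \<noteq> v" "cut_connected (adj E s t) (V - {u, v})"
      using e ab by (auto simp: u_def v_def doubleton_eq_iff insert_commute)
    have uvV: "u \<in> V" "v \<in> V" and \<phi>uv: "\<phi> u = \<phi> v" using uv by (auto simp: B_def)
    define m where "m x = (if x = v then u else x)" for x
    define E' where "E' = {f \<in> E. {s f, t f} \<noteq> {u, v}}"
    have \<phi>m: "\<phi> (m x) = \<phi> x" for x using \<phi>uv by (simp add: m_def)
    have mV: "m ` X = X - {v}" if "u \<in> X" for X using that uv(3) by (auto simp: m_def)
    have adj': "adj E' (m \<circ> s) (m \<circ> t) (m x) (m y)" if xy: "adj E s t x y" "m x \<noteq> m y" for x y
    proof -
      obtain f where f: "f \<in> E" "{s f, t f} = {x, y}" using xy(1) unfolding adj_def by blast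
      have "m ` {s f, t f} = {m x, m y}" using f(2) by simp
      moreover have "{s f, t f} \<noteq> {u, v}"
      proof
        assume "{s f, t f} = {u, v}"
        then have "m x = u" "m y = u" using f(2) by (auto simp: m_def doubleton_eq_iff)
        then show False using xy(2) by simp
      qed
      ultimately show ?thesis using f(1) by (auto simp: adj_def E'_def)
    qed
    have conn_img: "cut_connected (adj E' (m \<circ> s) (m \<circ> t)) (m ` X)" if "cut_connected (adj E s t) X" for X
      using that adj' by (rule cut_connected_image)
    have "realizable (V - {v}) E' (m \<circ> s) (m \<circ> t)"
    proof (rule less.hyps)
      show "card (V - {v}) < card V" using uvV(2) by (intro card_Diff1_less) auto
      show "finite E'" using fin by (simp add: E'_def)
      show "(m \<circ> s) f \<in> V - {v} \<and> (m \<circ> t) f \<in> V - {v} \<and> (m \<circ> s) f \<noteq> (m \<circ> t) f" if "f \<in> E'" for f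
        using that ends[of f] uvV uv(3) by (auto simp: E'_def m_def doubleton_eq_iff)
      \<comment> \<open>Deleting the merged vertex leaves the old graph minus both \<open>u\<close>
        and \<open>v\<close>, which is where the choice of a contractible edge is needed. For any
        other vertex, the contraction is a connected image.\<close>
      show "cut_connected (adj E' (m \<circ> s) (m \<circ> t)) (V - {v} - {x})" if x: "x \<in> V - {v}" for x
      proof (cases "x = u")
        case True
        have "m ` (V - {u, v}) = V - {u, v}" by (auto simp: m_def)
        moreover have "V - {v} - {x} = V - {u, v}" using True by blast
        ultimately show ?thesis using conn_img[OF uv(4)] by simp
      next
        case False
        have "m ` (V - {x}) = V - {v} - {x}" using mV[of "V - {x}"] False uvV by auto
        then show ?thesis using conn_img[OF conn[of x]] x by simp
      qed
      show "minor_model (V - {v}) (adj E' (m \<circ> s) (m \<circ> t)) W R \<phi>"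
        unfolding minor_model_def
      proof (intro conjI ballI impI)
        have "\<phi> ` m ` V = \<phi> ` V" by (simp add: image_image \<phi>m)
        then show "\<phi> ` (V - {v}) = W" using img mV[OF uvV(1)] by simp
      next
        fix h assume "h \<in> W"
        then have "cut_connected (adj E s t) {x \<in> V. \<phi> x = h}" using model by (simp add: minor_model_def)
        moreover have "m ` {x \<in> V. \<phi> x = h} = {x \<in> V - {v}. \<phi> x = h}"
          using uvV uv(3) \<phi>uv by (auto simp: m_def)
        ultimately show "cut_connected (adj E' (m \<circ> s) (m \<circ> t)) {x \<in> V - {v}. \<phi> x = h}"
          using conn_img by metis
      next
        fix h h' assume h: "h \<in> W" "h' \<in> W" "R h h'"
        then obtain x y where xy: "x \<in> V" "y \<in> V" "\<phi> x = h" "\<phi> y = h'" "adj E s t x y"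
          using model unfolding minor_model_def by blast
        have "m x \<noteq> m y" using \<phi>m[of x] \<phi>m[of y] xy(3,4) W(2) h(3) by metis
        then have "adj E' (m \<circ> s) (m \<circ> t) (m x) (m y)" using adj' xy(5) by blast
        moreover have "m x \<in> V - {v}" "m y \<in> V - {v}" using mV[OF uvV(1)] xy(1,2) by blast+
        ultimately show "\<exists>x\<in>V - {v}. \<exists>y\<in>V - {v}. \<phi> x = h \<and> \<phi> y = h' \<and> adj E' (m \<circ> s) (m \<circ> t) x y"
          using \<phi>m xy(3,4) by metis
      qed
    qed
    moreover have "m = (\<lambda>x. if x = t e then s e else x)" by (auto simp: m_def u_def v_def)
    ultimately have real': "realizable (V - {t e}) E' ((\<lambda>x. if x = t e then s e else x) \<circ> s) ((\<lambda>x. if x =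
          t e then s e else x) \<circ> t)"
      by (simp add: v_def)
    \<comment> \<open>With at least three vertices, connectedness after deleting one half gives the
      other half an edge to a third vertex.\<close>
    have inc: "incident E' s t x \<noteq> {}" if xy: "x \<in> V" "y \<in> V" "x \<noteq> y" "{x, y} = {u, v}" for x y
    proof -
      have "\<not> V \<subseteq> {x, y}" using card3 card_mono[of "{x, y}" V] xy(3) by auto
      then have "{x} \<noteq> V - {y}" using xy by blast
      then have "\<exists>a\<in>{x}. \<exists>b\<in>V - {y} - {x}. adj E s t a b"
        using xy by (intro cut_connectedD[OF conn[OF xy(2)]]) auto
      then obtain b where b: "b \<in> V - {y} - {x}" "adj E s t x b" by blast
      then obtain f where f: "f \<in> E" "{s f, t f} = {x, b}" unfolding adj_def by blast
      then have "{s f, t f} \<noteq> {u, v}" using b(1) xy(4)[symmetric] by (auto simp: doubleton_eq_iff)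
      moreover have "x \<in> {s f, t f}" using f(2) by simp
      ultimately have "f \<in> incident E' s t x" using f(1) unfolding incident_def E'_def by blast
      then show ?thesis by blast
    qed
    have "realizable V (insert e E') s t"
    proof (rule realizable_split_vertex[where s = s and t = t and e = e and V = V and E = E', OF real'])
      show "incident E' s t (s e) \<noteq> {}" using inc[of u v] uvV uv(3) by (simp add: u_def v_def)
      show "incident E' s t (t e) \<noteq> {}" using inc[of v u] uvV uv(3) by (simp add: u_def v_def insert_commute)
    qed (use fin e ends in \<open>auto simp: E'_def u_def v_def\<close>)
    then show ?thesis
      using realizable_superset[of V "insert e E'" s t E] fin e(1) ends by (auto simp: E'_def)
  qed
qed

section \<open>Transport to spanning subgraphs\<close>

text \<open>Orientations need not correspond. The sign \<open>sg\<close> records where they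
  disagree, and it cancels because scalar and vector differences occur in pairs.\<close>

lemma realizable_iso:
  fixes V :: "'v set" and W :: "'w set" and F :: "'f set"
  assumes \<nu>: "bij_betw \<nu> W V" and \<epsilon>: "inj_on \<epsilon> F"
    and ends: "\<And>g. g \<in> F \<Longrightarrow> {s (\<epsilon> g), t (\<epsilon> g)} = {\<nu> (s' g), \<nu> (t' g)}"
    and W: "\<And>g. g \<in> F \<Longrightarrow> s' g \<in> W \<and> t' g \<in> W"
    and "realizable W F s' t'"
  shows "realizable V (\<epsilon> ` F) s t"
proof -
  obtain w q where ss: "superstable_stress W F s' t' w q" and gen: "generic_stress W F s' t' w q"
    using assms(5) unfolding realizable_def by blast
  have eq: "in_equilibrium F s' t' w q" and psd: "pos_energy_on (\<lambda>x. True) W F s' t' w q"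
    and aff: "affinely_spanning W q" and con: "conic_free F s' t' q"
    using ss by (auto simp: superstable_stress_def)
  define \<mu> where "\<mu> = inv_into W \<nu>"
  have \<mu>: "\<mu> (\<nu> i) = i" if "i \<in> W" for i using \<nu> that by (simp add: \<mu>_def bij_betw_def inv_into_f_f)
  have V: "V = \<nu> ` W" using \<nu> by (simp add: bij_betw_def)
  define p where "p = q \<circ> \<mu>"
  define w' where "w' = w \<circ> inv_into F \<epsilon>"
  have w': "w' (\<epsilon> g) = w g" if "g \<in> F" for g using \<epsilon> that by (simp add: w'_def inv_into_f_f)
  define sg :: "'f \<Rightarrow> real" where "sg g = (if s (\<epsilon> g) = \<nu> (s' g) then 1 else -1)" for g
  have sg_cases: "sg g = 1 \<or> sg g = -1" for g by (simp add: sg_def)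
  have dx: "edge_diff s t x (\<epsilon> g) = sg g * edge_diff s' t' (x \<circ> \<nu>) g" if "g \<in> F" for x :: "'v \<Rightarrow> real" and g
    using ends[OF that] by (auto simp: sg_def doubleton_eq_iff)
  have dp: "edge_diff s t p (\<epsilon> g) = sg g *\<^sub>R edge_diff s' t' q g" if "g \<in> F" for g
    using ends[OF that] W[OF that] \<mu> by (auto simp: sg_def doubleton_eq_iff p_def)
  have summand: "(w' (\<epsilon> g) * edge_diff s t x (\<epsilon> g)) *\<^sub>R edge_diff s t p (\<epsilon> g) =
      (w g * edge_diff s' t' (x \<circ> \<nu>) g) *\<^sub>R edge_diff s' t' q g" if "g \<in> F" for g x
    unfolding w'[OF that] dx[OF that] dp[OF that] scaleR_scaleR using sg_cases[of g] by auto
  have en: "energy (\<epsilon> ` F) s t w' x = energy F s' t' w (x \<circ> \<nu>)" for x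
    unfolding energy_def sum.reindex[OF \<epsilon>]
  proof (rule sum.cong[OF refl])
    fix g assume g: "g \<in> F"
    show "((\<lambda>e. w' e * (edge_diff s t x e)\<^sup>2) \<circ> \<epsilon>) g = w g * (edge_diff s' t' (x \<circ> \<nu>) g)\<^sup>2"
      unfolding o_apply[of _ \<epsilon>] w'[OF g] dx[OF g] using sg_cases[of g] by (auto simp: power2_commute)
  qed
  have "in_equilibrium (\<epsilon> ` F) s t w' p"
    unfolding in_equilibrium_def
  proof
    fix x :: "'v \<Rightarrow> real"
    have "(\<Sum>e\<in>\<epsilon> ` F. (w' e * edge_diff s t x e) *\<^sub>R edge_diff s t p e) =
        (\<Sum>g\<in>F. (w g * edge_diff s' t' (x \<circ> \<nu>) g) *\<^sub>R edge_diff s' t' q g)"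
      unfolding sum.reindex[OF \<epsilon>] by (rule sum.cong[OF refl]) (simp only: o_apply[of _ \<epsilon>] summand)
    then show "(\<Sum>e\<in>\<epsilon> ` F. (w' e * edge_diff s t x e) *\<^sub>R edge_diff s t p e) = 0"
      using eq unfolding in_equilibrium_def by metis
  qed
  moreover have "pos_energy_on (\<lambda>x. True) V (\<epsilon> ` F) s t w' p"
    unfolding pos_energy_on_def
  proof (intro allI impI)
    fix x
    show "0 \<le> energy (\<epsilon> ` F) s t w' x \<and> (energy (\<epsilon> ` F) s t w' x = 0 \<longrightarrow> (\<exists>a b. \<forall>i\<in>V. x i = a \<bullet> p i + b))"
      using psd[unfolded pos_energy_on_def, rule_format, of "x \<circ> \<nu>"] \<mu> by (simp add: en V p_def)
  qed
  moreover have "affinely_spanning V p"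
    using aff \<mu> unfolding affinely_spanning_def V by (simp add: p_def)
  moreover have "conic_free (\<epsilon> ` F) s t p"
    unfolding conic_free_def
  proof (intro allI impI)
    fix S :: "real ^ 3 ^ 3"
    assume S: "transpose S = S" "\<forall>e\<in>\<epsilon> ` F. edge_diff s t p e \<bullet> (S *v edge_diff s t p e) = 0"
    have "edge_diff s' t' q g \<bullet> (S *v edge_diff s' t' q g) = 0" if "g \<in> F" for g
    proof -
      have "edge_diff s t p (\<epsilon> g) \<bullet> (S *v edge_diff s t p (\<epsilon> g)) = 0" using S(2) that by blast
      then show ?thesis
        unfolding dp[OF that] matrix_vector_mult_scaleR inner_scaleR_left inner_scaleR_right
        using sg_cases[of g] by auto
    qed
    then show "S = 0" using con S(1) unfolding conic_free_def by blast
  qed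
  moreover have "generic_stress V (\<epsilon> ` F) s t w' p"
    unfolding generic_stress_def
  proof (intro conjI ballI allI impI)
    show "w' e \<noteq> 0" if "e \<in> \<epsilon> ` F" for e using that w' gen by (auto simp: generic_stress_def)
    show "inj_on p V"
    proof -
      have "inj_on q W" using gen by (simp add: generic_stress_def)
      then show ?thesis by (auto simp: p_def V \<mu> intro!: inj_onI dest: inj_onD)
    qed
    fix i X assume i: "i \<in> V" and X: "X \<noteq> {}" "X \<subset> incident (\<epsilon> ` F) s t i"
    obtain j where j: "j \<in> W" "i = \<nu> j" using i V by blast
    define Y where "Y = {g \<in> F. \<epsilon> g \<in> X}"
    have XY: "X = \<epsilon> ` Y" using X(2) by (auto simp: Y_def incident_def)
    have inj\<nu>: "\<nu> x = \<nu> y \<longleftrightarrow> x = y" if "x \<in> W" "y \<in> W" for x y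
      using \<nu> that by (auto simp: bij_betw_def inj_on_def)
    have inc: "incident (\<epsilon> ` F) s t i = \<epsilon> ` incident F s' t' j"
    proof -
      have "(s (\<epsilon> g) = i \<or> t (\<epsilon> g) = i) \<longleftrightarrow> (s' g = j \<or> t' g = j)" if "g \<in> F" for g
      proof -
        have "(s (\<epsilon> g) = i \<or> t (\<epsilon> g) = i) \<longleftrightarrow> i \<in> {s (\<epsilon> g), t (\<epsilon> g)}" by auto
        then show ?thesis unfolding ends[OF that] j(2) using inj\<nu> W[OF that] j(1) by auto
      qed
      then show ?thesis by (auto simp: incident_def)
    qed
    have "Y \<noteq> {}" "Y \<subset> incident F s' t' j"
    proof -
      show "Y \<noteq> {}" using X(1) XY by blast
      have "Y \<subseteq> incident F s' t' j"
      proof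
        fix g assume g: "g \<in> Y"
        then have "\<epsilon> g \<in> \<epsilon> ` incident F s' t' j" using X(2) inc by (auto simp: Y_def)
        then show "g \<in> incident F s' t' j" using g \<epsilon> by (auto simp: Y_def incident_def inj_on_def)
      qed
      moreover have "Y \<noteq> incident F s' t' j" using X(2) inc XY by blast
      ultimately show "Y \<subset> incident F s' t' j" by blast
    qed
    then have "force s' t' w q Y j \<noteq> 0" using gen j(1) unfolding generic_stress_def by blast
    moreover have "force s t w' p X i = force s' t' w q Y j"
    proof -
      have inj: "inj_on \<epsilon> Y" using \<epsilon> by (auto simp: Y_def inj_on_def)
      have "(w' (\<epsilon> g) * edge_diff s t (indicator {i}) (\<epsilon> g)) *\<^sub>R edge_diff s t p (\<epsilon> g) =
          (w g * edge_diff s' t' (indicator {j}) g) *\<^sub>R edge_diff s' t' q g" if "g \<in> Y" for g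
      proof -
        have g: "g \<in> F" using that by (simp add: Y_def)
        then show ?thesis
          unfolding summand[OF g] using inj\<nu> W[OF g] j by (simp add: indicator_def)
      qed
      then show ?thesis unfolding force_def XY sum.reindex[OF inj] by (simp add: o_def)
    qed
    ultimately show "force s t w' p X i \<noteq> 0" by simp
  qed
  ultimately show ?thesis unfolding realizable_def superstable_stress_def by blast
qed

text \<open>One edge of the host graph is selected for each edge of the model. The order
  \<open>i < j\<close> makes each unordered pair occur only once in \<open>F\<close>, so the
  selection is injective.\<close>

lemma realizable_spanning:
  assumes "realizable W F fst snd" and F: "\<And>i j. (i, j) \<in> F \<Longrightarrow> i \<in> W \<and> j \<in> W \<and> i < (j :: 'w::linorder)"
    and R: "\<And>i j. (i, j) \<in> F \<Longrightarrow> R i j"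
    and model: "minor_model V (adj E s t) W R \<phi>" and inj: "inj_on \<phi> V"
  shows "\<exists>E0\<subseteq>E. realizable V E0 s t"
proof -
  define \<nu> where "\<nu> = inv_into V \<phi>"
  have "bij_betw \<phi> V W" using model inj by (simp add: bij_betw_def minor_model_def)
  then have \<nu>: "bij_betw \<nu> W V" unfolding \<nu>_def by (rule bij_betw_inv_into)
  have "\<exists>e\<in>E. {s e, t e} = {\<nu> (fst g), \<nu> (snd g)}" if "g \<in> F" for g
  proof -
    have g: "(fst g, snd g) \<in> F" using that by simp
    obtain x y where xy: "x \<in> V" "y \<in> V" "\<phi> x = fst g" "\<phi> y = snd g" "adj E s t x y"
      using model F[OF g] R[OF g] unfolding minor_model_def by blast
    then have "x = \<nu> (fst g)" "y = \<nu> (snd g)"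
      using inv_into_f_f[OF inj xy(1)] inv_into_f_f[OF inj xy(2)] by (simp_all add: \<nu>_def)
    then show ?thesis using xy(5) by (simp add: adj_def)
  qed
  then obtain \<epsilon> where \<epsilon>: "\<And>g. g \<in> F \<Longrightarrow> \<epsilon> g \<in> E \<and> {s (\<epsilon> g), t (\<epsilon> g)} = {\<nu> (fst g), \<nu> (snd g)}"
    by metis
  have "inj_on \<epsilon> F"
  proof (rule inj_onI)
    fix g g' assume g: "g \<in> F" "g' \<in> F" "\<epsilon> g = \<epsilon> g'"
    have F': "fst g \<in> W" "snd g \<in> W" "fst g < snd g" "fst g' \<in> W" "snd g' \<in> W" "fst g' < snd g'"
      using F[of "fst g" "snd g"] F[of "fst g'" "snd g'"] g by auto
    have "\<nu> ` {fst g, snd g} = \<nu> ` {fst g', snd g'}" using \<epsilon>[OF g(1)] \<epsilon>[OF g(2)] g(3) by simp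
    then have "{fst g, snd g} = {fst g', snd g'}"
      using \<nu> F' by (subst (asm) inj_on_image_eq_iff[of \<nu> W]) (auto simp: bij_betw_def)
    then show "g = g'" using F' by (auto simp: doubleton_eq_iff prod_eq_iff)
  qed
  then have "realizable V (\<epsilon> ` F) s t"
    using \<nu> \<epsilon> F assms(1) by (intro realizable_iso[of \<nu> W V \<epsilon> F s t fst snd]) auto
  then show ?thesis using \<epsilon> by (intro exI[of _ "\<epsilon> ` F"]) auto
qed

section \<open>Explicit realizations\<close>

lemma map_filter_in_subseqs: "map f (filter P xs) \<in> set (subseqs (map f xs))"
  by (induction xs) (auto simp: Let_def)

text \<open>Projecting the forces to a single direction \<open>c\<close> turns genericity at a
  vertex into a finite check of subset sums of numbers. The \<open>c\<close> used below are chosen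
  so that no nonempty proper sublist of \<open>ks\<close> adds up to zero.\<close>

lemma force_ne_zeroI:
  fixes c :: "real ^ 3"
  assumes inc: "incident E s t i = set es" and dist: "distinct es"
    and ks: "map (\<lambda>e. c \<bullet> ((w e * edge_diff s t (indicator {i}) e) *\<^sub>R edge_diff s t p e)) es = ks"
    and sums: "\<forall>ys\<in>set (subseqs ks). ys \<noteq> [] \<longrightarrow> length ys \<noteq> length ks \<longrightarrow> sum_list ys \<noteq> 0"
    and F: "F \<noteq> {}" "F \<subset> incident E s t i"
  shows "force s t w p F i \<noteq> 0"
proof
  assume "force s t w p F i = 0"
  let ?\<kappa> = "\<lambda>e. c \<bullet> ((w e * edge_diff s t (indicator {i}) e) *\<^sub>R edge_diff s t p e)"
  let ?ys = "filter (\<lambda>e. e \<in> F) es"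
  have ys: "set ?ys = F" "distinct ?ys" using F inc dist by auto
  have "sum_list (map ?\<kappa> ?ys) = (\<Sum>e\<in>F. ?\<kappa> e)"
    using ys by (simp add: sum_list_distinct_conv_sum_set)
  also have "\<dots> = c \<bullet> force s t w p F i" by (simp add: force_def inner_sum_right)
  also have "\<dots> = 0" using \<open>force s t w p F i = 0\<close> by simp
  finally have "sum_list (map ?\<kappa> ?ys) = 0" .
  moreover have "map ?\<kappa> ?ys \<in> set (subseqs ks)"
    unfolding ks[symmetric] by (rule map_filter_in_subseqs)
  moreover have "?ys \<noteq> []" using ys(1) F(1) by (metis list.set(1))
  moreover have "length ?ys \<noteq> length ks"
  proof -
    have "card F < card (set es)" using F(2) inc by (intro psubset_card_mono) auto
    moreover have "length ks = card (set es)" unfolding ks[symmetric] using dist by (simp add: distinct_card)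
    moreover have "length ?ys = card F" using distinct_card[OF ys(2)] ys(1) by simp
    ultimately show ?thesis by simp
  qed
  ultimately show False using sums by auto
qed

text \<open>The weights are \<open>- c\<^sub>i c\<^sub>j\<close>, where \<open>c = (1, 1, 1, -1, -2)\<close> is the affine dependency of the points.\<close>

definition k5_edges :: "(int \<times> int) set" where
  "k5_edges = {(0, 1), (0, 2), (0, 3), (0, 4), (1, 2), (1, 3), (1, 4), (2, 3), (2, 4), (3, 4)}"

definition k5_weight :: "int \<times> int \<Rightarrow> real" where
  "k5_weight = (\<lambda>_. 0)((0, 1) := -1, (0, 2) := -1, (0, 3) := 1, (0, 4) := 2, (1, 2) := -1, (1, 3) := 1,
    (1, 4) := 2, (2, 3) := 1, (2, 4) := 2, (3, 4) := -2)"

definition k5_point :: "int \<Rightarrow> real ^ 3" where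
  "k5_point = (\<lambda>_. 0)(0 := vector [1, 0, 0], 1 := vector [0, 1, 0], 2 := vector [0, 0, 1], 3 := vector [1, 1, 1],
    4 := vector [0, 0, 0])"

text \<open>The Laplacian has rank one, the least possible excess over a kernel of dimension four on
  five vertices.\<close>

lemma k5_energy:
  "energy k5_edges fst snd k5_weight x = (x 0 + x 1 + x 2 - x 3 - 2 * x 4)\<^sup>2"
  unfolding energy_def by (simp add: k5_edges_def k5_weight_def) (simp add: power2_eq_square algebra_simps)

lemma k5_superstable_stress: "superstable_stress {0, 1, 2, 3, 4} k5_edges fst snd k5_weight k5_point"
  unfolding superstable_stress_def
proof (intro conjI)
  show "in_equilibrium k5_edges fst snd k5_weight k5_point"
    unfolding in_equilibrium_def
    by (simp add: k5_edges_def k5_weight_def k5_point_def vec_eq_iff forall_3)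
  show "pos_energy_on (\<lambda>_. True) {0, 1, 2, 3, 4} k5_edges fst snd k5_weight k5_point"
    unfolding pos_energy_on_def
  proof (intro allI impI conjI)
    fix x :: "int \<Rightarrow> real"
    show "0 \<le> energy k5_edges fst snd k5_weight x" unfolding k5_energy by simp
    assume "energy k5_edges fst snd k5_weight x = 0"
    then have "x 0 + x 1 + x 2 - x 3 - 2 * x 4 = 0"
      unfolding k5_energy by (simp_all add: add_nonneg_eq_0_iff)
    then show "\<exists>a b. \<forall>i\<in>{0, 1, 2, 3, 4}. x i = a \<bullet> k5_point i + b"
      \<comment> \<open>Affine interpolation at vertices 0, 1, 2, 4, placed at the unit vectors and
        the origin; the energy equation takes care of vertex 3.\<close>
      by (intro exI[of _ "vector [(x 0 - x 4), (x 1 - x 4), (x 2 - x 4)]"] exI[of _ "x 4"])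
        (simp add: k5_point_def inner_vec_def sum_3 field_simps)
  qed
  show "affinely_spanning {0, 1, 2, 3, 4} k5_point"
    unfolding affinely_spanning_def
    by (simp add: k5_point_def inner_vec_def sum_3 vec_eq_iff forall_3)
  show "conic_free k5_edges fst snd k5_point"
    unfolding conic_free_def
  proof (intro allI impI)
    fix S :: "real ^ 3 ^ 3"
    assume "transpose S = S"
      and S: "\<forall>e\<in>k5_edges. edge_diff fst snd k5_point e \<bullet> (S *v edge_diff fst snd k5_point e) = 0"
    then have sym: "S $ 2 $ 1 = S $ 1 $ 2" "S $ 3 $ 1 = S $ 1 $ 3" "S $ 3 $ 2 = S $ 2 $ 3"
      by (auto simp: transpose_def vec_eq_iff)
    show "S = 0"
      using S by (simp add: k5_edges_def k5_point_def inner_vec_def matrix_vector_mult_def sum_3 sym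
        vec_eq_iff forall_3 algebra_simps)
  qed
qed

lemma k5_generic_stress: "generic_stress {0, 1, 2, 3, 4} k5_edges fst snd k5_weight k5_point"
proof -
  have nz: "\<forall>e\<in>k5_edges. k5_weight e \<noteq> 0"
    by (simp add: k5_edges_def k5_weight_def)
  have inj: "inj_on k5_point {0, 1, 2, 3, 4}"
    by (simp add: k5_point_def vec_eq_iff forall_3)
  have force: "\<forall>i\<in>{0, 1, 2, 3, 4}. \<forall>F. F \<noteq> {} \<longrightarrow> F \<subset> incident k5_edges fst snd i \<longrightarrow>
      force fst snd k5_weight k5_point F i \<noteq> 0"
  proof (intro ballI allI impI, elim insertE emptyE; hypsubst)
    show "force fst snd k5_weight k5_point F 0 \<noteq> 0" if "F \<noteq> {}" "F \<subset> incident k5_edges fst snd 0" for F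
      by (rule force_ne_zeroI[OF _ _ _ _ that, where es = "[(0, 1), (0, 2), (0, 3), (0, 4)]"
        and c = "vector [-2, -1, 0]" and ks = "[1, 2, 1, -4]"])
        (auto simp: incident_def k5_edges_def k5_weight_def k5_point_def inner_vec_def sum_3 indicator_def)
    show "force fst snd k5_weight k5_point F 1 \<noteq> 0" if "F \<noteq> {}" "F \<subset> incident k5_edges fst snd 1" for F
      by (rule force_ne_zeroI[OF _ _ _ _ that, where es = "[(0, 1), (1, 2), (1, 3), (1, 4)]"
        and c = "vector [-2, 1, 0]" and ks = "[-3, -1, 2, 2]"])
        (auto simp: incident_def k5_edges_def k5_weight_def k5_point_def inner_vec_def sum_3 indicator_def)
    show "force fst snd k5_weight k5_point F 2 \<noteq> 0" if "F \<noteq> {}" "F \<subset> incident k5_edges fst snd 2" for F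
      by (rule force_ne_zeroI[OF _ _ _ _ that, where es = "[(0, 2), (1, 2), (2, 3), (2, 4)]"
        and c = "vector [-2, 0, 1]" and ks = "[-3, -1, 2, 2]"])
        (auto simp: incident_def k5_edges_def k5_weight_def k5_point_def inner_vec_def sum_3 indicator_def)
    show "force fst snd k5_weight k5_point F 3 \<noteq> 0" if "F \<noteq> {}" "F \<subset> incident k5_edges fst snd 3" for F
      by (rule force_ne_zeroI[OF _ _ _ _ that, where es = "[(0, 3), (1, 3), (2, 3), (3, 4)]"
        and c = "vector [-1, -1, 0]" and ks = "[-1, -1, -2, 4]"])
        (auto simp: incident_def k5_edges_def k5_weight_def k5_point_def inner_vec_def sum_3 indicator_def)
    show "force fst snd k5_weight k5_point F 4 \<noteq> 0" if "F \<noteq> {}" "F \<subset> incident k5_edges fst snd 4" for F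
      by (rule force_ne_zeroI[OF _ _ _ _ that, where es = "[(0, 4), (1, 4), (2, 4), (3, 4)]"
        and c = "vector [-1, -1, -1]" and ks = "[2, 2, 2, -6]"])
        (auto simp: incident_def k5_edges_def k5_weight_def k5_point_def inner_vec_def sum_3 indicator_def)
  qed
  from nz inj force show ?thesis unfolding generic_stress_def by blast
qed

text \<open>The Laplacian is the Gram matrix of six vectors in the plane with sum zero,
  \<open>(-1, -1), (-1, 1), (-1, 0), (0, 1), (2, 1), (1, -2)\<close>, in which nonadjacent vertices get orthogonal
  vectors; the points are a Gale dual. The colour classes are \<open>{0, 1}\<close>, \<open>{2, 3}\<close> and \<open>{4, 5}\<close>.\<close>

definition k222_edges :: "(int \<times> int) set" where
  "k222_edges = {(0, 2), (0, 3), (0, 4), (0, 5), (1, 2), (1, 3), (1, 4), (1, 5), (2, 4), (2, 5), (3, 4),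
    (3, 5)}"

definition k222_weight :: "int \<times> int \<Rightarrow> real" where
  "k222_weight = (\<lambda>_. 0)((0, 2) := -1, (0, 3) := 1, (0, 4) := 3, (0, 5) := -1, (1, 2) := -1, (1, 3) := -1,
    (1, 4) := 1, (1, 5) := 3, (2, 4) := 2, (2, 5) := 1, (3, 4) := -1, (3, 5) := 2)"

text \<open>Vertices 1, 3, 4, 5 are placed at the unit vectors and the origin; the two relations of
  rank two in \<open>k222_energy\<close> then determine the points 0 and 2.\<close>

definition k222_point :: "int \<Rightarrow> real ^ 3" where
  "k222_point = (\<lambda>_. 0)(0 := vector [1, 1, 1], 1 := vector [1, 0, 0], 2 := vector [-2, -1, 1],
    3 := vector [0, 1, 0], 4 := vector [0, 0, 1], 5 := vector [0, 0, 0])"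

text \<open>The two linear forms are the coordinates of the six plane vectors, so the kernel has
  dimension four.\<close>

lemma k222_energy:
  "energy k222_edges fst snd k222_weight x = (- x 0 - x 1 - x 2 + 2 * x 4 + x 5)\<^sup>2 + (- x 0 + x 1 + x 3
        + x 4 - 2 * x 5)\<^sup>2"
  unfolding energy_def by (simp add: k222_edges_def k222_weight_def) (simp add: power2_eq_square
    algebra_simps)

lemma k222_superstable_stress: "superstable_stress {0, 1, 2, 3, 4, 5} k222_edges fst snd k222_weight k222_point"
  unfolding superstable_stress_def
proof (intro conjI)
  show "in_equilibrium k222_edges fst snd k222_weight k222_point"
    unfolding in_equilibrium_def
    by (simp add: k222_edges_def k222_weight_def k222_point_def vec_eq_iff forall_3)
  show "pos_energy_on (\<lambda>_. True) {0, 1, 2, 3, 4, 5} k222_edges fst snd k222_weight k222_point"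
    unfolding pos_energy_on_def
  proof (intro allI impI conjI)
    fix x :: "int \<Rightarrow> real"
    show "0 \<le> energy k222_edges fst snd k222_weight x" unfolding k222_energy by simp
    assume "energy k222_edges fst snd k222_weight x = 0"
    then have "- x 0 - x 1 - x 2 + 2 * x 4 + x 5 = 0" "- x 0 + x 1 + x 3 + x 4 - 2 * x 5 = 0"
      unfolding k222_energy by (simp_all add: add_nonneg_eq_0_iff)
    then show "\<exists>a b. \<forall>i\<in>{0, 1, 2, 3, 4, 5}. x i = a \<bullet> k222_point i + b"
      by (intro exI[of _ "vector [(x 1 - x 5), (x 3 - x 5), (x 4 - x 5)]"] exI[of _ "x 5"])
        (simp add: k222_point_def inner_vec_def sum_3 field_simps)
  qed
  show "affinely_spanning {0, 1, 2, 3, 4, 5} k222_point"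
    unfolding affinely_spanning_def
    by (simp add: k222_point_def inner_vec_def sum_3 vec_eq_iff forall_3)
  show "conic_free k222_edges fst snd k222_point"
    unfolding conic_free_def
  proof (intro allI impI)
    fix S :: "real ^ 3 ^ 3"
    assume "transpose S = S"
      and S: "\<forall>e\<in>k222_edges. edge_diff fst snd k222_point e \<bullet> (S *v edge_diff fst snd k222_point e) = 0"
    then have sym: "S $ 2 $ 1 = S $ 1 $ 2" "S $ 3 $ 1 = S $ 1 $ 3" "S $ 3 $ 2 = S $ 2 $ 3"
      by (auto simp: transpose_def vec_eq_iff)
    show "S = 0"
      using S by (simp add: k222_edges_def k222_point_def inner_vec_def matrix_vector_mult_def sum_3 sym
        vec_eq_iff forall_3 algebra_simps)
  qed
qed

lemma k222_generic_stress: "generic_stress {0, 1, 2, 3, 4, 5} k222_edges fst snd k222_weight k222_point"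
proof -
  have nz: "\<forall>e\<in>k222_edges. k222_weight e \<noteq> 0"
    by (simp add: k222_edges_def k222_weight_def)
  have inj: "inj_on k222_point {0, 1, 2, 3, 4, 5}"
    by (simp add: k222_point_def vec_eq_iff forall_3)
  have force: "\<forall>i\<in>{0, 1, 2, 3, 4, 5}. \<forall>F. F \<noteq> {} \<longrightarrow> F \<subset> incident k222_edges fst snd i \<longrightarrow>
      force fst snd k222_weight k222_point F i \<noteq> 0"
  proof (intro ballI allI impI, elim insertE emptyE; hypsubst)
    show "force fst snd k222_weight k222_point F 0 \<noteq> 0" if "F \<noteq> {}" "F \<subset> incident k222_edges fst snd 0" for F
      by (rule force_ne_zeroI[OF _ _ _ _ that, where es = "[(0, 2), (0, 3), (0, 4), (0, 5)]"
        and c = "vector [-1, -1, 0]" and ks = "[5, -1, -6, 2]"])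
        (auto simp: incident_def k222_edges_def k222_weight_def k222_point_def inner_vec_def sum_3
          indicator_def)
    show "force fst snd k222_weight k222_point F 1 \<noteq> 0" if "F \<noteq> {}" "F \<subset> incident k222_edges fst snd 1" for F
      by (rule force_ne_zeroI[OF _ _ _ _ that, where es = "[(1, 2), (1, 3), (1, 4), (1, 5)]"
        and c = "vector [-1, 0, 1]" and ks = "[4, 1, -2, -3]"])
        (auto simp: incident_def k222_edges_def k222_weight_def k222_point_def inner_vec_def sum_3
          indicator_def)
    show "force fst snd k222_weight k222_point F 2 \<noteq> 0" if "F \<noteq> {}" "F \<subset> incident k222_edges fst snd 2" for F
      by (rule force_ne_zeroI[OF _ _ _ _ that, where es = "[(0, 2), (1, 2), (2, 4), (2, 5)]"
        and c = "vector [-1, 0, 0]" and ks = "[-3, -3, 4, 2]"])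
        (auto simp: incident_def k222_edges_def k222_weight_def k222_point_def inner_vec_def sum_3
          indicator_def)
    show "force fst snd k222_weight k222_point F 3 \<noteq> 0" if "F \<noteq> {}" "F \<subset> incident k222_edges fst snd 3" for F
      by (rule force_ne_zeroI[OF _ _ _ _ that, where es = "[(0, 3), (1, 3), (3, 4), (3, 5)]"
        and c = "vector [-2, 1, 0]" and ks = "[2, -3, -1, 2]"])
        (auto simp: incident_def k222_edges_def k222_weight_def k222_point_def inner_vec_def sum_3
          indicator_def)
    show "force fst snd k222_weight k222_point F 4 \<noteq> 0" if "F \<noteq> {}" "F \<subset> incident k222_edges fst snd 4" for F
      by (rule force_ne_zeroI[OF _ _ _ _ that, where es = "[(0, 4), (1, 4), (2, 4), (3, 4)]"
        and c = "vector [-1, 0, 1]" and ks = "[3, 2, -4, -1]"])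
        (auto simp: incident_def k222_edges_def k222_weight_def k222_point_def inner_vec_def sum_3
          indicator_def)
    show "force fst snd k222_weight k222_point F 5 \<noteq> 0" if "F \<noteq> {}" "F \<subset> incident k222_edges fst snd 5" for F
      by (rule force_ne_zeroI[OF _ _ _ _ that, where es = "[(0, 5), (1, 5), (2, 5), (3, 5)]"
        and c = "vector [-2, -1, 0]" and ks = "[-3, 6, -5, 2]"])
        (auto simp: incident_def k222_edges_def k222_weight_def k222_point_def inner_vec_def sum_3
          indicator_def)
  qed
  from nz inj force show ?thesis unfolding generic_stress_def by blast
qed

text \<open>The bipartition is \<open>{0, 1, 2, 3}\<close>, \<open>{4, 5, 6, 7}\<close>, with \<open>i\<close> and \<open>i + 4\<close> antipodal. The bipartite block
  of the weight matrix is a skew conference matrix of order 4, with rows and columns scaled so that the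
  kernel of the Laplacian contains the constants.\<close>

definition q3_edges :: "(int \<times> int) set" where
  "q3_edges = {(0, 5), (0, 6), (0, 7), (1, 4), (1, 6), (1, 7), (2, 4), (2, 5), (2, 7), (3, 4), (3, 5),
    (3, 6)}"

definition q3_weight :: "int \<times> int \<Rightarrow> real" where
  "q3_weight = (\<lambda>_. 0)((0, 5) := -1, (0, 6) := 1, (0, 7) := 1, (1, 4) := 1, (1, 6) := -1, (1, 7) := 1,
    (2, 4) := -1, (2, 5) := 1, (2, 7) := 1, (3, 4) := 3, (3, 5) := 3, (3, 6) := 3)"

text \<open>Vertices 0 to 3 are placed at multiples of the unit vectors and the origin; each square
  in \<open>q3_energy\<close> then determines one of the others. The factor 3 avoids
  fractions.\<close>

definition q3_point :: "int \<Rightarrow> real ^ 3" where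
  "q3_point = (\<lambda>_. 0)(0 := vector [3, 0, 0], 1 := vector [0, 3, 0], 2 := vector [0, 0, 3], 3 := vector [0, 0, 0],
    4 := vector [0, 1, -1], 5 := vector [-1, 0, 1], 6 := vector [1, -1, 0],
    7 := vector [1, 1, 1])"

text \<open>Each square belongs to one of the vertices 4 to 7 and involves just its three
  neighbours. Mixed products of the variables 0 to 3 cancel by orthogonality in the conference
  matrix, so only edges of the cube get a weight.\<close>

lemma q3_energy:
  "energy q3_edges fst snd q3_weight x = ((- x 1 + x 2 - 3 * x 3 + 3 * x 4)\<^sup>2 + (- x 0 + x 2
        + 3 * x 3 - 3 * x 5)\<^sup>2 + (- x 0 + x 1 - 3 * x 3 + 3 * x 6)\<^sup>2 + (- x 0 - x 1 - x 2 + 3 * x 7)\<^sup>2) / 3"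
  unfolding energy_def by (simp add: q3_edges_def q3_weight_def) (simp add: power2_eq_square algebra_simps)

lemma q3_superstable_stress: "superstable_stress {0, 1, 2, 3, 4, 5, 6, 7} q3_edges fst snd q3_weight q3_point"
  unfolding superstable_stress_def
proof (intro conjI)
  show "in_equilibrium q3_edges fst snd q3_weight q3_point"
    unfolding in_equilibrium_def
    by (simp add: q3_edges_def q3_weight_def q3_point_def vec_eq_iff forall_3)
  show "pos_energy_on (\<lambda>_. True) {0, 1, 2, 3, 4, 5, 6, 7} q3_edges fst snd q3_weight q3_point"
    unfolding pos_energy_on_def
  proof (intro allI impI conjI)
    fix x :: "int \<Rightarrow> real"
    show "0 \<le> energy q3_edges fst snd q3_weight x" unfolding q3_energy by simp
    assume "energy q3_edges fst snd q3_weight x = 0"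
    then have "- x 1 + x 2 - 3 * x 3 + 3 * x 4 = 0" "- x 0 + x 2 + 3 * x 3 - 3 * x 5 = 0" "- x 0
          + x 1 - 3 * x 3 + 3 * x 6 = 0" "- x 0 - x 1 - x 2 + 3 * x 7 = 0"
      unfolding q3_energy by (simp_all add: add_nonneg_eq_0_iff)
    then show "\<exists>a b. \<forall>i\<in>{0, 1, 2, 3, 4, 5, 6, 7}. x i = a \<bullet> q3_point i + b"
      by (intro exI[of _ "vector [(x 0 - x 3) / 3, (x 1 - x 3) / 3, (x 2 - x 3) / 3]"] exI[of _ "x 3"])
        (simp add: q3_point_def inner_vec_def sum_3 field_simps)
  qed
  show "affinely_spanning {0, 1, 2, 3, 4, 5, 6, 7} q3_point"
    unfolding affinely_spanning_def
    by (simp add: q3_point_def inner_vec_def sum_3 vec_eq_iff forall_3)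
  show "conic_free q3_edges fst snd q3_point"
    unfolding conic_free_def
  proof (intro allI impI)
    fix S :: "real ^ 3 ^ 3"
    assume "transpose S = S"
      and S: "\<forall>e\<in>q3_edges. edge_diff fst snd q3_point e \<bullet> (S *v edge_diff fst snd q3_point e) = 0"
    then have sym: "S $ 2 $ 1 = S $ 1 $ 2" "S $ 3 $ 1 = S $ 1 $ 3" "S $ 3 $ 2 = S $ 2 $ 3"
      by (auto simp: transpose_def vec_eq_iff)
    show "S = 0"
      using S by (simp add: q3_edges_def q3_point_def inner_vec_def matrix_vector_mult_def sum_3 sym
        vec_eq_iff forall_3 algebra_simps)
  qed
qed

lemma q3_generic_stress: "generic_stress {0, 1, 2, 3, 4, 5, 6, 7} q3_edges fst snd q3_weight q3_point"
proof -
  have nz: "\<forall>e\<in>q3_edges. q3_weight e \<noteq> 0"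
    by (simp add: q3_edges_def q3_weight_def)
  have inj: "inj_on q3_point {0, 1, 2, 3, 4, 5, 6, 7}"
    by (simp add: q3_point_def vec_eq_iff forall_3)
  have force: "\<forall>i\<in>{0, 1, 2, 3, 4, 5, 6, 7}. \<forall>F. F \<noteq> {} \<longrightarrow> F \<subset> incident q3_edges fst snd i \<longrightarrow>
      force fst snd q3_weight q3_point F i \<noteq> 0"
  proof (intro ballI allI impI, elim insertE emptyE; hypsubst)
    show "force fst snd q3_weight q3_point F 0 \<noteq> 0" if "F \<noteq> {}" "F \<subset> incident q3_edges fst snd 0" for F
      by (rule force_ne_zeroI[OF _ _ _ _ that, where es = "[(0, 5), (0, 6), (0, 7)]"
        and c = "vector [-1, 0, 0]" and ks = "[4, -2, -2]"])
        (auto simp: incident_def q3_edges_def q3_weight_def q3_point_def inner_vec_def sum_3 indicator_def)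
    show "force fst snd q3_weight q3_point F 1 \<noteq> 0" if "F \<noteq> {}" "F \<subset> incident q3_edges fst snd 1" for F
      by (rule force_ne_zeroI[OF _ _ _ _ that, where es = "[(1, 4), (1, 6), (1, 7)]"
        and c = "vector [0, -1, 0]" and ks = "[-2, 4, -2]"])
        (auto simp: incident_def q3_edges_def q3_weight_def q3_point_def inner_vec_def sum_3 indicator_def)
    show "force fst snd q3_weight q3_point F 2 \<noteq> 0" if "F \<noteq> {}" "F \<subset> incident q3_edges fst snd 2" for F
      by (rule force_ne_zeroI[OF _ _ _ _ that, where es = "[(2, 4), (2, 5), (2, 7)]"
        and c = "vector [0, 0, -1]" and ks = "[4, -2, -2]"])
        (auto simp: incident_def q3_edges_def q3_weight_def q3_point_def inner_vec_def sum_3 indicator_def)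
    show "force fst snd q3_weight q3_point F 3 \<noteq> 0" if "F \<noteq> {}" "F \<subset> incident q3_edges fst snd 3" for F
      by (rule force_ne_zeroI[OF _ _ _ _ that, where es = "[(3, 4), (3, 5), (3, 6)]"
        and c = "vector [-1, 0, 1]" and ks = "[3, -6, 3]"])
        (auto simp: incident_def q3_edges_def q3_weight_def q3_point_def inner_vec_def sum_3 indicator_def)
    show "force fst snd q3_weight q3_point F 4 \<noteq> 0" if "F \<noteq> {}" "F \<subset> incident q3_edges fst snd 4" for F
      by (rule force_ne_zeroI[OF _ _ _ _ that, where es = "[(1, 4), (2, 4), (3, 4)]"
        and c = "vector [0, -1, 0]" and ks = "[2, 1, -3]"])
        (auto simp: incident_def q3_edges_def q3_weight_def q3_point_def inner_vec_def sum_3 indicator_def)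
    show "force fst snd q3_weight q3_point F 5 \<noteq> 0" if "F \<noteq> {}" "F \<subset> incident q3_edges fst snd 5" for F
      by (rule force_ne_zeroI[OF _ _ _ _ that, where es = "[(0, 5), (2, 5), (3, 5)]"
        and c = "vector [-1, 0, 0]" and ks = "[-4, 1, 3]"])
        (auto simp: incident_def q3_edges_def q3_weight_def q3_point_def inner_vec_def sum_3 indicator_def)
    show "force fst snd q3_weight q3_point F 6 \<noteq> 0" if "F \<noteq> {}" "F \<subset> incident q3_edges fst snd 6" for F
      by (rule force_ne_zeroI[OF _ _ _ _ that, where es = "[(0, 6), (1, 6), (3, 6)]"
        and c = "vector [-1, 0, 0]" and ks = "[2, 1, -3]"])
        (auto simp: incident_def q3_edges_def q3_weight_def q3_point_def inner_vec_def sum_3 indicator_def)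
    show "force fst snd q3_weight q3_point F 7 \<noteq> 0" if "F \<noteq> {}" "F \<subset> incident q3_edges fst snd 7" for F
      by (rule force_ne_zeroI[OF _ _ _ _ that, where es = "[(0, 7), (1, 7), (2, 7)]"
        and c = "vector [-1, 0, 0]" and ks = "[2, -1, -1]"])
        (auto simp: incident_def q3_edges_def q3_weight_def q3_point_def inner_vec_def sum_3 indicator_def)
  qed
  from nz inj force show ?thesis unfolding generic_stress_def by blast
qed

section \<open>Minors of multigraphs\<close>

definition mgraph_adj :: "('v, 'e) mgraph \<Rightarrow> 'v \<Rightarrow> 'v \<Rightarrow> bool" where
  "mgraph_adj G x y \<longleftrightarrow> (\<exists>e. joins G e x y)"

lemma mgraph_adj_sym: "mgraph_adj G x y \<Longrightarrow> mgraph_adj G y x"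
  by (auto simp: mgraph_adj_def joins_def insert_commute)

lemma multigraph_ends:
  assumes "multigraph G" "e \<in> edges G"
  obtains a b where "ends G e = {a, b}" "a \<noteq> b" "a \<in> verts G" "b \<in> verts G"
proof -
  have "card (ends G e) = 2" and sub: "ends G e \<subseteq> verts G"
    using assms by (auto simp: multigraph_def)
  then obtain a b where "ends G e = {a, b}" "a \<noteq> b" by (meson card_2_iff)
  then show thesis using that sub by auto
qed

lemma mgraph_adj_verts: "multigraph G \<Longrightarrow> mgraph_adj G x y \<Longrightarrow> x \<in> verts G \<and> y \<in> verts G \<and> x \<noteq> y"
  by (auto simp: mgraph_adj_def joins_def doubleton_eq_iff elim!: multigraph_ends)

lemma cut_connected_singleton: "cut_connected R {x}"
  by (auto simp: cut_connected_def subset_singleton_iff)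

lemma cut_connected_insertI:
  assumes "\<exists>a\<in>X. R a b \<and> R b a" "cut_connected R X"
  shows "cut_connected R (insert b X)"
  unfolding cut_connected_def
proof (intro allI impI)
  fix A assume A: "A \<subseteq> insert b X" "A \<noteq> {}" "A \<noteq> insert b X"
  obtain a where a: "a \<in> X" "R a b" "R b a" using assms(1) by blast
  show "\<exists>x\<in>A. \<exists>y\<in>insert b X - A. R x y"
  proof (cases "a \<in> A \<longleftrightarrow> b \<in> A")
    case False
    then show ?thesis using a by blast
  next
    case True
    then have "A \<inter> X \<subseteq> X" "A \<inter> X \<noteq> {}" "A \<inter> X \<noteq> X" using A a(1) by auto
    from cut_connectedD[OF assms(2) this] show ?thesis by blast
  qed
qed

lemma cut_connected_mono:
  assumes "cut_connected R X" "\<And>a b. R a b \<Longrightarrow> R' a b"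
  shows "cut_connected R' X"
  using assms unfolding cut_connected_def by meson

lemma connected_graph_cut_connected:
  assumes "connected_graph G" "multigraph G"
  shows "cut_connected (mgraph_adj G) (verts G)"
  unfolding cut_connected_def
proof (intro allI impI)
  fix A assume A: "A \<subseteq> verts G" "A \<noteq> {}" "A \<noteq> verts G"
  then obtain a b where ab: "a \<in> A" "b \<in> verts G - A" by blast
  then have "(a, b) \<in> {(a, b). \<exists>e. joins G e a b}\<^sup>*"
    using assms(1) A(1) unfolding connected_graph_def by blast
  then have "b \<notin> A \<longrightarrow> (\<exists>x\<in>A. \<exists>y. y \<notin> A \<and> mgraph_adj G x y)"
    using ab(1) by (induction rule: rtrancl_induct) (auto simp: mgraph_adj_def)
  then show "\<exists>a\<in>A. \<exists>b\<in>verts G - A. mgraph_adj G a b"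
    using ab(2) mgraph_adj_verts[OF assms(2)] by blast
qed

lemma multigraph_delete_vertex: "multigraph G \<Longrightarrow> multigraph (delete_vertex G v)"
  by (auto simp: multigraph_def delete_vertex_def)

lemma multigraph_delete_edge: "multigraph G \<Longrightarrow> multigraph (delete_edge G e)"
  by (auto simp: multigraph_def delete_edge_def)

lemma multigraph_contract:
  assumes "multigraph G" "joins G e0 u v"
  shows "multigraph (contract G u v)"
proof -
  have uv: "u \<in> verts G" "v \<in> verts G" "u \<noteq> v"
    using mgraph_adj_verts[OF assms(1), of u v] assms(2) by (auto simp: mgraph_adj_def)
  have "(\<lambda>x. if x = v then u else x) ` ends G e \<subseteq> verts G - {v} \<and>
      card ((\<lambda>x. if x = v then u else x) ` ends G e) = 2"
    if e: "e \<in> edges G" "ends G e \<noteq> {u, v}" for e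
  proof -
    obtain a b where ab: "ends G e = {a, b}" "a \<noteq> b" "a \<in> verts G" "b \<in> verts G"
      using multigraph_ends[OF assms(1) e(1)] .
    have "\<not> (a = u \<and> b = v)" "\<not> (a = v \<and> b = u)" using ab(1) e(2) by auto
    then have "(if a = v then u else a) \<noteq> (if b = v then u else b)" using ab(2) uv by auto
    moreover have "(\<lambda>x. if x = v then u else x) ` ends G e = {if a = v then u else a, if b = v then u else b}"
      unfolding ab(1) by (simp only: image_insert image_empty)
    ultimately show ?thesis using ab uv by auto
  qed
  then show ?thesis using assms(1) by (auto simp: multigraph_def contract_def)
qed

lemma mgraph_adj_contract:
  assumes "multigraph G" "mgraph_adj (contract G u v) a b"
  obtains a0 b0 where "mgraph_adj G a0 b0" "(if a0 = v then u else a0) = a" "(if b0 = v then u else b0) = b"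
proof -
  obtain e where e: "e \<in> edges G" "(\<lambda>x. if x = v then u else x) ` ends G e = {a, b}"
    using assms(2) by (auto simp: mgraph_adj_def joins_def contract_def)
  obtain c d where cd: "ends G e = {c, d}"
    using multigraph_ends[OF assms(1) e(1)] by metis
  then have "mgraph_adj G c d" "mgraph_adj G d c"
    using e(1) by (auto simp: mgraph_adj_def joins_def insert_commute)
  moreover have "{if c = v then u else c, if d = v then u else d} = {a, b}"
    using e(2) unfolding cd by (simp only: image_insert image_empty)
  ultimately show thesis using that[of c d] that[of d c] unfolding doubleton_eq_iff by blast
qed

lemma minor_model_mono:
  assumes "minor_model V A W R \<phi>" "\<And>a b. A a b \<Longrightarrow> A' a b"
  shows "minor_model V A' W R \<phi>"
  using assms cut_connected_mono[of A _ A'] unfolding minor_model_def by meson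

text \<open>Uncontracting puts \<open>v\<close> into the branch set of \<open>u\<close>, if there is
  one. A cut separating \<open>u\<close> from \<open>v\<close> is crossed by the edge between them;
  any other cut comes from a cut in the contraction, whose crossing edge lifts.\<close>

lemma minor_model_contract:
  assumes G: "multigraph G" and uv: "mgraph_adj G u v"
    and D: "D \<subseteq> verts (contract G u v)" and model: "minor_model D (mgraph_adj (contract G u v)) W R \<phi>"
  shows "\<exists>D\<subseteq>verts G. \<exists>\<phi>. minor_model D (mgraph_adj G) W R \<phi>"
proof -
  define m where "m x = (if x = v then u else x)" for x
  define D' where "D' = {x \<in> verts G. m x \<in> D}"
  have uv': "u \<in> verts G" "v \<in> verts G" "u \<noteq> v" using mgraph_adj_verts[OF G uv] by auto
  have Dv: "D \<subseteq> verts G" "v \<notin> D" using D by (auto simp: contract_def)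
  have mD: "x \<in> D' \<and> m x = x" if "x \<in> D" for x using that Dv by (auto simp: m_def D'_def)
  have D'm: "m x \<in> D" if "x \<in> D'" for x using that by (simp add: D'_def)
  have lift: "\<exists>x y. mgraph_adj G x y \<and> m x = a \<and> m y = b" if "mgraph_adj (contract G u v) a b" for a b
    using mgraph_adj_contract[OF G that] unfolding m_def by metis
  have D'I: "x \<in> D'" if "mgraph_adj G x y \<or> mgraph_adj G y x" "m x \<in> D" for x y
    using that mgraph_adj_verts[OF G] by (auto simp: D'_def)
  have "minor_model D' (mgraph_adj G) W R (\<phi> \<circ> m)"
    unfolding minor_model_def
  proof (intro conjI ballI impI)
    have "m ` D' = D" using mD D'm by force
    then show "(\<phi> \<circ> m) ` D' = W" using model unfolding image_comp[symmetric] minor_model_def by simp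
  next
    fix h assume "h \<in> W"
    then have conn: "cut_connected (mgraph_adj (contract G u v)) {x \<in> D. \<phi> x = h}"
      using model by (simp add: minor_model_def)
    show "cut_connected (mgraph_adj G) {x \<in> D'. (\<phi> \<circ> m) x = h}"
      unfolding cut_connected_def
    proof (intro allI impI)
      let ?F = "{x \<in> D'. (\<phi> \<circ> m) x = h}"
      fix A assume A: "A \<subseteq> ?F" "A \<noteq> {}" "A \<noteq> ?F"
      show "\<exists>a\<in>A. \<exists>b\<in>?F - A. mgraph_adj G a b"
      proof (cases "u \<in> ?F \<and> (u \<in> A \<longleftrightarrow> v \<notin> A)")
        case True
        moreover have "v \<in> ?F" using True uv' by (auto simp: D'_def m_def)
        ultimately show ?thesis using uv mgraph_adj_sym[OF uv] by blast
      next
        case False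
        have uvF: "v \<in> ?F \<longleftrightarrow> u \<in> ?F" using uv' by (auto simp: D'_def m_def)
        then have mA: "m x \<in> A \<longleftrightarrow> x \<in> A" if "x \<in> ?F" for x
          using False that by (auto simp: m_def split: if_splits)
        have mF: "m x \<in> {x \<in> D. \<phi> x = h}" if "x \<in> ?F" for x using that D'm by auto
        have FD: "{x \<in> D. \<phi> x = h} \<subseteq> ?F" using mD by auto
        let ?A = "A \<inter> {x \<in> D. \<phi> x = h}"
        have "?A \<noteq> {}"
        proof -
          obtain x where "x \<in> A" using A(2) by blast
          then have "m x \<in> ?A" using mA[of x] mF[of x] A(1) by blast
          then show ?thesis by blast
        qed
        moreover have "?A \<noteq> {x \<in> D. \<phi> x = h}"
        proof -
          obtain x where "x \<in> ?F - A" using A(1,3) by blast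
          then have "m x \<notin> ?A" "m x \<in> {x \<in> D. \<phi> x = h}" using mA[of x] mF[of x] by blast+
          then show ?thesis by blast
        qed
        ultimately obtain a b where ab: "a \<in> ?A" "b \<in> {x \<in> D. \<phi> x = h} - ?A" "mgraph_adj (contract G u v) a b"
          using cut_connectedD[OF conn _ \<open>?A \<noteq> {}\<close>] by blast
        then obtain x y where xy: "mgraph_adj G x y" "m x = a" "m y = b" using lift by blast
        have "x \<in> ?F" "y \<in> ?F" using D'I[of x y] D'I[of y x] xy ab by auto
        then have "x \<in> A" "y \<in> ?F - A" using mA[of x] mA[of y] xy(2,3) ab(1,2) by auto
        then show ?thesis using xy(1) by blast
      qed
    qed
  next
    fix h h' assume "h \<in> W" "h' \<in> W" "R h h'"
    then obtain a b where ab: "a \<in> D" "b \<in> D" "\<phi> a = h" "\<phi> b = h'" "mgraph_adj (contract G u v) a b"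
      using model unfolding minor_model_def by blast
    then obtain x y where xy: "mgraph_adj G x y" "m x = a" "m y = b" using lift by blast
    then have "x \<in> D'" "y \<in> D'" using D'I[of x y] D'I[of y x] ab(1,2) by auto
    then show "\<exists>x\<in>D'. \<exists>y\<in>D'. (\<phi> \<circ> m) x = h \<and> (\<phi> \<circ> m) y = h' \<and> mgraph_adj G x y"
      using xy ab by (intro bexI[of _ x] bexI[of _ y]) auto
  qed
  moreover have "D' \<subseteq> verts G" by (auto simp: D'_def)
  ultimately show ?thesis by blast
qed

lemma minor_model_of_iso:
  assumes "multigraph K" "mgraph_iso K H"
  shows "\<exists>\<phi>. minor_model (verts K) (mgraph_adj K) (verts H) (mgraph_adj H) \<phi>"
proof -
  obtain f g where f: "bij_betw f (verts K) (verts H)" and g: "bij_betw g (edges K) (edges H)"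
    and fg: "\<And>e. e \<in> edges K \<Longrightarrow> ends H (g e) = f ` ends K e"
    using assms(2) unfolding mgraph_iso_def by blast
  have "minor_model (verts K) (mgraph_adj K) (verts H) (mgraph_adj H) f"
    unfolding minor_model_def
  proof (intro conjI ballI impI)
    show "f ` verts K = verts H" using f by (simp add: bij_betw_def)
  next
    fix h assume "h \<in> verts H"
    then have "h \<in> f ` verts K" using f by (simp add: bij_betw_def)
    then obtain x where x: "x \<in> verts K" "f x = h" by blast
    then have "{x \<in> verts K. f x = h} = {x}" using f by (auto simp: bij_betw_def inj_on_def)
    then show "cut_connected (mgraph_adj K) {x \<in> verts K. f x = h}" by (simp add: cut_connected_singleton)
  next
    fix h h' assume "mgraph_adj H h h'"
    then obtain e' where e': "e' \<in> edges H" "ends H e' = {h, h'}" by (auto simp: mgraph_adj_def joins_def)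
    then obtain e where e: "e \<in> edges K" "e' = g e" using g by (auto simp: bij_betw_def)
    obtain a b where ab: "ends K e = {a, b}" "a \<in> verts K" "b \<in> verts K"
      using multigraph_ends[OF assms(1) e(1)] by metis
    have "{f a, f b} = {h, h'}" using fg[OF e(1)] ab(1) e' e(2) by simp
    moreover have "mgraph_adj K a b" "mgraph_adj K b a"
      using e(1) ab(1) by (auto simp: mgraph_adj_def joins_def insert_commute)
    ultimately show "\<exists>x\<in>verts K. \<exists>y\<in>verts K. f x = h \<and> f y = h' \<and> mgraph_adj K x y"
      using ab(2,3) unfolding doubleton_eq_iff by blast
  qed
  then show ?thesis by blast
qed

text \<open>The steps are undone from the minor back to \<open>G\<close>, starting with singleton
  branch sets. The set \<open>D\<close> may be smaller than the vertex set because of deleted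
  vertices.\<close>

lemma minor_model_of_has_minor:
  assumes "multigraph G" "has_minor G H"
  shows "\<exists>D\<subseteq>verts G. \<exists>\<phi>. minor_model D (mgraph_adj G) (verts H) (mgraph_adj H) \<phi>"
proof -
  obtain K where K: "minor_step\<^sup>*\<^sup>* G K" "mgraph_iso K H" using assms(2) unfolding has_minor_def by blast
  from K(1) assms(1) show ?thesis
  proof (induction rule: converse_rtranclp_induct)
    case base
    then show ?case using minor_model_of_iso K(2) by blast
  next
    case (step G G')
    from step(1) show ?case
    proof cases
      case (1 e)
      then have "\<exists>D\<subseteq>verts G'. \<exists>\<phi>. minor_model D (mgraph_adj G') (verts H) (mgraph_adj H) \<phi>"
        using step.IH multigraph_delete_edge[OF step.prems] by simp
      moreover have "verts G' \<subseteq> verts G" using 1 by (simp add: delete_edge_def)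
      moreover have "mgraph_adj G a b" if "mgraph_adj G' a b" for a b
        using that 1 by (auto simp: mgraph_adj_def joins_def delete_edge_def)
      ultimately show ?thesis
        using minor_model_mono[of _ "mgraph_adj G'" _ _ _ "mgraph_adj G"] by (meson subset_trans)
    next
      case (2 v)
      then have "\<exists>D\<subseteq>verts G'. \<exists>\<phi>. minor_model D (mgraph_adj G') (verts H) (mgraph_adj H) \<phi>"
        using step.IH multigraph_delete_vertex[OF step.prems] by simp
      moreover have "verts G' \<subseteq> verts G" using 2 by (auto simp: delete_vertex_def)
      moreover have "mgraph_adj G a b" if "mgraph_adj G' a b" for a b
        using that 2 by (auto simp: mgraph_adj_def joins_def delete_vertex_def)
      ultimately show ?thesis
        using minor_model_mono[of _ "mgraph_adj G'" _ _ _ "mgraph_adj G"] by (meson subset_trans)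
    next
      case (3 e u v)
      then have "\<exists>D\<subseteq>verts G'. \<exists>\<phi>. minor_model D (mgraph_adj G') (verts H) (mgraph_adj H) \<phi>"
        using step.IH multigraph_contract[OF step.prems] by simp
      moreover have "mgraph_adj G u v" using 3 by (auto simp: mgraph_adj_def)
      ultimately show ?thesis using minor_model_contract[OF step.prems] 3(1) by blast
    qed
  qed
qed

text \<open>Connectedness provides an uncovered vertex next to \<open>D\<close>, which is absorbed
  into the branch set of its neighbour; this repeats until the model is spanning.\<close>

lemma minor_model_extend:
  assumes "finite V" "cut_connected A V" "\<And>a b. A a b \<Longrightarrow> A b a" "W \<noteq> {}"
    and "D \<subseteq> V" "minor_model D A W R \<phi>"
  shows "\<exists>\<phi>. minor_model V A W R \<phi>"
  using assms(5,6)
proof (induction "card (V - D)" arbitrary: D \<phi> rule: less_induct)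
  case less
  show ?case
  proof (cases "D = V")
    case True
    then show ?thesis using less.prems(2) by blast
  next
    case False
    have "D \<noteq> {}" using less.prems(2) assms(4) by (auto simp: minor_model_def)
    then obtain a b where ab: "a \<in> D" "b \<in> V - D" "A a b"
      using cut_connectedD[OF assms(2) less.prems(1)] False by blast
    have model: "\<phi> ` D = W" "\<And>h. h \<in> W \<Longrightarrow> cut_connected A {x \<in> D. \<phi> x = h}"
      "\<And>h h'. \<lbrakk>h \<in> W; h' \<in> W; R h h'\<rbrakk> \<Longrightarrow> \<exists>x\<in>D. \<exists>y\<in>D. \<phi> x = h \<and> \<phi> y = h' \<and> A x y"
      using less.prems(2) by (auto simp: minor_model_def)
    let ?\<phi> = "\<phi>(b := \<phi> a)"
    have "minor_model (insert b D) A W R ?\<phi>"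
      unfolding minor_model_def
    proof (intro conjI ballI impI)
      show "?\<phi> ` insert b D = W" using model(1) ab by auto
    next
      fix h assume h: "h \<in> W"
      have "{x \<in> insert b D. ?\<phi> x = h} = (if h = \<phi> a then insert b {x \<in> D. \<phi> x = h} else {x \<in> D. \<phi> x = h})"
        using ab by auto
      then show "cut_connected A {x \<in> insert b D. ?\<phi> x = h}"
        using model(2)[OF h] ab assms(3) by (auto intro!: cut_connected_insertI)
    next
      fix h h' assume "h \<in> W" "h' \<in> W" "R h h'"
      then obtain x y where "x \<in> D" "y \<in> D" "\<phi> x = h" "\<phi> y = h'" "A x y" using model(3) by blast
      then show "\<exists>x\<in>insert b D. \<exists>y\<in>insert b D. ?\<phi> x = h \<and> ?\<phi> y = h' \<and> A x y"
        using ab by (intro bexI[of _ x] bexI[of _ y]) auto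
    qed
    moreover have "card (V - insert b D) < card (V - D)"
      using ab assms(1) by (intro psubset_card_mono) auto
    ultimately show ?thesis using less.hyps less.prems(1) ab(2) by (metis DiffD1 insert_subset)
  qed
qed

lemma minor_model_relabel:
  assumes "minor_model V A W R \<phi>" "bij_betw \<xi> W' W"
    and "\<And>i j. \<lbrakk>i \<in> W'; j \<in> W'; R' i j\<rbrakk> \<Longrightarrow> R (\<xi> i) (\<xi> j)"
  shows "minor_model V A W' R' (inv_into W' \<xi> \<circ> \<phi>)"
proof -
  let ?\<eta> = "inv_into W' \<xi>"
  have \<eta>: "?\<eta> h = i \<longleftrightarrow> h = \<xi> i" if "h \<in> W" "i \<in> W'" for h i
    using assms(2) that by (auto simp: bij_betw_def inv_into_f_f f_inv_into_f)
  have \<xi>: "\<xi> i \<in> W" if "i \<in> W'" for i using assms(2) that by (auto simp: bij_betw_def)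
  have \<phi>: "\<phi> x \<in> W" if "x \<in> V" for x using assms(1) that by (auto simp: minor_model_def)
  show ?thesis
    unfolding minor_model_def
  proof (intro conjI ballI impI)
    have "?\<eta> ` W = W'" using bij_betw_inv_into[OF assms(2)] by (simp add: bij_betw_def)
    then show "(?\<eta> \<circ> \<phi>) ` V = W'" using assms(1) unfolding image_comp[symmetric] minor_model_def by simp
  next
    fix i assume i: "i \<in> W'"
    have "{x \<in> V. (?\<eta> \<circ> \<phi>) x = i} = {x \<in> V. \<phi> x = \<xi> i}" using \<eta> \<phi> i by auto
    then show "cut_connected A {x \<in> V. (?\<eta> \<circ> \<phi>) x = i}"
      using assms(1) \<xi>[OF i] by (simp add: minor_model_def)
  next
    fix i j assume ij: "i \<in> W'" "j \<in> W'" "R' i j"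
    have "\<forall>h\<in>W. \<forall>h'\<in>W. R h h' \<longrightarrow> (\<exists>x\<in>V. \<exists>y\<in>V. \<phi> x = h \<and> \<phi> y = h' \<and> A x y)"
      using assms(1) by (simp add: minor_model_def)
    from this[rule_format, OF \<xi>[OF ij(1)] \<xi>[OF ij(2)] assms(3)[OF ij]]
    obtain x y where xy: "x \<in> V" "y \<in> V" "\<phi> x = \<xi> i" "\<phi> y = \<xi> j" "A x y" by blast
    then have "?\<eta> (\<phi> x) = i" "?\<eta> (\<phi> y) = j" using \<eta> \<phi> \<xi> ij by auto
    then show "\<exists>x\<in>V. \<exists>y\<in>V. (?\<eta> \<circ> \<phi>) x = i \<and> (?\<eta> \<circ> \<phi>) y = j \<and> A x y"
      unfolding o_apply using xy by blast
  qed
qed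

section \<open>From oriented stresses back to tensegrities\<close>

lemma super_stable_of_realizable:
  fixes G :: "('v::finite, 'e) mgraph"
  assumes G: "multigraph G" and ends: "\<And>e. e \<in> edges G \<Longrightarrow> ends G e = {s e, t e} \<and> s e \<noteq> t e"
    and "realizable (verts G) (edges G) s t"
  shows "\<exists>(\<sigma> :: 'e \<Rightarrow> real) (p :: 'v \<Rightarrow> real ^ 3).
    tensegrity G \<sigma> p \<and> injective_realization G p \<and> super_stable G \<sigma> p"
proof -
  let ?V = "verts G" and ?E = "edges G"
  obtain w p where ss: "superstable_stress ?V ?E s t w p" and gen: "generic_stress ?V ?E s t w p"
    using assms(3) unfolding realizable_def by blast
  have eq: "in_equilibrium ?E s t w p" and psd: "pos_energy_on (\<lambda>x. True) ?V ?E s t w p"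
    and aff: "affinely_spanning ?V p" and con: "conic_free ?E s t p"
    using ss by (auto simp: superstable_stress_def)
  have fin: "finite ?E" using G by (simp add: multigraph_def)
  have st: "s e \<in> ?V" "t e \<in> ?V" if "e \<in> ?E" for e using G ends[OF that] that by (auto simp: multigraph_def)
  let ?d = "\<lambda>e i. edge_diff s t (indicator {i}) e :: real"
  have lap_nth: "laplacian G w $ i $ j = (\<Sum>e\<in>?E. w e * (?d e i * ?d e j))" for i j
  proof -
    have "edge_matrix G e $ i $ j = ?d e i * ?d e j" if "e \<in> ?E" for e
    proof -
      have "(axis (s e) 1 - axis (t e) 1 :: real ^ 'v) $ k = ?d e k" for k
        by (simp add: axis_def indicator_def)
      then show ?thesis
        using ends[OF that] by (simp add: edge_matrix_eq matrix_matrix_mult_def columnvector_def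
          rowvector_def)
    qed
    then show ?thesis by (simp add: laplacian_def)
  qed
  have sum_d: "(\<Sum>j\<in>UNIV. ?d e j * x $ j) = edge_diff s t (($) x) e" for e and x :: "real ^ 'v"
    by (simp add: left_diff_distrib sum_subtractf indicator_def if_distrib[of "\<lambda>a. a * _"] cong: if_cong)
  have lap_mult: "(laplacian G w *v x) $ i = (\<Sum>e\<in>?E. (w e * ?d e i) * edge_diff s t (($) x) e)" for x i
  proof -
    have "(laplacian G w *v x) $ i = (\<Sum>e\<in>?E. \<Sum>j\<in>UNIV. w e * (?d e i * ?d e j) * x $ j)"
      unfolding matrix_vector_mult_def by (simp add: lap_nth sum_distrib_right sum.swap[of _ ?E])
    also have "\<dots> = (\<Sum>e\<in>?E. (w e * ?d e i) * (\<Sum>j\<in>UNIV. ?d e j * x $ j))"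
      by (simp add: sum_distrib_left mult.assoc)
    finally show ?thesis unfolding sum_d .
  qed
  have form: "x \<bullet> (laplacian G w *v x) = energy ?E s t w (($) x)" for x
  proof -
    have "x \<bullet> (laplacian G w *v x) = (\<Sum>e\<in>?E. \<Sum>i\<in>UNIV. x $ i * ((w e * ?d e i) * edge_diff s t (($) x) e))"
      unfolding inner_vec_def by (simp add: lap_mult sum_distrib_left sum.swap[of _ ?E])
    also have "\<dots> = (\<Sum>e\<in>?E. w e * edge_diff s t (($) x) e * (\<Sum>i\<in>UNIV. ?d e i * x $ i))"
      unfolding sum_distrib_left by (intro sum.cong) (auto simp: mult_ac)
    finally show ?thesis unfolding sum_d energy_def power2_eq_square by (simp add: mult.assoc)
  qed
  have psdL: "pos_semidef (laplacian G w)"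
    unfolding pos_semidef_def
  proof (intro conjI allI)
    show "transpose (laplacian G w) = laplacian G w"
      by (simp add: transpose_def vec_eq_iff lap_nth mult.commute)
    show "x \<bullet> (laplacian G w *v x) \<ge> 0" for x
      using psd unfolding form pos_energy_on_def by simp
  qed
  define f :: "(real ^ 3) \<times> real \<Rightarrow> real ^ 'v" where
    "f = (\<lambda>(a, b). \<chi> i. if i \<in> ?V then a \<bullet> p i + b else 0)"
  have f_lin: "linear f"
    unfolding f_def by (rule linearI) (auto simp: vec_eq_iff algebra_simps inner_add_left)
  have "inj f"
  proof -
    have "x = 0" if "f x = 0" for x
    proof -
      obtain a b where x: "x = (a, b)" by fastforce
      have "\<forall>i\<in>?V. a \<bullet> p i + b = 0"
        using that unfolding x f_def vec_eq_iff by (auto split: if_splits dest: spec)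
      then show ?thesis using aff x unfolding affinely_spanning_def by (simp add: zero_prod_def)
    qed
    then show ?thesis using f_lin by (simp add: linear_injective_0)
  qed
  \<comment> \<open>Vectors in the kernel have zero energy and so are affine in \<open>p\<close>;
    the converse inclusion is equilibrium at each vertex. Injectivity of \<open>f\<close> then gives
    dimension 3 + 1.\<close>
  have ker: "laplacian_kernel G w = range f"
  proof (intro set_eqI iffI)
    fix x assume x: "x \<in> laplacian_kernel G w"
    then have "energy ?E s t w (($) x) = 0" unfolding form[symmetric] laplacian_kernel_def by simp
    then obtain a b where ab: "\<forall>i\<in>?V. x $ i = a \<bullet> p i + b" using psd unfolding pos_energy_on_def by blast
    have "x = f (a, b)" using ab x by (auto simp: f_def vec_eq_iff laplacian_kernel_def)
    then show "x \<in> range f" by blast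
  next
    fix x assume "x \<in> range f"
    then obtain a b where x: "x = f (a, b)" by auto
    have "(laplacian G w *v x) $ i = 0" for i
    proof -
      have "(laplacian G w *v x) $ i = a \<bullet> (\<Sum>e\<in>?E. (w e * ?d e i) *\<^sub>R edge_diff s t p e)"
        unfolding lap_mult inner_sum_right using st
        by (intro sum.cong) (auto simp: x f_def inner_diff_right)
      then show ?thesis using eq[unfolded in_equilibrium_def, rule_format, of "indicator {i}"] by simp
    qed
    then show "x \<in> laplacian_kernel G w" by (auto simp: laplacian_kernel_def vec_eq_iff x f_def)
  qed
  have dim: "dim (laplacian_kernel G w) = CARD(3) + 1"
    unfolding ker using dim_image_eq[OF f_lin, of UNIV] \<open>inj f\<close> by (simp add: dim_UNIV)
  have equil: "equilibrium_stress G p w"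
    unfolding equilibrium_stress_def
  proof
    fix i assume i: "i \<in> ?V"
    have "(\<Sum>j\<in>?V. \<Sum>e | joins G e i j. w e *\<^sub>R (p j - p i)) =
        (\<Sum>j\<in>?V. \<Sum>e\<in>?E. if ends G e = {i, j} then w e *\<^sub>R (p j - p i) else 0)"
      using fin by (simp add: joins_def sum.inter_filter)
    also have "\<dots> = (\<Sum>e\<in>?E. \<Sum>j\<in>?V. if ends G e = {i, j} then w e *\<^sub>R (p j - p i) else 0)"
      by (rule sum.swap)
    also have "\<dots> = (\<Sum>e\<in>?E. - ((w e * ?d e i) *\<^sub>R edge_diff s t p e))"
    proof (rule sum.cong[OF refl])
      fix e assume e: "e \<in> ?E"
      have st_e: "s e \<noteq> t e" "ends G e = {s e, t e}" using ends[OF e] by auto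
      \<comment> \<open>An edge contributes for exactly one \<open>j\<close> if \<open>i\<close> is
        an end of it and for none otherwise; the minus sign appears because the force uses
        \<open>p i - p j\<close>.\<close>
      consider "i = s e" | "i = t e" | "i \<noteq> s e" "i \<noteq> t e" by blast
      then show "(\<Sum>j\<in>?V. if ends G e = {i, j} then w e *\<^sub>R (p j - p i) else 0) =
            - ((w e * ?d e i) *\<^sub>R edge_diff s t p e)"
      proof cases
        case 1
        then have "(ends G e = {i, j}) = (j = t e)" for j using st_e by (auto simp: doubleton_eq_iff)
        then show ?thesis using 1 st_e st[OF e] by (simp add: sum.delta algebra_simps)
      next
        case 2
        then have "(ends G e = {i, j}) = (j = s e)" for j using st_e by (auto simp: doubleton_eq_iff)
        then show ?thesis using 2 st_e st[OF e] by (simp add: sum.delta algebra_simps)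
      next
        case 3
        then have "(ends G e = {i, j}) = False" for j using st_e by (auto simp: doubleton_eq_iff)
        then show ?thesis using 3 by simp
      qed
    qed
    also have "\<dots> = 0"
      using eq[unfolded in_equilibrium_def, rule_format, of "indicator {i}"] by (simp add: sum_negf)
    finally show "(\<Sum>j\<in>?V. \<Sum>e | joins G e i j. w e *\<^sub>R (p j - p i)) = 0" .
  qed
  have hull: "affine hull (p ` ?V) = UNIV"
  proof (rule ccontr)
    assume "affine hull (p ` ?V) \<noteq> UNIV"
    then have "aff_dim (p ` ?V) < int DIM(real ^ 3)"
      using aff_dim_eq_full[of "p ` ?V"] aff_dim_le_DIM[of "p ` ?V"] by linarith
    then obtain a b where "a \<noteq> 0" "p ` ?V \<subseteq> {x. a \<bullet> x = b}" by (rule aff_lowdim_subset_hyperplane)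
    then have "\<forall>i\<in>?V. a \<bullet> p i + (- b) = 0" by auto
    then show False using aff \<open>a \<noteq> 0\<close> unfolding affinely_spanning_def by blast
  qed
  have nz: "\<And>e. e \<in> ?E \<Longrightarrow> w e \<noteq> 0" and inj: "inj_on p ?V" using gen by (auto simp: generic_stress_def)
  \<comment> \<open>The only place where signs are assigned: any nowhere zero stress is strictly
    proper for its own sign.\<close>
  let ?\<sigma> = "\<lambda>e. sgn (w e)"
  have "strictly_proper G ?\<sigma> w"
    unfolding strictly_proper_def
  proof
    fix e assume "e \<in> ?E"
    then show "sgn (w e) * w e > 0" using nz[of e] by (cases "w e > 0") (auto simp: sgn_if)
  qed
  moreover have "\<not> (\<exists>S :: real ^ 3 ^ 3. S \<noteq> 0 \<and> transpose S = S \<and>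
        (\<forall>e i j. joins G e i j \<longrightarrow> (p j - p i) \<bullet> (S *v (p j - p i)) = 0))"
  proof
    assume "\<exists>S :: real ^ 3 ^ 3. S \<noteq> 0 \<and> transpose S = S \<and>
        (\<forall>e i j. joins G e i j \<longrightarrow> (p j - p i) \<bullet> (S *v (p j - p i)) = 0)"
    then obtain S :: "real ^ 3 ^ 3" where S: "S \<noteq> 0" "transpose S = S"
      "\<And>e i j. joins G e i j \<Longrightarrow> (p j - p i) \<bullet> (S *v (p j - p i)) = 0" by blast
    have "\<forall>e\<in>?E. edge_diff s t p e \<bullet> (S *v edge_diff s t p e) = 0"
    proof
      fix e assume e: "e \<in> ?E"
      then have "joins G e (t e) (s e)" using ends[OF e] by (auto simp: joins_def)
      then show "edge_diff s t p e \<bullet> (S *v edge_diff s t p e) = 0" by (rule S(3))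
    qed
    then show False using con S(1,2) unfolding conic_free_def by blast
  qed
  ultimately have "super_stable G ?\<sigma> p"
    unfolding super_stable_def using hull equil psdL dim by blast
  moreover have "tensegrity G ?\<sigma> p"
    using G nz by (auto simp: tensegrity_def sgn_if)
  moreover have "injective_realization G p" using inj by (simp add: injective_realization_def)
  ultimately show ?thesis by blast
qed

text \<open>The base graph is given by integer-like labels and ordered pairs, convenient for
  computation; \<open>\<xi>\<close> ties it to \<open>H\<close>. It suffices that pairs in
  \<open>F\<close> go to edges of \<open>H\<close>, since surplus edges can be inserted
  later.\<close>

lemma super_stable_of_minor:
  fixes G :: "('v::finite, 'e) mgraph" and W :: "'i::linorder set"
  assumes G: "multigraph G" and conn: "two_connected G" and minor: "has_minor G H"
    and F: "\<And>i j. (i, j) \<in> F \<Longrightarrow> i \<in> W \<and> j \<in> W \<and> i < j"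
    and stress: "superstable_stress W F fst snd w q" "generic_stress W F fst snd w q"
    and W: "\<And>h. h \<in> W \<Longrightarrow> cut_connected (\<lambda>i j. (i, j) \<in> F \<or> (j, i) \<in> F) (W - {h})" "card W \<ge> 3"
    and \<xi>: "bij_betw \<xi> W (verts H)" "\<And>i j. (i, j) \<in> F \<Longrightarrow> mgraph_adj H (\<xi> i) (\<xi> j)"
  shows "\<exists>(\<sigma> :: 'e \<Rightarrow> real) (p :: 'v \<Rightarrow> real ^ 3).
    tensegrity G \<sigma> p \<and> injective_realization G p \<and> super_stable G \<sigma> p"
proof -
  let ?R = "\<lambda>i j. (i, j) \<in> F \<or> (j, i) \<in> F"
  have real: "realizable W F fst snd" using stress unfolding realizable_def by blast
  have "\<forall>e\<in>edges G. \<exists>a b. ends G e = {a, b} \<and> a \<noteq> b"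
    using multigraph_ends[OF G] by metis
  then obtain s t where st: "\<And>e. e \<in> edges G \<Longrightarrow> ends G e = {s e, t e} \<and> s e \<noteq> t e" by metis
  have st_V: "s e \<in> verts G \<and> t e \<in> verts G \<and> s e \<noteq> t e" if "e \<in> edges G" for e
    using G st[OF that] that by (auto simp: multigraph_def)
  have adj_eq: "adj (edges G) s t = mgraph_adj G"
    using st by (auto simp: fun_eq_iff adj_def mgraph_adj_def joins_def)
  have connG: "cut_connected (mgraph_adj G) (verts G)"
    using conn G by (simp add: two_connected_def connected_graph_cut_connected)
  have conn_del: "cut_connected (adj (edges G) s t) (verts G - {x})" if "x \<in> verts G" for x
  proof -
    have "cut_connected (mgraph_adj (delete_vertex G x)) (verts (delete_vertex G x))"
      using conn G that by (simp add: two_connected_def connected_graph_cut_connected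
        multigraph_delete_vertex)
    then have "cut_connected (mgraph_adj G) (verts (delete_vertex G x))"
      by (rule cut_connected_mono) (auto simp: mgraph_adj_def joins_def delete_vertex_def)
    then show ?thesis by (simp add: adj_eq delete_vertex_def)
  qed
  have finV: "finite (verts G)" using G by (simp add: multigraph_def)
  obtain D \<phi>0 where D: "D \<subseteq> verts G" "minor_model D (mgraph_adj G) (verts H) (mgraph_adj H) \<phi>0"
    using minor_model_of_has_minor[OF G minor] by blast
  have "W \<noteq> {}" using W(2) by auto
  then have "verts H \<noteq> {}" using \<xi>(1) by (auto simp: bij_betw_def)
  then obtain \<phi> where \<phi>: "minor_model (verts G) (mgraph_adj G) (verts H) (mgraph_adj H) \<phi>"
    using minor_model_extend[OF finV connG mgraph_adj_sym _ D] by blast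
  have "mgraph_adj H (\<xi> i) (\<xi> j)" if "?R i j" for i j
    using that
  proof
    assume "(j, i) \<in> F"
    then show ?thesis by (intro mgraph_adj_sym[OF \<xi>(2)])
  qed (rule \<xi>(2))
  then have "minor_model (verts G) (adj (edges G) s t) W ?R (inv_into W \<xi> \<circ> \<phi>)"
    unfolding adj_eq by (intro minor_model_relabel[OF \<phi> \<xi>(1)])
  moreover have "\<exists>E0\<subseteq>E. realizable V E0 s' t'"
    if "minor_model V (adj E s' t') W ?R \<phi>" "inj_on \<phi> V"
    for V :: "'v set" and E :: "'e set" and s' t' \<phi>
    using real F _ that by (rule realizable_spanning) auto
  moreover have "\<not> ?R h h" for h using F by blast
  moreover have "finite (edges G)" using G by (simp add: multigraph_def)
  ultimately have "realizable (verts G) (edges G) s t"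
    using st_V conn_del W by (intro realizable_of_minor_model[of W ?R]) auto
  then show ?thesis using super_stable_of_realizable[OF G] st by blast
qed

lemma mgraph_adj_simple_graph: "x \<in> V \<Longrightarrow> y \<in> V \<Longrightarrow> a x y \<Longrightarrow> mgraph_adj (simple_graph V a) x y"
  by (auto simp: mgraph_adj_def joins_def simple_graph_def)

section \<open>2-connectivity of the three base graphs\<close>

lemma k5_cut_connected:
  assumes "h \<in> {0, 1, 2, 3, 4}"
  shows "cut_connected (\<lambda>i j. (i, j) \<in> k5_edges \<or> (j, i) \<in> k5_edges) ({0, 1, 2, 3, 4} - {h})"
    (is "cut_connected ?R _")
proof -
  have "cut_connected ?R ({0, 1, 2, 3, 4} - {0})"
  proof -
    have "{0, 1, 2, 3, 4} - {0 :: int} = {4, 3, 2, 1}" by auto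
    then show ?thesis
      by (simp only:) (intro cut_connected_insertI cut_connected_singleton; simp add: k5_edges_def)
  qed
  moreover
  have "cut_connected ?R ({0, 1, 2, 3, 4} - {1})"
  proof -
    have "{0, 1, 2, 3, 4} - {1 :: int} = {4, 3, 2, 0}" by auto
    then show ?thesis
      by (simp only:) (intro cut_connected_insertI cut_connected_singleton; simp add: k5_edges_def)
  qed
  moreover
  have "cut_connected ?R ({0, 1, 2, 3, 4} - {2})"
  proof -
    have "{0, 1, 2, 3, 4} - {2 :: int} = {4, 3, 1, 0}" by auto
    then show ?thesis
      by (simp only:) (intro cut_connected_insertI cut_connected_singleton; simp add: k5_edges_def)
  qed
  moreover
  have "cut_connected ?R ({0, 1, 2, 3, 4} - {3})"
  proof -
    have "{0, 1, 2, 3, 4} - {3 :: int} = {4, 2, 1, 0}" by auto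
    then show ?thesis
      by (simp only:) (intro cut_connected_insertI cut_connected_singleton; simp add: k5_edges_def)
  qed
  moreover
  have "cut_connected ?R ({0, 1, 2, 3, 4} - {4})"
  proof -
    have "{0, 1, 2, 3, 4} - {4 :: int} = {3, 2, 1, 0}" by auto
    then show ?thesis
      by (simp only:) (intro cut_connected_insertI cut_connected_singleton; simp add: k5_edges_def)
  qed
  ultimately show ?thesis using assms by (elim insertE emptyE) (simp_all only:)
qed

text \<open>The remaining vertices are listed so that, reading from the right, each new vertex has a
  neighbour among those already read. The same is done for the cube.\<close>

lemma k222_cut_connected:
  assumes "h \<in> {0, 1, 2, 3, 4, 5}"
  shows "cut_connected (\<lambda>i j. (i, j) \<in> k222_edges \<or> (j, i) \<in> k222_edges) ({0, 1, 2, 3, 4, 5} - {h})"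
    (is "cut_connected ?R _")
proof -
  have "cut_connected ?R ({0, 1, 2, 3, 4, 5} - {0})"
  proof -
    have "{0, 1, 2, 3, 4, 5} - {0 :: int} = {5, 4, 3, 2, 1}" by auto
    then show ?thesis
      by (simp only:) (intro cut_connected_insertI cut_connected_singleton; simp add: k222_edges_def)
  qed
  moreover
  have "cut_connected ?R ({0, 1, 2, 3, 4, 5} - {1})"
  proof -
    have "{0, 1, 2, 3, 4, 5} - {1 :: int} = {5, 4, 3, 2, 0}" by auto
    then show ?thesis
      by (simp only:) (intro cut_connected_insertI cut_connected_singleton; simp add: k222_edges_def)
  qed
  moreover
  have "cut_connected ?R ({0, 1, 2, 3, 4, 5} - {2})"
  proof -
    have "{0, 1, 2, 3, 4, 5} - {2 :: int} = {5, 4, 1, 3, 0}" by auto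
    then show ?thesis
      by (simp only:) (intro cut_connected_insertI cut_connected_singleton; simp add: k222_edges_def)
  qed
  moreover
  have "cut_connected ?R ({0, 1, 2, 3, 4, 5} - {3})"
  proof -
    have "{0, 1, 2, 3, 4, 5} - {3 :: int} = {5, 4, 1, 2, 0}" by auto
    then show ?thesis
      by (simp only:) (intro cut_connected_insertI cut_connected_singleton; simp add: k222_edges_def)
  qed
  moreover
  have "cut_connected ?R ({0, 1, 2, 3, 4, 5} - {4})"
  proof -
    have "{0, 1, 2, 3, 4, 5} - {4 :: int} = {5, 3, 1, 2, 0}" by auto
    then show ?thesis
      by (simp only:) (intro cut_connected_insertI cut_connected_singleton; simp add: k222_edges_def)
  qed
  moreover
  have "cut_connected ?R ({0, 1, 2, 3, 4, 5} - {5})"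
  proof -
    have "{0, 1, 2, 3, 4, 5} - {5 :: int} = {4, 3, 1, 2, 0}" by auto
    then show ?thesis
      by (simp only:) (intro cut_connected_insertI cut_connected_singleton; simp add: k222_edges_def)
  qed
  ultimately show ?thesis using assms by (elim insertE emptyE) (simp_all only:)
qed

lemma q3_cut_connected:
  assumes "h \<in> {0, 1, 2, 3, 4, 5, 6, 7}"
  shows "cut_connected (\<lambda>i j. (i, j) \<in> q3_edges \<or> (j, i) \<in> q3_edges) ({0, 1, 2, 3, 4, 5, 6, 7} - {h})"
    (is "cut_connected ?R _")
proof -
  have "cut_connected ?R ({0, 1, 2, 3, 4, 5, 6, 7} - {0})"
  proof -
    have "{0, 1, 2, 3, 4, 5, 6, 7} - {0 :: int} = {7, 6, 5, 3, 2, 4, 1}" by auto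
    then show ?thesis
      by (simp only:) (intro cut_connected_insertI cut_connected_singleton; simp add: q3_edges_def)
  qed
  moreover
  have "cut_connected ?R ({0, 1, 2, 3, 4, 5, 6, 7} - {1})"
  proof -
    have "{0, 1, 2, 3, 4, 5, 6, 7} - {1 :: int} = {7, 6, 4, 3, 2, 5, 0}" by auto
    then show ?thesis
      by (simp only:) (intro cut_connected_insertI cut_connected_singleton; simp add: q3_edges_def)
  qed
  moreover
  have "cut_connected ?R ({0, 1, 2, 3, 4, 5, 6, 7} - {2})"
  proof -
    have "{0, 1, 2, 3, 4, 5, 6, 7} - {2 :: int} = {7, 6, 1, 4, 3, 5, 0}" by auto
    then show ?thesis
      by (simp only:) (intro cut_connected_insertI cut_connected_singleton; simp add: q3_edges_def)
  qed
  moreover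
  have "cut_connected ?R ({0, 1, 2, 3, 4, 5, 6, 7} - {3})"
  proof -
    have "{0, 1, 2, 3, 4, 5, 6, 7} - {3 :: int} = {7, 6, 1, 4, 2, 5, 0}" by auto
    then show ?thesis
      by (simp only:) (intro cut_connected_insertI cut_connected_singleton; simp add: q3_edges_def)
  qed
  moreover
  have "cut_connected ?R ({0, 1, 2, 3, 4, 5, 6, 7} - {4})"
  proof -
    have "{0, 1, 2, 3, 4, 5, 6, 7} - {4 :: int} = {7, 1, 6, 3, 2, 5, 0}" by auto
    then show ?thesis
      by (simp only:) (intro cut_connected_insertI cut_connected_singleton; simp add: q3_edges_def)
  qed
  moreover
  have "cut_connected ?R ({0, 1, 2, 3, 4, 5, 6, 7} - {5})"
  proof -
    have "{0, 1, 2, 3, 4, 5, 6, 7} - {5 :: int} = {7, 2, 4, 3, 1, 6, 0}" by auto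
    then show ?thesis
      by (simp only:) (intro cut_connected_insertI cut_connected_singleton; simp add: q3_edges_def)
  qed
  moreover
  have "cut_connected ?R ({0, 1, 2, 3, 4, 5, 6, 7} - {6})"
  proof -
    have "{0, 1, 2, 3, 4, 5, 6, 7} - {6 :: int} = {7, 1, 4, 3, 2, 5, 0}" by auto
    then show ?thesis
      by (simp only:) (intro cut_connected_insertI cut_connected_singleton; simp add: q3_edges_def)
  qed
  moreover
  have "cut_connected ?R ({0, 1, 2, 3, 4, 5, 6, 7} - {7})"
  proof -
    have "{0, 1, 2, 3, 4, 5, 6, 7} - {7 :: int} = {6, 1, 4, 3, 2, 5, 0}" by auto
    then show ?thesis
      by (simp only:) (intro cut_connected_insertI cut_connected_singleton; simp add: q3_edges_def)
  qed
  ultimately show ?thesis using assms by (elim insertE emptyE) (simp_all only:)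
qed


text \<open>Rewrites the Hamming distance as a sum over three coordinates, so that adjacency in the
  cube can be evaluated by simplification.\<close>

lemma card_vec3_differences:
  fixes x y :: "'a ^ 3"
  shows "card {i. x $ i \<noteq> y $ i} = (\<Sum>i\<in>UNIV. if x $ i \<noteq> y $ i then 1 else 0)"
  by (simp add: sum.If_cases)

theorem theorem4p7:
  fixes G :: "('v::finite, 'e) mgraph"
  assumes "multigraph G"
    and "two_connected G"
    and "has_minor G K5 \<or> has_minor G Q3 \<or> has_minor G K222"
  shows "\<exists>(\<sigma> :: 'e \<Rightarrow> real) (p :: 'v \<Rightarrow> real ^ 3).
    tensegrity G \<sigma> p \<and> injective_realization G p \<and> super_stable G \<sigma> p"
  using assms(3)
proof (elim disjE)
  assume "has_minor G K5"
  then show ?thesis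
  proof (rule super_stable_of_minor[OF assms(1,2) _ _ k5_superstable_stress k5_generic_stress
    k5_cut_connected])
    have "nat ` {0, 1, 2, 3, 4} = {..<5}" by auto
    then show "bij_betw nat {0, 1, 2, 3, 4} (verts K5)"
      by (simp add: bij_betw_def K5_def simple_graph_def)
    show "mgraph_adj K5 (nat i) (nat j)" if "(i, j) \<in> k5_edges" for i j
      unfolding K5_def by (rule mgraph_adj_simple_graph) (use that in \<open>auto simp: k5_edges_def\<close>)
  qed (auto simp: k5_edges_def)
next
  assume "has_minor G Q3"
  \<comment> \<open>Each label goes to the set of coordinates that are true: subsets of even size
    for 0 to 3, and for \<open>i + 4\<close> the complement of the set of \<open>i\<close>. The
    default value \<open>{}\<close> serves label 0.\<close>
  let ?\<xi> = "\<lambda>i :: int. (\<chi> k :: 3. k \<in> ((\<lambda>_. {})(1 := {2, 3}, 2 := {1, 3}, 3 := {1, 2}, 4 := {1, 2, 3},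
    5 := {1}, 6 := {2}, 7 := {3})) i)"
  from \<open>has_minor G Q3\<close> show ?thesis
  proof (rule super_stable_of_minor[OF assms(1,2) _ _ q3_superstable_stress q3_generic_stress
    q3_cut_connected])
    have "x \<in> ?\<xi> ` {0, 1, 2, 3, 4, 5, 6, 7}" for x
      by (cases "x $ 1"; cases "x $ 2"; cases "x $ 3") (simp_all add: vec_eq_iff forall_3)
    then have "?\<xi> ` {0, 1, 2, 3, 4, 5, 6, 7} = UNIV" by blast
    moreover have "inj_on ?\<xi> {0, 1, 2, 3, 4, 5, 6, 7}" by (simp add: vec_eq_iff forall_3)
    ultimately show "bij_betw ?\<xi> {0, 1, 2, 3, 4, 5, 6, 7} (verts Q3)"
      by (simp only: bij_betw_def Q3_def simple_graph_def mgraph.simps simp_thms)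
    have "\<forall>(i, j)\<in>q3_edges. card {k. ?\<xi> i $ k \<noteq> ?\<xi> j $ k} = 1"
      unfolding card_vec3_differences sum_3 q3_edges_def by simp
    then show "mgraph_adj Q3 (?\<xi> i) (?\<xi> j)" if "(i, j) \<in> q3_edges" for i j
      unfolding Q3_def by (intro mgraph_adj_simple_graph UNIV_I) (use that in blast)
  qed (auto simp: q3_edges_def)
next
  assume "has_minor G K222"
  \<comment> \<open>The quotient by two is the colour class, matching the pairs
    \<open>{0, 1}\<close>, \<open>{2, 3}\<close>, \<open>{4, 5}\<close> of nonadjacent
    vertices.\<close>
  let ?\<xi> = "\<lambda>i :: int. (nat (i div 2), nat (i mod 2))"
  from \<open>has_minor G K222\<close> show ?thesis
  proof (rule super_stable_of_minor[OF assms(1,2) _ _ k222_superstable_stress k222_generic_stress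
    k222_cut_connected])
    have "{..<3} = {0, 1, 2 :: nat}" "{..<2} = {0, 1 :: nat}" by auto
    then have "?\<xi> ` {0, 1, 2, 3, 4, 5} = {..<3} \<times> {..<2}" by auto
    then show "bij_betw ?\<xi> {0, 1, 2, 3, 4, 5} (verts K222)"
      by (simp add: bij_betw_def K222_def simple_graph_def)
    show "mgraph_adj K222 (?\<xi> i) (?\<xi> j)" if "(i, j) \<in> k222_edges" for i j
      unfolding K222_def by (rule mgraph_adj_simple_graph) (use that in \<open>auto simp: k222_edges_def\<close>)
  qed (auto simp: k222_edges_def)
qed

end
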